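(* Let $n\ge 5$ and let $\Delta_n$ be a permissible uniform flag complex on the vertex set $V_n$. Then $\Delta_n$ represents a triangulation of the boundary $\partial P_n$ of the root polytope if and only if $\Delta_n$ satisfies exactly one of the following three conditions: (1) pairs of arrows of type $THTH$ and of type $HTHT$ both do not nest, and pairs of type $HTTH$ and of type $THHT$ both do not cross; (2) pairs of type $THTH$ and of type $HTHT$ both nest, and pairs of type $HTTH$ and of type $THHT$ both cross; (3) exactly one of the types $THTH$, $HTHT$ nests; and furthermore, if pairs of both types $THHT$ and $HTTH$ cross, then pairs of both types $TTHH$ and $HHTT$ nest.
   Context: Let $e_1,\dots,e_{n+1}$ be the standard basis of $\mathbb{R}^{n+1}$. The root polytope $P_n$ is the convex hull of the points $e_j-e_i$ for $i\ne j$ in $\{1,\dots,n+1\}$. An arrow is an ordered pair $(i,j)$ with $i\neq j$ in $\{1,\dots,n+1\}$, identified with the vertex $e_j-e_i$ of $P_n$; $i$ is its tail and $j$ its head. $V_n$ denotes the set of all arrows. A simplicial complex on $V_n$ represents a triangulation of $\partial P_n$ if, identifying arrows with vertices, the convex hulls of its faces form a triangulation of $\partial P_n$ (using no new vertices). A set of arrows is admissible if it is contained in $I\times J$ for some disjoint $I,J\subseteq\{1,\dots,n+1\}$. A simplicial complex $\Delta_n$ on $V_n$ is permissible if: (i) every face is admissible; (ii) for every face, the underlying undirected graph of its arrows is a forest; (iii) for every three distinct $i,j,k$ the sets $\{(i,j),(i,k)\}$ and $\{(j,i),(k,i)\}$ are edges of $\Delta_n$; for any two disjoint pairs $\{i_1,i_2\}$,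 $\{j_1,j_2\}$ exactly one of $\{(i_1,j_1),(i_2,j_2)\}$ and $\{(i_1,j_2),(i_2,j_1)\}$ is an edge; and the $2$-skeleton of $\Delta_n$ is flag. A flag complex on $V_n$ is a uniform flag complex if whether a pair $\{(i_1,j_1),(i_2,j_2)\}$ is an edge depends only on the equalities and inequalities among $i_1,i_2,j_1,j_2$. For two arrows with four distinct endpoints $p_1<p_2<p_3<p_4$, their type is the word of length 4 obtained by writing, for $p_1,\dots,p_4$ in order, $T$ if the node is a tail and $H$ if it is a head. The pair nests if its arrows join $\{p_1,p_4\}$ and $\{p_2,p_3\}$, and crosses if they join $\{p_1,p_3\}$ and $\{p_2,p_4\}$. "Pairs of type $W$ nest" means that every nesting pair of arrows of type $W$ is an edge of the complex; "do not nest" means no nesting pair of type $W$ is an edge; "cross" and "do not cross" are defined analogously with crossing pairs. (By uniformity these hold for all or for no quadruples of a given type.) *)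

theory Defs
  imports "HOL-Analysis.Analysis"
begin

section \<open>Arrows and the root polytope\<close>

text \<open>
  The nodes \<open>1, \<dots>, n+1\<close> are modelled by a finite linearly ordered type \<open>'v\<close> with
  \<open>CARD('v) = n + 1\<close>, so that \<open>\<real>\<^sup>n\<^sup>+\<^sup>1\<close> is \<open>real ^ 'v\<close> with standard basis \<open>axis i 1\<close>.
\<close>

type_synonym 'v arrow = "'v \<times> 'v"

abbreviation tail :: "'v arrow \<Rightarrow> 'v" where "tail \<equiv> fst"
abbreviation head :: "'v arrow \<Rightarrow> 'v" where "head \<equiv> snd"

definition arrows :: "'v arrow set" where
  "arrows = {(i, j). i \<noteq> j}"

definition arrow_vertex :: "'v::finite arrow \<Rightarrow> real ^ 'v" where
  "arrow_vertex a = axis (head a) 1 - axis (tail a) 1"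

definition root_polytope :: "(real ^ 'v::finite) set" where
  "root_polytope = convex hull {axis j 1 - axis i 1 | i j. i \<noteq> j}"

section \<open>Simplicial complexes on the arrows\<close>

definition arrow_complex :: "'v arrow set set \<Rightarrow> bool" where
  "arrow_complex \<Delta> \<longleftrightarrow>
     \<Delta> \<subseteq> Pow arrows \<and>
     {} \<in> \<Delta> \<and> (\<forall>a\<in>arrows. {a} \<in> \<Delta>) \<and>
     (\<forall>\<sigma>\<in>\<Delta>. \<forall>\<tau>\<subseteq>\<sigma>. \<tau> \<in> \<Delta>)"

definition edge :: "'v arrow set set \<Rightarrow> 'v arrow \<Rightarrow> 'v arrow \<Rightarrow> bool" where
  "edge \<Delta> a b \<longleftrightarrow> a \<noteq> b \<and> {a, b} \<in> \<Delta>"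

definition clique_complex :: "'v arrow set set \<Rightarrow> 'v arrow set set" where
  "clique_complex \<Delta> = {\<sigma>. \<sigma> \<subseteq> arrows \<and> (\<forall>a\<in>\<sigma>. \<forall>b\<in>\<sigma>. a \<noteq> b \<longrightarrow> edge \<Delta> a b)}"

definition flag_complex :: "'v arrow set set \<Rightarrow> bool" where
  "flag_complex \<Delta> \<longleftrightarrow> arrow_complex \<Delta> \<and> clique_complex \<Delta> \<subseteq> \<Delta>"

definition skeleton :: "nat \<Rightarrow> 'v::finite arrow set set \<Rightarrow> 'v arrow set set" where
  "skeleton k \<Delta> = {\<sigma> \<in> \<Delta>. card \<sigma> \<le> k + 1}"

text \<open>
  Flagness of the \<open>k\<close>-skeleton is understood up to dimension \<open>k\<close>: every clique with at most
  \<open>k + 1\<close> vertices is a face, i.e. there is no minimal non-face of dimension \<open>2, \<dots>, k\<close>.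
  (A \<open>k\<close>-skeleton has no \<open>(k+2)\<close>-element face at all, so asking it to contain larger cliques
  would exclude every complex of dimension greater than \<open>k\<close>.)
\<close>

definition flag_skeleton :: "nat \<Rightarrow> 'v::finite arrow set set \<Rightarrow> bool" where
  "flag_skeleton k \<Delta> \<longleftrightarrow> skeleton k (clique_complex \<Delta>) \<subseteq> skeleton k \<Delta>"

section \<open>Permissible complexes\<close>

definition admissible :: "'v arrow set \<Rightarrow> bool" where
  "admissible \<sigma> \<longleftrightarrow> (\<exists>I J. I \<inter> J = {} \<and> \<sigma> \<subseteq> I \<times> J)"

definition underlying_edges :: "'v arrow set \<Rightarrow> 'v set set" where
  "underlying_edges \<sigma> = {{tail a, head a} | a. a \<in> \<sigma>}"

definition graph_cycle :: "'v set set \<Rightarrow> 'v list \<Rightarrow> bool" where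
  "graph_cycle E vs \<longleftrightarrow>
     length vs \<ge> 3 \<and> distinct vs \<and>
     (\<forall>k < length vs. {vs ! k, vs ! (Suc k mod length vs)} \<in> E)"

definition forest :: "'v set set \<Rightarrow> bool" where
  "forest E \<longleftrightarrow> (\<nexists>vs. graph_cycle E vs)"

definition permissible :: "'v::finite arrow set set \<Rightarrow> bool" where
  "permissible \<Delta> \<longleftrightarrow>
     arrow_complex \<Delta> \<and>
     (\<forall>\<sigma>\<in>\<Delta>. admissible \<sigma>) \<and>
     (\<forall>\<sigma>\<in>\<Delta>. forest (underlying_edges \<sigma>)) \<and>
     (\<forall>i j k. distinct [i, j, k] \<longrightarrow> edge \<Delta> (i, j) (i, k) \<and> edge \<Delta> (j, i) (k, i)) \<and>
     (\<forall>i1 i2 j1 j2. distinct [i1, i2, j1, j2] \<longrightarrow>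
        (edge \<Delta> (i1, j1) (i2, j2) \<noteq> edge \<Delta> (i1, j2) (i2, j1))) \<and>
     flag_skeleton 2 \<Delta>"

section \<open>Uniform flag complexes\<close>

definition same_order_pattern :: "'v::linorder list \<Rightarrow> 'v list \<Rightarrow> bool" where
  "same_order_pattern xs ys \<longleftrightarrow>
     length xs = length ys \<and>
     (\<forall>s < length xs. \<forall>t < length xs.
        (xs ! s = xs ! t \<longleftrightarrow> ys ! s = ys ! t) \<and> (xs ! s < xs ! t \<longleftrightarrow> ys ! s < ys ! t))"

definition uniform_flag_complex :: "'v::linorder arrow set set \<Rightarrow> bool" where
  "uniform_flag_complex \<Delta> \<longleftrightarrow>
     flag_complex \<Delta> \<and>
     (\<forall>i1 j1 i2 j2 i1' j1' i2' j2'.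
        same_order_pattern [i1, j1, i2, j2] [i1', j1', i2', j2'] \<longrightarrow>
        (edge \<Delta> (i1, j1) (i2, j2) \<longleftrightarrow> edge \<Delta> (i1', j1') (i2', j2')))"

section \<open>Types, nesting and crossing\<close>

datatype role = T | H

definition endpoints :: "'v arrow \<Rightarrow> 'v arrow \<Rightarrow> 'v set" where
  "endpoints a b = {tail a, head a, tail b, head b}"

text \<open>Only meaningful for pairs with four distinct endpoints.\<close>

definition pair_type :: "'v::linorder arrow \<Rightarrow> 'v arrow \<Rightarrow> role list" where
  "pair_type a b =
     map (\<lambda>p. if p \<in> {tail a, tail b} then T else H) (sorted_list_of_set (endpoints a b))"

definition nesting_pair :: "'v::linorder arrow \<Rightarrow> 'v arrow \<Rightarrow> bool" where
  "nesting_pair a b \<longleftrightarrow>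
     (\<exists>p1 p2 p3 p4. p1 < p2 \<and> p2 < p3 \<and> p3 < p4 \<and>
        {{tail a, head a}, {tail b, head b}} = {{p1, p4}, {p2, p3}})"

definition crossing_pair :: "'v::linorder arrow \<Rightarrow> 'v arrow \<Rightarrow> bool" where
  "crossing_pair a b \<longleftrightarrow>
     (\<exists>p1 p2 p3 p4. p1 < p2 \<and> p2 < p3 \<and> p3 < p4 \<and>
        {{tail a, head a}, {tail b, head b}} = {{p1, p3}, {p2, p4}})"

definition nest :: "'v::linorder arrow set set \<Rightarrow> role list \<Rightarrow> bool" where
  "nest \<Delta> W \<longleftrightarrow> (\<forall>a b. nesting_pair a b \<and> pair_type a b = W \<longrightarrow> edge \<Delta> a b)"

definition do_not_nest :: "'v::linorder arrow set set \<Rightarrow> role list \<Rightarrow> bool" where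
  "do_not_nest \<Delta> W \<longleftrightarrow> (\<forall>a b. nesting_pair a b \<and> pair_type a b = W \<longrightarrow> \<not> edge \<Delta> a b)"

definition cross :: "'v::linorder arrow set set \<Rightarrow> role list \<Rightarrow> bool" where
  "cross \<Delta> W \<longleftrightarrow> (\<forall>a b. crossing_pair a b \<and> pair_type a b = W \<longrightarrow> edge \<Delta> a b)"

definition do_not_cross :: "'v::linorder arrow set set \<Rightarrow> role list \<Rightarrow> bool" where
  "do_not_cross \<Delta> W \<longleftrightarrow> (\<forall>a b. crossing_pair a b \<and> pair_type a b = W \<longrightarrow> \<not> edge \<Delta> a b)"

section \<open>Triangulations of the boundary\<close>

text \<open>
  The polytope is not full-dimensional in \<open>real ^ 'v\<close>, so its boundary is the relative frontier.
  The constant \<^const>\<open>simplicial_complex\<close> of the library is the geometric notion; the affine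
  independence says that the vertices of each geometric simplex are exactly the arrows of the face.
\<close>

definition represents_boundary_triangulation :: "'v::finite arrow set set \<Rightarrow> bool" where
  "represents_boundary_triangulation \<Delta> \<longleftrightarrow>
     (\<forall>\<sigma>\<in>\<Delta>. \<not> affine_dependent (arrow_vertex ` \<sigma>)) \<and>
     simplicial_complex ((\<lambda>\<sigma>. convex hull (arrow_vertex ` \<sigma>)) ` \<Delta>) \<and>
     (\<Union>\<sigma>\<in>\<Delta>. convex hull (arrow_vertex ` \<sigma>)) = rel_frontier root_polytope"

definition exactly_one_of_three :: "bool \<Rightarrow> bool \<Rightarrow> bool \<Rightarrow> bool" where
  "exactly_one_of_three P Q R \<longleftrightarrow>
     (P \<and> \<not> Q \<and> \<not> R) \<or> (\<not> P \<and> Q \<and> \<not> R) \<or> (\<not> P \<and> \<not> Q \<and> R)"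

end

theory Submission
  imports Defs
begin

text \<open>
  A point of the boundary of the root polytope is a vector with coordinate sum \<open>0\<close> and \<open>\<ell>\<^sub>1\<close>-norm \<open>2\<close>:
  negative entries are supplies and positive entries are demands. Writing it as a convex
  combination of the arrows of a face means finding a transportation plan from the supplies to the
  demands whose support is a clique of the compatibility relation on arrows. Hence the
  complex represents a triangulation exactly if every balanced transportation problem has exactly
  one such plan.

  A uniform complex is determined by six bits, one for each type. For most good bit vectors every
  problem has an arrow compatible with all others, so the plan is built greedily and each greedy
  step is forced. The other good vectors but two differ from such a vector only in the bits of
  \<open>TTHH\<close> and \<open>HHTT\<close>; these can be flipped by rearranging the forward and the backward part of
  a plan separately. The last two need a refined greedy step. Conversely, a bad bit vector
  either violates the forest condition on \<open>THTHTH\<close> or \<open>HTHTHT\<close>, or leaves the barycentric problem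
  on the word \<open>THTHHT\<close> or its reversal of roles without a plan.
\<close>

section \<open>Flows with pairwise compatible support\<close>

text \<open>The split into forward arrows (tail below head) and backward ones follows what each bit
  governs: two forward arrows involve only \<open>n1\<close> and \<open>n3\<close>, two backward
  ones only \<open>n2\<close> and \<open>n4\<close>, a mixed pair only \<open>n3\<close>,
  \<open>n4\<close>, \<open>c5\<close>, \<open>c6\<close>. So the bits of \<open>TTHH\<close> and
  \<open>HHTT\<close> act inside one part. With the other four bits off, a problem whose prefix
  excesses of supply over demand are all nonnegative admits only plans of forward arrows; this
  provides each part with exactly one replacement having the same marginals. The obstacle is that
  the new parts must stay compatible with each other, which works where mixed compatibility can be
  read off from marginals. In the geometry, existence of plans gives the covering of the boundary,
  and uniqueness gives both the affine independence of faces and the intersection property. The two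
  obstructions of the converse differ in kind: the cycle is excluded by the forest condition before
  any geometry enters, while the barycentric problem uses that a triangulation must cover one
  particular point. Both live on six nodes, whence \<open>n \<ge> 5\<close>.\<close>

definition flow :: "('v::finite \<Rightarrow> real) \<Rightarrow> ('v \<Rightarrow> real) \<Rightarrow> ('v \<Rightarrow> 'v \<Rightarrow> real) \<Rightarrow> bool" where
  "flow a b f \<longleftrightarrow>
     (\<forall>i j. 0 \<le> f i j) \<and> (\<forall>i. (\<Sum>j\<in>UNIV. f i j) = a i) \<and> (\<forall>j. (\<Sum>i\<in>UNIV. f i j) = b j)"

definition clique_flow ::
  "('v arrow \<Rightarrow> 'v arrow \<Rightarrow> bool) \<Rightarrow> ('v::finite \<Rightarrow> real) \<Rightarrow> ('v \<Rightarrow> real) \<Rightarrow> ('v \<Rightarrow> 'v \<Rightarrow> real) \<Rightarrow> bool"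
  where
  "clique_flow K a b f \<longleftrightarrow>
     flow a b f \<and> (\<forall>i j i' j'. 0 < f i j \<longrightarrow> 0 < f i' j' \<longrightarrow> K (i, j) (i', j'))"

text \<open>The negative and positive parts of a vector with coordinate sum 0 have this form. The
  disjointness clause makes the support of every flow admissible.\<close>

definition balanced :: "('v::finite \<Rightarrow> real) \<Rightarrow> ('v \<Rightarrow> real) \<Rightarrow> bool" where
  "balanced a b \<longleftrightarrow>
     (\<forall>v. 0 \<le> a v) \<and> (\<forall>v. 0 \<le> b v) \<and> (\<forall>v. a v = 0 \<or> b v = 0) \<and> sum a UNIV = sum b UNIV"

definition solvable :: "('v::finite arrow \<Rightarrow> 'v arrow \<Rightarrow> bool) \<Rightarrow> bool" where
  "solvable K \<longleftrightarrow> (\<forall>a b. balanced a b \<longrightarrow> (\<exists>!f. clique_flow K a b f))"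

definition add_at :: "'v \<Rightarrow> 'v \<Rightarrow> real \<Rightarrow> ('v \<Rightarrow> 'v \<Rightarrow> real) \<Rightarrow> 'v \<Rightarrow> 'v \<Rightarrow> real" where
  "add_at i j d f = (\<lambda>x y. f x y + (if x = i \<and> y = j then d else 0))"

lemma flow_nonneg: "flow a b f \<Longrightarrow> 0 \<le> f i j"
  by (simp add: flow_def)

lemma flow_le_row: "flow a b f \<Longrightarrow> f i j \<le> a i"
  unfolding flow_def by (metis UNIV_I finite member_le_sum)

lemma flow_le_column: "flow a b f \<Longrightarrow> f i j \<le> b j"
  unfolding flow_def by (metis (mono_tags, lifting) UNIV_I finite member_le_sum)

lemma flow_row_pos: "flow a b f \<Longrightarrow> 0 < a i \<longleftrightarrow> (\<exists>j. 0 < f i j)"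
proof -
  assume f: "flow a b f"
  have "a i = (\<Sum>j\<in>UNIV. f i j)" using f by (simp add: flow_def)
  then show ?thesis
    using f sum_pos2[of UNIV _ "f i"] flow_le_row[OF f]
    by (metis finite UNIV_I flow_nonneg less_le_trans not_less sum_nonpos)
qed

lemma flow_column_pos: "flow a b f \<Longrightarrow> 0 < b j \<longleftrightarrow> (\<exists>i. 0 < f i j)"
proof -
  assume f: "flow a b f"
  have "b j = (\<Sum>i\<in>UNIV. f i j)" using f by (simp add: flow_def)
  then show ?thesis
    using f flow_le_column[OF f]
    by (metis flow_nonneg less_le_trans not_less sum_nonpos)
qed

lemma flow_add_at:
  assumes "flow a b f" "0 \<le> f i j + d"
  shows "flow (a(i := a i + d)) (b(j := b j + d)) (add_at i j d f)"
proof -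
  have 1: "(\<Sum>y\<in>UNIV. if x = i \<and> y = j then d else 0) = (if x = i then d else 0)" for x
    by (cases "x = i") (simp_all add: sum.delta)
  have 2: "(\<Sum>x\<in>UNIV. if x = i \<and> y = j then d else 0) = (if y = j then d else 0)" for y
    by (cases "y = j") (simp_all add: sum.delta)
  show ?thesis
    using assms by (auto simp: flow_def add_at_def sum.distrib 1 2)
qed

lemma add_at_add_at: "add_at i j d (add_at i j e f) = add_at i j (d + e) f"
  by (auto simp: add_at_def fun_eq_iff)

lemma add_at_zero: "add_at i j 0 f = f"
  by (auto simp: add_at_def fun_eq_iff)

text \<open>Supply left at \<open>i\<close> must go to another head and demand left at
  \<open>j\<close> must come from another tail. These two arrows are the other matching of
  \<open>(i, j)\<close> and \<open>(i', j')\<close>.\<close>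

lemma flow_unsaturated:
  assumes f: "flow a b f" and "f i j < a i" "f i j < b j"
  obtains i' j' where "i' \<noteq> i" "j' \<noteq> j" "0 < f i j'" "0 < f i' j"
proof -
  have "\<exists>j'. j' \<noteq> j \<and> 0 < f i j'"
  proof (rule ccontr)
    assume "\<not> ?thesis"
    then have "\<And>y. y \<noteq> j \<Longrightarrow> f i y = 0" using f by (metis flow_nonneg order_le_less)
    then have "(\<Sum>y\<in>UNIV. f i y) = f i j"
      by (subst sum.mono_neutral_right[of UNIV "{j}"]) auto
    then show False using f assms(2) by (simp add: flow_def)
  qed
  moreover have "\<exists>i'. i' \<noteq> i \<and> 0 < f i' j"
  proof (rule ccontr)
    assume "\<not> ?thesis"
    then have "\<And>x. x \<noteq> i \<Longrightarrow> f x j = 0" using f by (metis flow_nonneg order_le_less)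
    then have "(\<Sum>x\<in>UNIV. f x j) = f i j"
      by (subst sum.mono_neutral_right[of UNIV "{i}"]) auto
    then show False using f assms(3) by (simp add: flow_def)
  qed
  ultimately show thesis using that by blast
qed

text \<open>Termination measure of the greedy construction: filling an arrow to the capacity of one
  of its ends removes that end from the problem.\<close>

definition support_size :: "('v::finite \<Rightarrow> real) \<Rightarrow> ('v \<Rightarrow> real) \<Rightarrow> nat" where
  "support_size a b = card {v. 0 < a v} + card {v. 0 < b v}"

lemma support_size_peel:
  assumes "0 < a i" "0 < b j" "0 \<le> d" "d = a i \<or> d = b j"
  shows "support_size (a(i := a i - d)) (b(j := b j - d)) < support_size a b"
proof -
  have 1: "{v. 0 < (a(i := a i - d)) v} \<subseteq> {v. 0 < a v}"
    and 2: "{v. 0 < (b(j := b j - d)) v} \<subseteq> {v. 0 < b v}"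
    using assms by auto
  have "{v. 0 < (a(i := a i - d)) v} \<subset> {v. 0 < a v} \<or> {v. 0 < (b(j := b j - d)) v} \<subset> {v. 0 < b v}"
    proof (rule disjE[OF assms(4)])
    assume "d = a i"
    then have "i \<notin> {v. 0 < (a(i := a i - d)) v}" "i \<in> {v. 0 < a v}" using assms by auto
    then show ?thesis using 1 by blast
  next
    assume "d = b j"
    then have "j \<notin> {v. 0 < (b(j := b j - d)) v}" "j \<in> {v. 0 < b v}" using assms by auto
    then show ?thesis using 2 by blast
  qed
  then show ?thesis
    unfolding support_size_def
    using 1 2 by (metis add_le_less_mono add_less_le_mono card_mono finite psubset_card_mono)
qed

lemma balanced_peel:
  assumes "balanced a b" "0 \<le> d" "d \<le> a i" "d \<le> b j"
  shows "balanced (a(i := a i - d)) (b(j := b j - d))"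
proof -
  have "sum (a(i := a i - d)) UNIV = sum a UNIV - d"
    by (subst (1 2) sum.remove[of UNIV i]) (auto intro: sum.cong)
  moreover have "sum (b(j := b j - d)) UNIV = sum b UNIV - d"
    by (subst (1 2) sum.remove[of UNIV j]) (auto intro: sum.cong)
  ultimately show ?thesis using assms unfolding balanced_def by (auto; smt (verit))
qed

lemma balanced_flow:
  assumes "balanced a b" "flow a b f" "0 < f i j"
  shows "a j = 0" "b i = 0" "0 < a i" "0 < b j" "i \<noteq> j"
proof -
  show "0 < a i" "0 < b j" using assms flow_row_pos flow_column_pos by blast+
  then show "a j = 0" "b i = 0" using assms(1) unfolding balanced_def by (metis less_irrefl)+
  then show "i \<noteq> j" using \<open>0 < a i\<close> by auto
qed

lemma clique_flow_zero:
  assumes "balanced a b" "{v. 0 < a v} = {} \<or> {v. 0 < b v} = {}"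
  shows "\<exists>!f. clique_flow K a b f"
proof -
  have *: "a v = 0 \<and> b v = 0" for v
  proof -
    have "(\<forall>v. a v = 0) \<or> (\<forall>v. b v = 0)"
      using assms unfolding balanced_def by (metis empty_Collect_eq order_le_less)
    then have s: "sum a UNIV = 0 \<or> sum b UNIV = 0" by auto
    then have "sum a UNIV = 0" "sum b UNIV = 0" using assms by (auto simp: balanced_def)
    then show ?thesis
      using assms(1) sum_nonneg_eq_0_iff[of UNIV a] sum_nonneg_eq_0_iff[of UNIV b]
      by (simp add: balanced_def)
  qed
  show ?thesis
  proof (rule ex1I[of _ "\<lambda>_ _. 0"])
    show "clique_flow K a b (\<lambda>_ _. 0)" using * by (simp add: clique_flow_def flow_def)
    fix f assume "clique_flow K a b f"
    then have f: "flow a b f" by (simp add: clique_flow_def)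
    have "f i j = 0" for i j using flow_nonneg[OF f, of i j] flow_le_row[OF f, of i j] * by simp
    then show "f = (\<lambda>_ _. 0)" by (simp add: fun_eq_iff)
  qed
qed

text \<open>Adding \<open>d\<close> at \<open>(i, j)\<close> is a bijection from the clique flows of
  the reduced problem to those of the original one: \<open>extend\<close> keeps the support a
  clique, and \<open>forced\<close> keeps the inverse nonnegative. The amount \<open>d\<close> need
  not exhaust an end, which the case of both mixed crossings relies on.\<close>

lemma clique_flow_peel_ex1:
  assumes bal: "balanced a b" and d: "0 \<le> d" "d \<le> a i" "d \<le> b j"
    and sym: "\<And>\<alpha> \<beta>. K \<alpha> \<beta> \<Longrightarrow> K \<beta> \<alpha>" and refl: "K (i, j) (i, j)"
    and ex: "\<exists>!f. clique_flow K (a(i := a i - d)) (b(j := b j - d)) f"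
    and extend: "\<And>f x y. clique_flow K (a(i := a i - d)) (b(j := b j - d)) f \<Longrightarrow> 0 < f x y \<Longrightarrow>
      0 < d \<Longrightarrow> K (i, j) (x, y)"
    and forced: "\<And>f. clique_flow K a b f \<Longrightarrow> d \<le> f i j"
  shows "\<exists>!f. clique_flow K a b f"
proof -
  let ?a = "a(i := a i - d)" and ?b = "b(j := b j - d)"
  obtain f where f: "clique_flow K ?a ?b f" using ex by blast
  have fn: "0 \<le> f x y" for x y using f by (auto simp: clique_flow_def flow_def)
  have "flow a b (add_at i j d f)"
    using flow_add_at[of ?a ?b f i j d] f fn[of i j] d by (simp add: clique_flow_def)
  moreover have "K (x, y) (x', y')" if p: "0 < add_at i j d f x y" "0 < add_at i j d f x' y'" for x y x' y'
  proof -
    consider "0 < f x y" "0 < f x' y'" | "0 < f x y" "(x', y') = (i, j)" "0 < d"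
      | "0 < f x' y'" "(x, y) = (i, j)" "0 < d" | "(x, y) = (i, j)" "(x', y') = (i, j)"
      using p fn[of x y] fn[of x' y'] d(1) by (auto simp: add_at_def split: if_splits) fastforce+
    then show ?thesis
      using f extend[OF f] sym refl by cases (auto simp: clique_flow_def)
  qed
  ultimately have "clique_flow K a b (add_at i j d f)" by (simp add: clique_flow_def)
  moreover have "g = add_at i j d f" if g: "clique_flow K a b g" for g
  proof -
    have "flow ?a ?b (add_at i j (- d) g)"
      using flow_add_at[of a b g i j "- d"] g forced[OF g] by (simp add: clique_flow_def)
    moreover have "0 < g x y" if "0 < add_at i j (- d) g x y" for x y
      using that d(1) by (auto simp: add_at_def split: if_splits)
    ultimately have "clique_flow K ?a ?b (add_at i j (- d) g)"
      using g by (auto simp: clique_flow_def)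
    then have "add_at i j (- d) g = f" using ex f by blast
    then have "add_at i j d (add_at i j (- d) g) = add_at i j d f" by simp
    then show ?thesis by (simp add: add_at_add_at add_at_zero)
  qed
  ultimately show ?thesis by blast
qed

text \<open>The arrow \<open>(i, j)\<close> is a cone point of the clique complex on
  \<open>I \<times> J\<close>, where \<open>I\<close> and \<open>J\<close> will be the nodes with
  positive supply and positive demand.\<close>

definition has_cone :: "('v arrow \<Rightarrow> 'v arrow \<Rightarrow> bool) \<Rightarrow> 'v set \<Rightarrow> 'v set \<Rightarrow> bool" where
  "has_cone K I J \<longleftrightarrow> (\<exists>i\<in>I. \<exists>j\<in>J. \<forall>i'\<in>I. \<forall>j'\<in>J. K (i, j) (i', j'))"

text \<open>
  Filling the cone arrow up to the smaller of its two capacities is forced: slack at both ends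
  would be used by two arrows that form the other matching of a pair containing the cone arrow.
\<close>

lemma solvable_if_cones:
  fixes K :: "'v::finite arrow \<Rightarrow> 'v arrow \<Rightarrow> bool"
  assumes sym: "\<And>\<alpha> \<beta>. K \<alpha> \<beta> \<Longrightarrow> K \<beta> \<alpha>"
    and anti: "\<And>i i' j j'. distinct [i, i', j, j'] \<Longrightarrow> K (i, j) (i', j') \<Longrightarrow> \<not> K (i, j') (i', j)"
    and cone: "\<And>I J. I \<noteq> {} \<Longrightarrow> J \<noteq> {} \<Longrightarrow> I \<inter> J = {} \<Longrightarrow> has_cone K I J"
  shows "solvable K"
  unfolding solvable_def
proof (intro allI impI)
  fix a b :: "'v \<Rightarrow> real"
  assume "balanced a b"
  then show "\<exists>!f. clique_flow K a b f"
  proof (induction "support_size a b" arbitrary: a b rule: less_induct)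
    case less
    let ?I = "{v. 0 < a v}" and ?J = "{v. 0 < b v}"
    show ?case
    proof (cases "?I = {} \<or> ?J = {}")
      case True
      then show ?thesis using clique_flow_zero less.prems by blast
    next
      case False
      have disj: "?I \<inter> ?J = {}" using less.prems unfolding balanced_def by (metis (mono_tags, lifting) disjoint_iff less_irrefl mem_Collect_eq)
      then obtain i j where ij: "0 < a i" "0 < b j"
        and K: "\<And>i' j'. 0 < a i' \<Longrightarrow> 0 < b j' \<Longrightarrow> K (i, j) (i', j')"
        using cone[of ?I ?J] False unfolding has_cone_def by auto
      define d where "d = min (a i) (b j)"
      have d: "0 \<le> d" "d \<le> a i" "d \<le> b j" "d = a i \<or> d = b j" using ij by (auto simp: d_def)
      let ?a = "a(i := a i - d)" and ?b = "b(j := b j - d)"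
      have bal: "balanced ?a ?b" using balanced_peel less.prems d by blast
      show ?thesis
      proof (rule clique_flow_peel_ex1[OF less.prems d(1-3) sym])
        show "\<exists>!f. clique_flow K ?a ?b f"
          using less.hyps[OF support_size_peel[of a i b j d, OF ij d(1,4)] bal] .
        show "K (i, j) (i, j)" using K ij by blast
      next
        fix f x y assume f: "clique_flow K ?a ?b f" and pos: "0 < f x y"
        then have "0 < ?a x" "0 < ?b y" using balanced_flow(3,4)[of ?a ?b f x y, OF bal _ pos] by (auto simp: clique_flow_def)
        then show "K (i, j) (x, y)" using K d(1) by (auto split: if_splits)
      next
        fix f assume f: "clique_flow K a b f"
        then have fl: "flow a b f" by (simp add: clique_flow_def)
        show "d \<le> f i j"
        proof (rule ccontr)
          assume "\<not> d \<le> f i j"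
          then have "f i j < a i" "f i j < b j" by (auto simp: d_def)
          then obtain i' j' where *: "i' \<noteq> i" "j' \<noteq> j" "0 < f i j'" "0 < f i' j"
            using flow_unsaturated[OF fl] by blast
          then have pos: "0 < a i'" "0 < b j'" using flow_row_pos[OF fl] flow_column_pos[OF fl] by blast+
          then have "distinct [i, i', j, j']" using * ij disj by auto
          moreover have "K (i, j) (i', j')" using K pos by blast
          moreover have "K (i, j') (i', j)" using f * by (auto simp: clique_flow_def)
          ultimately show False using anti by blast
        qed
      qed
    qed
  qed
qed

section \<open>Compatibility by type\<close>

text \<open>
  The bits \<open>n1\<close>, \<open>n2\<close>, \<open>n3\<close>, \<open>n4\<close> say whether the types \<open>TTHH\<close>, \<open>HHTT\<close>, \<open>THTH\<close>, \<open>HTHT\<close> nest, and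
  \<open>c5\<close>, \<open>c6\<close> whether the types \<open>THHT\<close>, \<open>HTTH\<close> cross; if a type does not, its other matching is
  compatible. The tails are \<open>i1\<close>, \<open>i2\<close> and the heads are \<open>j1\<close>, \<open>j2\<close>.
\<close>

definition compat0 ::
  "bool \<Rightarrow> bool \<Rightarrow> bool \<Rightarrow> bool \<Rightarrow> bool \<Rightarrow> bool \<Rightarrow> 'v::linorder \<Rightarrow> 'v \<Rightarrow> 'v \<Rightarrow> 'v \<Rightarrow> bool" where
  "compat0 n1 n2 n3 n4 c5 c6 i1 j1 i2 j2 \<longleftrightarrow>
     (i1 < i2 \<and> i2 < j2 \<and> j2 < j1 \<and> n1) \<or> (i1 < i2 \<and> i2 < j1 \<and> j1 < j2 \<and> \<not> n1) \<or>
     (j1 < j2 \<and> j2 < i2 \<and> i2 < i1 \<and> n2) \<or> (j1 < j2 \<and> j2 < i1 \<and> i1 < i2 \<and> \<not> n2) \<or>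
     (i1 < j2 \<and> j2 < i2 \<and> i2 < j1 \<and> n3) \<or> (i1 < j1 \<and> j1 < i2 \<and> i2 < j2 \<and> \<not> n3) \<or>
     (j1 < i2 \<and> i2 < j2 \<and> j2 < i1 \<and> n4) \<or> (j1 < i1 \<and> i1 < j2 \<and> j2 < i2 \<and> \<not> n4) \<or>
     (i1 < j2 \<and> j2 < j1 \<and> j1 < i2 \<and> c5) \<or> (i1 < j1 \<and> j1 < j2 \<and> j2 < i2 \<and> \<not> c5) \<or>
     (j1 < i2 \<and> i2 < i1 \<and> i1 < j2 \<and> c6) \<or> (j1 < i1 \<and> i1 < i2 \<and> i2 < j2 \<and> \<not> c6)"

text \<open>Each clause of \<open>compat0\<close> fixes which arrow is listed first, hence the two
  orders.\<close>

definition compat ::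
  "bool \<Rightarrow> bool \<Rightarrow> bool \<Rightarrow> bool \<Rightarrow> bool \<Rightarrow> bool \<Rightarrow> 'v::linorder arrow \<Rightarrow> 'v arrow \<Rightarrow> bool" where
  "compat n1 n2 n3 n4 c5 c6 \<alpha> \<beta> \<longleftrightarrow>
     tail \<alpha> = tail \<beta> \<or> head \<alpha> = head \<beta> \<or>
     compat0 n1 n2 n3 n4 c5 c6 (tail \<alpha>) (head \<alpha>) (tail \<beta>) (head \<beta>) \<or>
     compat0 n1 n2 n3 n4 c5 c6 (tail \<beta>) (head \<beta>) (tail \<alpha>) (head \<alpha>)"

lemma compat_sym: "compat n1 n2 n3 n4 c5 c6 \<alpha> \<beta> \<Longrightarrow> compat n1 n2 n3 n4 c5 c6 \<beta> \<alpha>"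
  unfolding compat_def by auto

lemma compat_refl: "compat n1 n2 n3 n4 c5 c6 \<alpha> \<alpha>"
  unfolding compat_def by auto

text \<open>Reversing all arrows exchanges the letters T and H and therefore the bits in pairs.
  Later cases are halved by this symmetry.\<close>

lemma compat_swap:
  "compat n1 n2 n3 n4 c5 c6 (j, i) (j', i') \<longleftrightarrow> compat n2 n1 n4 n3 c6 c5 (i, j) (i', j')"
  unfolding compat_def compat0_def by auto

lemma ordered_facts:
  fixes p1 p2 p3 p4 :: "'v::linorder"
  assumes "p1 < p2" "p2 < p3" "p3 < p4"
  shows "p1 < p2" "p1 < p3" "p1 < p4" "p2 < p3" "p2 < p4" "p3 < p4"
    "\<not> p2 < p1" "\<not> p3 < p1" "\<not> p4 < p1" "\<not> p3 < p2" "\<not> p4 < p2" "\<not> p4 < p3"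
    "p1 \<noteq> p2" "p1 \<noteq> p3" "p1 \<noteq> p4" "p2 \<noteq> p3" "p2 \<noteq> p4" "p3 \<noteq> p4"
    "p2 \<noteq> p1" "p3 \<noteq> p1" "p4 \<noteq> p1" "p3 \<noteq> p2" "p4 \<noteq> p2" "p4 \<noteq> p3"
  using assms by order+

lemma compat_types:
  fixes p1 p2 p3 p4 :: "'v::linorder"
  assumes "p1 < p2" "p2 < p3" "p3 < p4"
  shows "compat n1 n2 n3 n4 c5 c6 (p1, p4) (p2, p3) \<longleftrightarrow> n1"
    "compat n1 n2 n3 n4 c5 c6 (p1, p3) (p2, p4) \<longleftrightarrow> \<not> n1"
    "compat n1 n2 n3 n4 c5 c6 (p4, p1) (p3, p2) \<longleftrightarrow> n2"
    "compat n1 n2 n3 n4 c5 c6 (p3, p1) (p4, p2) \<longleftrightarrow> \<not> n2"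
    "compat n1 n2 n3 n4 c5 c6 (p1, p4) (p3, p2) \<longleftrightarrow> n3"
    "compat n1 n2 n3 n4 c5 c6 (p1, p2) (p3, p4) \<longleftrightarrow> \<not> n3"
    "compat n1 n2 n3 n4 c5 c6 (p2, p3) (p4, p1) \<longleftrightarrow> n4"
    "compat n1 n2 n3 n4 c5 c6 (p2, p1) (p4, p3) \<longleftrightarrow> \<not> n4"
    "compat n1 n2 n3 n4 c5 c6 (p1, p3) (p4, p2) \<longleftrightarrow> c5"
    "compat n1 n2 n3 n4 c5 c6 (p1, p2) (p4, p3) \<longleftrightarrow> \<not> c5"
    "compat n1 n2 n3 n4 c5 c6 (p2, p4) (p3, p1) \<longleftrightarrow> c6"
    "compat n1 n2 n3 n4 c5 c6 (p2, p1) (p3, p4) \<longleftrightarrow> \<not> c6"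
  by (simp_all add: compat_def compat0_def ordered_facts[OF assms])

lemma compat_commute: "compat n1 n2 n3 n4 c5 c6 \<alpha> \<beta> \<longleftrightarrow> compat n1 n2 n3 n4 c5 c6 \<beta> \<alpha>"
  using compat_sym by blast

lemma compat_exclusive_ordered:
  fixes i :: "'v::linorder"
  assumes "distinct [i, i', j, j']" "i < i'" "j < j'"
  shows "compat n1 n2 n3 n4 c5 c6 (i, j) (i', j') \<noteq> compat n1 n2 n3 n4 c5 c6 (i, j') (i', j)"
proof -
  have "i < j \<or> j < i" "i < j' \<or> j' < i" "i' < j \<or> j < i'" "i' < j' \<or> j' < i'"
    using assms(1) by (auto simp: neq_iff)
  then consider "i < i'" "i' < j" "j < j'" | "i < j" "j < i'" "i' < j'" | "i < j" "j < j'" "j' < i'"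
    | "j < i" "i < i'" "i' < j'" | "j < i" "i < j'" "j' < i'" | "j < j'" "j' < i" "i < i'"
    using assms by blast
  then show ?thesis
  proof cases
    case 1 then show ?thesis using compat_types[of i i' j j'] by simp
  next
    case 2 then show ?thesis using compat_types[of i j i' j'] by simp
  next
    case 3 then show ?thesis using compat_types[of i j j' i'] by simp
  next
    case 4 then show ?thesis using compat_types[of j i i' j'] compat_commute by metis
  next
    case 5 then show ?thesis using compat_types[of j i j' i'] compat_commute by metis
  next
    case 6 then show ?thesis using compat_types[of j j' i i'] compat_commute by metis
  qed
qed

lemma compat_exclusive:
  fixes i :: "'v::linorder"
  assumes "distinct [i, i', j, j']"
  shows "compat n1 n2 n3 n4 c5 c6 (i, j) (i', j') \<noteq> compat n1 n2 n3 n4 c5 c6 (i, j') (i', j)"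
proof -
  let ?K = "compat n1 n2 n3 n4 c5 c6"
  have 1: "?K (x, y) (x', y') \<noteq> ?K (x, y') (x', y)" if "distinct [x, x', y, y']" "x < x'" for x x' y y' :: 'v
    using compat_exclusive_ordered[of x x' y y'] compat_exclusive_ordered[of x x' y' y] that
    by (cases "y < y'") auto
  have "i < i' \<or> i' < i" using assms by (auto simp: neq_iff)
  then show ?thesis
    using 1[of i i' j j'] 1[of i' i j' j] assms compat_sym by (metis distinct_length_2_or_more)
qed

lemma solvable_compat_if_cones:
  fixes n1 n2 n3 n4 c5 c6 :: bool
  assumes "\<And>(I :: 'v::{finite,linorder} set) J. I \<noteq> {} \<Longrightarrow> J \<noteq> {} \<Longrightarrow> I \<inter> J = {} \<Longrightarrow>
    has_cone (compat n1 n2 n3 n4 c5 c6) I J"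
  shows "solvable (compat n1 n2 n3 n4 c5 c6 :: 'v arrow \<Rightarrow> 'v arrow \<Rightarrow> bool)"
  using solvable_if_cones[of "compat n1 n2 n3 n4 c5 c6"] compat_sym compat_exclusive assms by blast

section \<open>Cone arrows for the base cases of the bits\<close>

lemma has_cone_swap:
  "has_cone (compat n1 n2 n3 n4 c5 c6) I J \<longleftrightarrow> has_cone (compat n2 n1 n4 n3 c6 c5) J I"
  unfolding has_cone_def compat_swap[of n1 n2] by blast

lemma has_coneI:
  assumes "i \<in> I" "j \<in> J"
    and "\<And>i' j'. i' \<in> I \<Longrightarrow> j' \<in> J \<Longrightarrow> i' \<noteq> i \<Longrightarrow> j' \<noteq> j \<Longrightarrow>
      compat0 n1 n2 n3 n4 c5 c6 i j i' j' \<or> compat0 n1 n2 n3 n4 c5 c6 i' j' i j"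
  shows "has_cone (compat n1 n2 n3 n4 c5 c6) I J"
  using assms unfolding has_cone_def compat_def fst_conv snd_conv by metis

text \<open>The cone arrow runs from the first tail to the last head. An arrow sharing no end with
  it lies inside it, forward (\<open>n1\<close>) or backward (\<open>n3\<close>), or is a backward
  arrow whose tail is beyond \<open>Max J\<close> and which crosses it (\<open>c5\<close>).\<close>

lemma has_cone_intersecting:
  fixes I J :: "'v::{finite,linorder} set"
  assumes ne: "I \<noteq> {}" "J \<noteq> {}" and dj: "I \<inter> J = {}" and less: "Min I < Min J" and n: "n1" "n3" "c5"
  shows "has_cone (compat n1 n2 n3 n4 c5 c6) I J"
proof (rule has_coneI)
  show "Min I \<in> I" "Max J \<in> J" using ne by auto
  fix i' j' assume *: "i' \<in> I" "j' \<in> J" "i' \<noteq> Min I" "j' \<noteq> Max J"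
  have "Min I < i'" "j' < Max J" "Min J \<le> j'" using * by (auto simp: order_less_le)
  moreover have "i' \<noteq> j'" "i' \<noteq> Max J" using * dj ne Max_in[of J] by (blast, metis disjoint_iff finite)
  ultimately show "compat0 n1 n2 n3 n4 c5 c6 (Min I) (Max J) i' j' \<or> compat0 n1 n2 n3 n4 c5 c6 i' j' (Min I) (Max J)"
    using less n unfolding compat0_def
    by (smt (verit) order_less_trans order_le_less_trans order_less_le_trans less_irrefl linorder_neqE)
qed

text \<open>The cone arrow ends at the first head, and arrows with a tail beyond that head are
  disjoint from it, as \<open>\<not> n3\<close> and \<open>\<not> c5\<close> demand. The bit
  \<open>n1\<close> selects its tail: the last tail before \<open>Min J\<close>, so that arrows with
  an earlier tail nest around it, or the first tail, so that arrows with a tail before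
  \<open>Min J\<close> cross it.\<close>

lemma has_cone_disjoint:
  fixes I J :: "'v::{finite,linorder} set"
  assumes ne: "I \<noteq> {}" "J \<noteq> {}" and dj: "I \<inter> J = {}" and less: "Min I < Min J"
    and n: "\<not> n3" "\<not> c5"
  shows "has_cone (compat n1 n2 n3 n4 c5 c6) I J"
proof (cases n1)
  case True
  define i where "i = Max {v \<in> I. v < Min J}"
  have "Min I \<in> {v \<in> I. v < Min J}" using ne less by simp
  then have i: "i \<in> {v \<in> I. v < Min J}" "\<And>v. v \<in> {v \<in> I. v < Min J} \<Longrightarrow> v \<le> i"
    unfolding i_def by (metis Max_in empty_iff finite, metis Max_ge finite)
  show ?thesis
  proof (rule has_coneI)
    show "i \<in> I" "Min J \<in> J" using i ne by auto
    fix i' j' assume *: "i' \<in> I" "j' \<in> J" "i' \<noteq> i" "j' \<noteq> Min J"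
    have M: "Min J \<in> J" using ne by simp
    have "i < Min J" "Min J < j'" using i * by (auto simp: order_less_le)
    moreover have "i' \<noteq> j'" "i' \<noteq> Min J" using * dj M by auto
    moreover then have "i' < i \<or> Min J < i'" using i(2)[of i'] * by fastforce
    ultimately show "compat0 n1 n2 n3 n4 c5 c6 i (Min J) i' j' \<or> compat0 n1 n2 n3 n4 c5 c6 i' j' i (Min J)"
      using n True unfolding compat0_def by (smt (verit) order_less_trans less_irrefl linorder_neqE)
  qed
next
  case False
  show ?thesis
  proof (rule has_coneI)
    show "Min I \<in> I" "Min J \<in> J" using ne by auto
    fix i' j' assume *: "i' \<in> I" "j' \<in> J" "i' \<noteq> Min I" "j' \<noteq> Min J"
    then have "Min I < i'" "Min J < j'" by (auto simp: order_less_le)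
    moreover have "i' \<noteq> j'" "i' \<noteq> Min J" using * dj ne Min_in[of J] by (blast, metis disjoint_iff finite)
    ultimately show "compat0 n1 n2 n3 n4 c5 c6 (Min I) (Min J) i' j' \<or> compat0 n1 n2 n3 n4 c5 c6 i' j' (Min I) (Min J)"
      using n False less unfolding compat0_def by (smt (verit) order_less_trans less_irrefl linorder_neqE)
  qed
qed

lemma Min_cases:
  fixes I J :: "'v::{finite,linorder} set"
  assumes "I \<noteq> {}" "J \<noteq> {}" "I \<inter> J = {}"
  obtains "Min I < Min J" | "Min J < Min I"
  using assms by (metis Min_in disjoint_iff finite linorder_neqE)

lemma solvable_separated: "solvable (compat n1 n2 False False False False :: 'v::{finite,linorder} arrow \<Rightarrow> _)"
proof (rule solvable_compat_if_cones)
  fix I J :: "'v set"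
  assume *: "I \<noteq> {}" "J \<noteq> {}" "I \<inter> J = {}"
  then show "has_cone (compat n1 n2 False False False False) I J"
  proof (cases rule: Min_cases)
    case 1
    then show ?thesis using * by (intro has_cone_disjoint) auto
  next
    case 2
    then show ?thesis
      unfolding has_cone_swap[of n1 n2] using * by (intro has_cone_disjoint) auto
  qed
qed

lemma solvable_intersecting: "solvable (compat True True True True True True :: 'v::{finite,linorder} arrow \<Rightarrow> _)"
proof (rule solvable_compat_if_cones)
  fix I J :: "'v set"
  assume *: "I \<noteq> {}" "J \<noteq> {}" "I \<inter> J = {}"
  then show "has_cone (compat True True True True True True) I J"
  proof (cases rule: Min_cases)
    case 1
    then show ?thesis using * by (intro has_cone_intersecting) auto
  next
    case 2
    then have "has_cone (compat True True True True True True) J I"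
      using * by (intro has_cone_intersecting) auto
    then show ?thesis by (subst has_cone_swap)
  qed
qed

lemma next_tail:
  fixes I J :: "'v::{finite,linorder} set"
  assumes "h \<in> J" "t0 \<in> I" "h < t0"
  obtains t where "t \<in> I" "h < t" "\<And>v. v \<in> I \<Longrightarrow> h < v \<Longrightarrow> t \<le> v"
proof
  define A where "A = {v \<in> I. h < v}"
  have A: "A \<noteq> {}" using assms by (auto simp: A_def)
  then have "Min A \<in> A" by simp
  then show "Min A \<in> I" "h < Min A" by (auto simp: A_def)
  show "\<And>v. v \<in> I \<Longrightarrow> h < v \<Longrightarrow> Min A \<le> v" using A by (auto simp: A_def)
qed

lemma previous_head:
  fixes I J :: "'v::{finite,linorder} set"
  assumes "t \<in> I" "h0 \<in> J" "h0 < t"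
  obtains h where "h \<in> J" "h < t" "\<And>v. v \<in> J \<Longrightarrow> v < t \<Longrightarrow> v \<le> h"
proof
  define A where "A = {v \<in> J. v < t}"
  have A: "A \<noteq> {}" using assms by (auto simp: A_def)
  then have "Max A \<in> A" by simp
  then show "Max A \<in> J" "Max A < t" by (auto simp: A_def)
  show "\<And>v. v \<in> J \<Longrightarrow> v < t \<Longrightarrow> v \<le> Max A" using A by (auto simp: A_def)
qed

text \<open>If some head precedes some tail, the cone arrow is a backward arrow between a head and
  the tail right behind it, with no node of the problem in between. Any arrow sharing no end with it
  covers it or is disjoint from it, and both positions are compatible for these bits. Otherwise
  every arrow is forward and the outermost one nests around the others.\<close>

lemma solvable_no_cross: "solvable (compat True True True False False False :: 'v::{finite,linorder} arrow \<Rightarrow> _)"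
proof (rule solvable_compat_if_cones)
  fix I J :: "'v set"
  assume *: "I \<noteq> {}" "J \<noteq> {}" "I \<inter> J = {}"
  let ?K = "compat True True True False False False"
  show "has_cone ?K I J"
  proof (cases "\<exists>h0\<in>J. \<exists>t0\<in>I. h0 < t0")
    case True
    then obtain h0 t0 where 0: "h0 \<in> J" "t0 \<in> I" "h0 < t0" by blast
    obtain t where t: "t \<in> I" "h0 < t" "\<And>v. v \<in> I \<Longrightarrow> h0 < v \<Longrightarrow> t \<le> v"
      using next_tail[OF 0] by blast
    obtain h where h: "h \<in> J" "h < t" "\<And>v. v \<in> J \<Longrightarrow> v < t \<Longrightarrow> v \<le> h"
      using previous_head[OF t(1) 0(1) t(2)] by blast
    show ?thesis
    proof (rule has_coneI[OF t(1) h(1)])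
      fix i' j' assume **: "i' \<in> I" "j' \<in> J" "i' \<noteq> t" "j' \<noteq> h"
      have "h0 \<le> h" using h(3) 0 t by blast
      moreover have "h \<noteq> i'" using h(1) ** * by blast
      ultimately have "i' < h \<or> t < i'" using t(3)[OF **(1)] **(3) by fastforce
      moreover have "t \<noteq> j'" "i' \<noteq> j'" using t(1) ** * by blast+
      moreover then have "j' < h \<or> t < j'" using h(3)[OF **(2)] **(4) by fastforce
      ultimately show "compat0 True True True False False False t h i' j' \<or>
          compat0 True True True False False False i' j' t h"
        using h(2) unfolding compat0_def by (smt (verit) order_less_trans less_irrefl linorder_neqE)
    qed
  next
    case False
    show ?thesis
    proof (rule has_coneI)
      show "Min I \<in> I" "Max J \<in> J" using * by auto
      fix i' j' assume **: "i' \<in> I" "j' \<in> J" "i' \<noteq> Min I" "j' \<noteq> Max J"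
      have "Min I < i'" "j' < Max J" using ** by (auto simp: order_less_le)
      moreover have "\<not> j' < i'" "i' \<noteq> j'" using False ** * by blast+
      then have "i' < j'" by simp
      ultimately show "compat0 True True True False False False (Min I) (Max J) i' j' \<or>
          compat0 True True True False False False i' j' (Min I) (Max J)"
        unfolding compat0_def by (simp add: not_less)
    qed
  qed
qed

text \<open>The last node decides. If it is a tail, the backward arrow between the last head and the
  next tail is a cone: a later tail gives a nesting pair, an earlier one a disjoint arrow. If it is
  a head, the outermost arrow \<open>(Min I, Max J)\<close> is a cone, since no tail lies beyond
  \<open>Max J\<close> and arrows with a head before \<open>Min I\<close> cross it by the bit of
  \<open>HTTH\<close>.\<close>

lemma solvable_HTTH_cross: "solvable (compat True True True False False True :: 'v::{finite,linorder} arrow \<Rightarrow> _)"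
proof (rule solvable_compat_if_cones)
  fix I J :: "'v set"
  assume *: "I \<noteq> {}" "J \<noteq> {}" "I \<inter> J = {}"
  then have M: "Max I \<in> I" "Max J \<in> J" by auto
  then have "Max I \<noteq> Max J" using * by (metis disjoint_iff)
  then consider "Max J < Max I" | "Max I < Max J" by fastforce
  then show "has_cone (compat True True True False False True) I J"
  proof cases
    case 1
    obtain t where t: "t \<in> I" "Max J < t" "\<And>v. v \<in> I \<Longrightarrow> Max J < v \<Longrightarrow> t \<le> v"
      using next_tail[OF M(2,1) 1] by blast
    show ?thesis
    proof (rule has_coneI[OF t(1) M(2)])
      fix i' j' assume **: "i' \<in> I" "j' \<in> J" "i' \<noteq> t" "j' \<noteq> Max J"
      have "j' < Max J" using ** by (auto simp: order_less_le)
      moreover have "i' < Max J \<or> t < i'" using t(3)[of i'] ** M * by (metis disjoint_iff linorder_neqE not_le)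
      moreover have "i' \<noteq> j'" using ** * by blast
      ultimately show "compat0 True True True False False True t (Max J) i' j' \<or>
          compat0 True True True False False True i' j' t (Max J)"
        using t(2) unfolding compat0_def by (smt (verit) order_less_trans less_irrefl linorder_neqE)
    qed
  next
    case 2
    show ?thesis
    proof (rule has_coneI)
      show "Min I \<in> I" "Max J \<in> J" using * by auto
      fix i' j' assume **: "i' \<in> I" "j' \<in> J" "i' \<noteq> Min I" "j' \<noteq> Max J"
      have "Min I < i'" "j' < Max J" "i' \<le> Max I" using ** by (auto simp: order_less_le)
      moreover have "i' \<noteq> j'" "j' \<noteq> Min I" using ** * by (blast, metis Min_in disjoint_iff finite)
      ultimately show "compat0 True True True False False True (Min I) (Max J) i' j' \<or>
          compat0 True True True False False True i' j' (Min I) (Max J)"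
        using 2 unfolding compat0_def
        by (smt (verit) order_less_trans order_le_less_trans less_irrefl linorder_neqE)
    qed
  qed
qed

text \<open>Mirror image of the preceding case: reversing both the order of the nodes and all arrows
  fixes the first four types and exchanges \<open>THHT\<close> with \<open>HTTH\<close>.\<close>

lemma solvable_THHT_cross: "solvable (compat True True True False True False :: 'v::{finite,linorder} arrow \<Rightarrow> _)"
proof (rule solvable_compat_if_cones)
  fix I J :: "'v set"
  assume *: "I \<noteq> {}" "J \<noteq> {}" "I \<inter> J = {}"
  then have M: "Min I \<in> I" "Min J \<in> J" by auto
  from * show "has_cone (compat True True True False True False) I J"
  proof (cases rule: Min_cases)
    case 2
    obtain h where h: "h \<in> J" "h < Min I" "\<And>v. v \<in> J \<Longrightarrow> v < Min I \<Longrightarrow> v \<le> h"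
      using previous_head[OF M 2] by blast
    show ?thesis
    proof (rule has_coneI[OF M(1) h(1)])
      fix i' j' assume **: "i' \<in> I" "j' \<in> J" "i' \<noteq> Min I" "j' \<noteq> h"
      have "Min I < i'" using ** by (auto simp: order_less_le)
      moreover have "j' < h \<or> Min I < j'" using h(3)[of j'] ** M * by (metis disjoint_iff linorder_neqE not_le)
      moreover have "i' \<noteq> j'" using ** * by blast
      ultimately show "compat0 True True True False True False (Min I) h i' j' \<or>
          compat0 True True True False True False i' j' (Min I) h"
        using h(2) unfolding compat0_def by (smt (verit) order_less_trans less_irrefl linorder_neqE)
    qed
  next
    case 1
    then show ?thesis using * by (intro has_cone_intersecting) auto
  qed
qed

section \<open>Forward and backward parts of a flow\<close>

lemma sum_pos_iff:
  fixes f :: "'a::finite \<Rightarrow> real"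
  assumes "\<And>i. 0 \<le> f i"
  shows "0 < sum f A \<longleftrightarrow> (\<exists>i\<in>A. 0 < f i)"
  using assms sum_pos2[of A _ f] sum_nonpos[of A f] by (metis finite not_less)

definition cut :: "('v::finite \<Rightarrow> 'v \<Rightarrow> real) \<Rightarrow> 'v set \<Rightarrow> real" where
  "cut f A = (\<Sum>i\<in>A. \<Sum>j\<in>-A. f i j)"

definition flip :: "('v \<Rightarrow> 'v \<Rightarrow> real) \<Rightarrow> 'v \<Rightarrow> 'v \<Rightarrow> real" where
  "flip f = (\<lambda>i j. f j i)"

lemma flip_flip [simp]: "flip (flip f) = f"
  by (simp add: flip_def)

lemma flip_apply [simp]: "flip f i j = f j i"
  by (simp add: flip_def)

lemma flow_flip: "flow b a (flip f) \<longleftrightarrow> flow a b f"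
  by (auto simp: flow_def)

lemma clique_flow_flip:
  "clique_flow (compat n1 n2 n3 n4 c5 c6) b a (flip f) \<longleftrightarrow> clique_flow (compat n2 n1 n4 n3 c6 c5) a b f"
  unfolding clique_flow_def flow_flip flip_apply using compat_swap[of n1 n2 n3 n4 c5 c6] by blast

lemma balanced_commute: "balanced b a \<longleftrightarrow> balanced a b"
  by (auto simp: balanced_def)

lemma solvable_swap:
  assumes "solvable (compat n2 n1 n4 n3 c6 c5 :: 'v::{finite,linorder} arrow \<Rightarrow> _)"
  shows "solvable (compat n1 n2 n3 n4 c5 c6 :: 'v arrow \<Rightarrow> _)"
  unfolding solvable_def
proof (intro allI impI)
  fix a b :: "'v \<Rightarrow> real"
  assume "balanced a b"
  then obtain f where f: "clique_flow (compat n2 n1 n4 n3 c6 c5) b a f"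
    and u: "\<And>g. clique_flow (compat n2 n1 n4 n3 c6 c5) b a g \<Longrightarrow> g = f"
    using assms balanced_commute unfolding solvable_def by metis
  show "\<exists>!f. clique_flow (compat n1 n2 n3 n4 c5 c6) a b f"
  proof (rule ex1I[of _ "flip f"])
    show "clique_flow (compat n1 n2 n3 n4 c5 c6) a b (flip f)" using f by (simp add: clique_flow_flip)
    fix g assume "clique_flow (compat n1 n2 n3 n4 c5 c6) a b g"
    then have "flip g = f" using u[of "flip g"] by (simp add: clique_flow_flip)
    then show "g = flip f" by (metis flip_flip)
  qed
qed

text \<open>Flow inside \<open>A\<close> cancels. Hence the marginals alone determine the net flow
  out of every set, which is how they control where the arrows of a plan pass.\<close>

lemma flow_cut:
  assumes "flow a b f"
  shows "sum a A - sum b A = cut f A - cut (flip f) A"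
proof -
  have split: "(\<Sum>j\<in>UNIV. g j) = (\<Sum>j\<in>A. g j) + (\<Sum>j\<in>-A. g j)" for g :: "'a \<Rightarrow> real"
    by (subst sum.union_disjoint[symmetric]) auto
  have "sum a A = (\<Sum>i\<in>A. (\<Sum>j\<in>A. f i j) + (\<Sum>j\<in>-A. f i j))"
    using assms by (auto simp: flow_def split intro!: sum.cong)
  moreover have "sum b A = (\<Sum>j\<in>A. (\<Sum>i\<in>A. f i j) + (\<Sum>i\<in>-A. f i j))"
    using assms by (auto simp: flow_def split intro!: sum.cong)
  moreover have "(\<Sum>i\<in>A. \<Sum>j\<in>A. f i j) = (\<Sum>j\<in>A. \<Sum>i\<in>A. f i j)" by (rule sum.swap)
  ultimately show ?thesis by (simp add: cut_def sum.distrib)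
qed

lemma cut_nonneg: "(\<And>i j. 0 \<le> f i j) \<Longrightarrow> 0 \<le> cut f A"
  by (simp add: cut_def sum_nonneg)

lemma cut_pos_iff:
  assumes "\<And>i j. 0 \<le> f i j"
  shows "0 < cut f A \<longleftrightarrow> (\<exists>i j. i \<in> A \<and> j \<notin> A \<and> 0 < f i j)"
  unfolding cut_def using assms
  by (subst sum_pos_iff) (auto simp: sum_nonneg sum_pos_iff)

definition forward :: "('v::linorder \<Rightarrow> 'v \<Rightarrow> real) \<Rightarrow> bool" where
  "forward f \<longleftrightarrow> (\<forall>i j. 0 < f i j \<longrightarrow> i < j)"

lemma forward_excess:
  assumes "flow a b f" "forward f"
  shows "0 \<le> sum a {..x} - sum b {..x}"
proof -
  have "\<not> (i \<le> x \<and> x < j \<and> 0 < f j i)" for i j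
    using assms(2) unfolding forward_def by (metis leD less_le_trans less_imp_le)
  then have "\<not> 0 < cut (flip f) {..x}"
    using cut_pos_iff[of "flip f" "{..x}"] flow_nonneg[OF assms(1)] by (auto simp: not_le)
  then show ?thesis
    using flow_cut[OF assms(1), of "{..x}"] cut_nonneg[of f "{..x}"] assms(1) by (simp add: flow_def)
qed

lemma compat_ff:
  fixes t :: "'v::linorder"
  assumes "t < h" "t' < h'" "t < t'" "h \<noteq> t'"
  shows "compat n1 n2 n3 n4 c5 c6 (t, h) (t', h') \<longleftrightarrow>
    h = h' \<or> (h' < h \<and> n1) \<or> (t' < h \<and> h < h' \<and> \<not> n1) \<or> (h < t' \<and> \<not> n3)"
proof -
  consider "h = h'" | "h' < h" | "t' < h" "h < h'" | "h < t'"
    using assms by fastforce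
  then show ?thesis
  proof cases
    case 1 then show ?thesis by (simp add: compat_def)
  next
    case 2 then show ?thesis using assms ordered_facts[of t t' h' h] by (simp add: compat_types)
  next
    case 3 then show ?thesis using assms ordered_facts[of t t' h h'] by (simp add: compat_types)
  next
    case 4 then show ?thesis using assms ordered_facts[of t h t' h'] by (simp add: compat_types)
  qed
qed

text \<open>The node intervals of a forward and a backward arrow can nest in two ways
  (\<open>n3\<close>, \<open>n4\<close>), overlap in two ways (\<open>c5\<close>, \<open>c6\<close>)
  or be disjoint in two ways (\<open>\<not> c5\<close>, \<open>\<not> c6\<close>). The bits
  \<open>n1\<close> and \<open>n2\<close> never enter.\<close>

lemma compat_fb:
  fixes t :: "'v::linorder"
  assumes "t < h" "h' < t'" "t \<noteq> h'" "h \<noteq> t'"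
  shows "compat n1 n2 n3 n4 c5 c6 (t, h) (t', h') \<longleftrightarrow>
    t = t' \<or> h = h' \<or> (t < h' \<and> t' < h \<and> n3) \<or> (h' < t \<and> h < t' \<and> n4) \<or>
    (t < h' \<and> h' < h \<and> h < t' \<and> c5) \<or> (h < h' \<and> \<not> c5) \<or>
    (h' < t \<and> t < t' \<and> t' < h \<and> c6) \<or> (t' < t \<and> \<not> c6)"
proof -
  consider "t = t' \<or> h = h'" | "t < h'" "t' < h" | "h' < t" "h < t'" | "t < h'" "h' < h" "h < t'"
    | "h < h'" | "h' < t" "t < t'" "t' < h" | "t' < t"
    using assms by fastforce
  then show ?thesis
  proof cases
    case 1 then show ?thesis by (auto simp: compat_def)
  next
    case 2 then show ?thesis using assms ordered_facts[of t h' t' h] by (simp add: compat_types)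
  next
    case 3 then show ?thesis using assms ordered_facts[of h' t h t'] compat_types(7)[of h' t h t'] by simp
  next
    case 4 then show ?thesis using assms ordered_facts[of t h' h t'] by (simp add: compat_types)
  next
    case 5 then show ?thesis using assms ordered_facts[of t h h' t'] by (simp add: compat_types)
  next
    case 6 then show ?thesis
      using assms ordered_facts[of h' t t' h] compat_types(11)[of h' t t' h] by simp
  next
    case 7 then show ?thesis
      using assms ordered_facts[of h' t' t h] compat_types(12)[of h' t' t h] by (simp add: compat_commute)
  qed
qed

text \<open>A backward arrow with head \<open>j\<close> brings flow into the initial segment up to
  \<open>j\<close>. Nonnegative excess then forces a forward arrow out of that segment, and it
  overlaps the backward one, which is incompatible when the four bits are off.\<close>

lemma separated_forward:
  assumes bal: "balanced a b" and f: "clique_flow (compat n1 n2 False False False False) a b f"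
    and excess: "\<And>x. 0 \<le> sum a {..x} - sum b {..x}"
  shows "forward f"
  unfolding forward_def
proof (intro allI impI, rule ccontr)
  fix i j assume pos: "0 < f i j" and "\<not> i < j"
  have fl: "flow a b f" using f by (simp add: clique_flow_def)
  note bf = balanced_flow[OF bal fl]
  have "j < i" using bf(5)[OF pos] \<open>\<not> i < j\<close> by simp
  have n: "\<And>i j. 0 \<le> f i j" using fl flow_nonneg by blast
  have "0 < cut (flip f) {..j}"
    using cut_pos_iff[of "flip f" "{..j}"] pos \<open>j < i\<close> n by (auto simp: not_le)
  then have "0 < cut f {..j}" using flow_cut[OF fl, of "{..j}"] excess[of j] by simp
  then obtain i' j' where *: "i' \<le> j" "j < j'" "0 < f i' j'" using n by (auto simp: cut_pos_iff not_le)
  have "i' \<noteq> j" "j' \<noteq> i" using bf[OF pos] bf[OF *(3)] by auto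
  then have "i' < j" using *(1) by simp
  have "compat n1 n2 False False False False (i', j') (i, j)" using f pos * by (auto simp: clique_flow_def)
  then show False
    using \<open>i' < j\<close> \<open>j < i\<close> \<open>j < j'\<close> \<open>j' \<noteq> i\<close> by (subst (asm) compat_fb) auto
qed

lemma separated_backward:
  assumes "balanced a b" and "clique_flow (compat n1 n2 False False False False) a b f"
    and "\<And>x. sum a {..x} - sum b {..x} \<le> 0"
  shows "forward (flip f)"
  using separated_forward[of b a n2 n1 "flip f"] assms
  by (simp add: balanced_commute clique_flow_flip)

section \<open>Exchanging the two parts with their marginals fixed\<close>

definition fw :: "('v::linorder \<Rightarrow> 'v \<Rightarrow> real) \<Rightarrow> 'v \<Rightarrow> 'v \<Rightarrow> real" where
  "fw f = (\<lambda>i j. if i < j then f i j else 0)"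

definition bw :: "('v::linorder \<Rightarrow> 'v \<Rightarrow> real) \<Rightarrow> 'v \<Rightarrow> 'v \<Rightarrow> real" where
  "bw f = (\<lambda>i j. if j < i then f i j else 0)"

text \<open>Finer than equality of the marginals of \<open>f\<close> and \<open>g\<close>: the
  forward parts agree and the backward parts agree separately.\<close>

definition same_marginals :: "('v::{finite,linorder} \<Rightarrow> 'v \<Rightarrow> real) \<Rightarrow> ('v \<Rightarrow> 'v \<Rightarrow> real) \<Rightarrow> bool" where
  "same_marginals f g \<longleftrightarrow> (\<exists>a b a' b'. flow a b (fw f) \<and> flow a b (fw g) \<and> flow a' b' (bw f) \<and> flow a' b' (bw g))"

lemma fw_pos_iff: "0 < fw f i j \<longleftrightarrow> i < j \<and> 0 < f i j"
  and bw_pos_iff: "0 < bw f i j \<longleftrightarrow> j < i \<and> 0 < f i j"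
  by (auto simp: fw_def bw_def)

lemma fw_bw_flow:
  assumes bal: "balanced a b" and fl: "flow a b f"
  obtains a1 b1 a2 b2 where "balanced a1 b1" "balanced a2 b2" "flow a1 b1 (fw f)" "flow a2 b2 (bw f)"
    "\<And>v. a v = a1 v + a2 v" "\<And>v. b v = b1 v + b2 v" "\<And>i j. f i j = fw f i j + bw f i j"
proof -
  define a1 b1 a2 b2 where "a1 = (\<lambda>i. \<Sum>j\<in>UNIV. fw f i j)" and "b1 = (\<lambda>j. \<Sum>i\<in>UNIV. fw f i j)"
    and "a2 = (\<lambda>i. \<Sum>j\<in>UNIV. bw f i j)" and "b2 = (\<lambda>j. \<Sum>i\<in>UNIV. bw f i j)"
  note defs = this
  have n: "0 \<le> f i j" for i j using fl by (rule flow_nonneg)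
  have n': "0 \<le> fw f i j" "0 \<le> bw f i j" for i j using n by (auto simp: fw_def bw_def)
  have "f i i = 0" for i using balanced_flow(5)[OF bal fl, of i i] n[of i i] by fastforce
  then have split: "f i j = fw f i j + bw f i j" for i j by (auto simp: fw_def bw_def neq_iff)
  have 1: "a v = a1 v + a2 v" "b v = b1 v + b2 v" for v
    using fl by (simp_all add: flow_def defs split[symmetric] flip: sum.distrib)
  have 2: "0 \<le> a1 v" "0 \<le> a2 v" "0 \<le> b1 v" "0 \<le> b2 v" for v
    using n' by (simp_all add: defs sum_nonneg)
  have 3: "(a1 v = 0 \<and> a2 v = 0) \<or> (b1 v = 0 \<and> b2 v = 0)" for v
    using bal 1[of v] 2[of v] unfolding balanced_def by (metis add_nonneg_eq_0_iff)
  have 4: "sum a1 UNIV = sum b1 UNIV" "sum a2 UNIV = sum b2 UNIV"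
    unfolding defs by (rule sum.swap)+
  have "balanced a1 b1" "balanced a2 b2" using 2 3 4 unfolding balanced_def by blast+
  moreover have "flow a1 b1 (fw f)" "flow a2 b2 (bw f)" using n' by (auto simp: flow_def defs)
  ultimately show thesis using that 1 split by blast
qed

text \<open>Between two forward arrows, turning \<open>n3\<close> on only forbids the disjoint
  position; all other positions are settled by \<open>n1\<close>.\<close>

lemma compat_forward_restrict:
  assumes "t < h" "t' < h'" "t \<noteq> h'" "h \<noteq> t'" "n3 \<Longrightarrow> t < h' \<and> t' < h"
    and "compat n1 n2 False False False False (t, h) (t', h')"
  shows "compat n1 n2 n3 n4 c5 c6 (t, h) (t', h')"
proof -
  consider "t = t'" | "t < t'" | "t' < t" by fastforce
  then show ?thesis
  proof cases
    case 1 then show ?thesis by (simp add: compat_def)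
  next
    case 2 then show ?thesis using assms compat_ff[of t h t' h'] by auto
  next
    case 3 then show ?thesis using assms compat_ff[of t' h' t h] by (auto simp: compat_commute)
  qed
qed

lemma compat_forward:
  assumes "t < h" "t' < h'" "t \<noteq> h'" "h \<noteq> t'" "compat n1 n2 n3 n4 c5 c6 (t, h) (t', h')"
  shows "compat n1 n2 False False False False (t, h) (t', h')" "n3 \<Longrightarrow> t < h' \<and> t' < h"
proof -
  consider "t = t'" | "t < t'" | "t' < t" by fastforce
  then have "compat n1 n2 False False False False (t, h) (t', h') \<and> (n3 \<longrightarrow> t < h' \<and> t' < h)"
  proof cases
    case 1 then show ?thesis using assms by (simp add: compat_def)
  next
    case 2 then show ?thesis using assms compat_ff[of t h t' h'] by auto
  next
    case 3 then show ?thesis using assms compat_ff[of t' h' t h] by (auto simp: compat_commute)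
  qed
  then show "compat n1 n2 False False False False (t, h) (t', h')" "n3 \<Longrightarrow> t < h' \<and> t' < h" by auto
qed

lemma compat_backward_restrict:
  assumes "h < t" "h' < t'" "t \<noteq> h'" "h \<noteq> t'" "n4 \<Longrightarrow> h < t' \<and> h' < t"
    and "compat n1 n2 False False False False (t, h) (t', h')"
  shows "compat n1 n2 n3 n4 c5 c6 (t, h) (t', h')"
  using compat_forward_restrict[of h t h' t' n4 n2 n1 n3 c6 c5] assms unfolding compat_swap[of n1 n2] by metis

lemma compat_backward:
  assumes "h < t" "h' < t'" "t \<noteq> h'" "h \<noteq> t'" "compat n1 n2 n3 n4 c5 c6 (t, h) (t', h')"
  shows "compat n1 n2 False False False False (t, h) (t', h')" "n4 \<Longrightarrow> h < t' \<and> h' < t"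
  using compat_forward[of h t h' t' n2 n1 n4 n3 c6 c5] assms unfolding compat_swap[of n1 n2] by metis+

text \<open>
  In the four classes below, compatibility of a forward with a backward arrow amounts to
  conditions (see \<open>compat_marginal\<close>) that the marginals of the two parts decide, so either part
  may be replaced by another one with the same marginals.
\<close>

definition marginal_class :: "bool \<Rightarrow> bool \<Rightarrow> bool \<Rightarrow> bool \<Rightarrow> bool" where
  "marginal_class n3 n4 c5 c6 \<longleftrightarrow> n3 \<and> (if n4 then c5 \<and> c6 else \<not> (c5 \<and> c6))"

text \<open>The condition on \<open>h\<close> does not mention \<open>t\<close>, and conversely.
  Each either compares two heads or two tails, which the supports of the marginals decide, or
  forbids the backward arrow to pass strictly over a node, which the net backward flow at that node
  decides.\<close>

lemma compat_marginal:
  assumes "marginal_class n3 n4 c5 c6" "t < h" "h' < t'" "t \<noteq> h'" "h \<noteq> t'"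
  shows "compat n1 n2 n3 n4 c5 c6 (t, h) (t', h') \<longleftrightarrow>
    (if n4 \<or> c5 then h' \<le> h else \<not> (h' < h \<and> h < t')) \<and>
    (if n4 \<or> c6 then t \<le> t' else \<not> (h' < t \<and> t < t'))"
proof -
  consider "t = t'" | "h = h'" "t < t'" | "t < h'" "t' < h" | "h' < t" "h < t'" | "t < h'" "h' < h" "h < t'"
    | "h < h'" | "h' < t" "t < t'" "t' < h" | "t' < t"
    using assms by fastforce
  then show ?thesis
    using assms unfolding compat_fb[OF assms(2-5)] marginal_class_def
    by cases (auto split: if_splits)
qed

lemma flow_same_row_pos: "flow a b f \<Longrightarrow> flow a b' g \<Longrightarrow> 0 < g i j \<Longrightarrow> \<exists>j'. 0 < f i j'"
  using flow_row_pos by metis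

lemma flow_same_column_pos: "flow a b f \<Longrightarrow> flow a' b g \<Longrightarrow> 0 < g i j \<Longrightarrow> \<exists>i'. 0 < f i' j"
  using flow_column_pos by metis

text \<open>Backward arrows never leave a down-closed \<open>A\<close>, so the flow entering
  \<open>A\<close> equals demand minus supply inside and is the same for \<open>f\<close> and
  \<open>g\<close>.\<close>

lemma backward_crossing:
  assumes f: "flow a b f" "forward (flip f)" and g: "flow a b g" "forward (flip g)"
    and pos: "0 < g i j" "i \<notin> A" "j \<in> A" and down: "\<And>x y. x \<in> A \<Longrightarrow> y \<le> x \<Longrightarrow> y \<in> A"
  shows "\<exists>i j. i \<notin> A \<and> j \<in> A \<and> 0 < f i j"
proof -
  have *: "cut u A = 0" if "flow a b u" "forward (flip u)" for u
  proof -
    have "\<not> 0 < cut u A"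
      using that down flow_nonneg[OF that(1)] unfolding forward_def
      by (subst cut_pos_iff) (auto, metis less_imp_le)
    then show ?thesis using cut_nonneg[of u A] flow_nonneg[OF that(1)] by simp
  qed
  have "cut (flip f) A = cut (flip g) A"
    using flow_cut[OF f(1), of A] flow_cut[OF g(1), of A] *[OF f] *[OF g] by simp
  moreover have "0 < cut (flip g) A"
    using pos flow_nonneg[OF g(1)] by (subst cut_pos_iff) auto
  ultimately show ?thesis using cut_pos_iff[of "flip f" A] flow_nonneg[OF f(1)] by auto
qed

text \<open>Each part is replaced by the plan that the separated relation with the new bits
  \<open>n1\<close>, \<open>n2\<close> has for the marginals of that part.\<close>

lemma marginal_transfer:
  fixes a b :: "'v::{finite,linorder} \<Rightarrow> real"
  assumes bal: "balanced a b" and f: "clique_flow (compat m1 m2 n3 n4 c5 c6) a b f"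
    and mc: "marginal_class n3 n4 c5 c6"
  obtains g where "clique_flow (compat n1 n2 n3 n4 c5 c6) a b g" "same_marginals f g"
proof -
  have fl: "flow a b f" using f by (simp add: clique_flow_def)
  note ne = balanced_flow[OF bal fl]
  obtain a1 b1 a2 b2 where bal1: "balanced a1 b1" and bal2: "balanced a2 b2"
    and fl1: "flow a1 b1 (fw f)" and fl2: "flow a2 b2 (bw f)"
    and ab: "\<And>v. a v = a1 v + a2 v" "\<And>v. b v = b1 v + b2 v" "\<And>i j. f i j = fw f i j + bw f i j"
    using fw_bw_flow[OF bal fl] by metis
  have fwd: "forward (fw f)" and bwd: "forward (flip (bw f))"
    by (auto simp: forward_def fw_pos_iff bw_pos_iff)
  obtain g1 where g1: "clique_flow (compat n1 n2 False False False False) a1 b1 g1"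
    using solvable_separated bal1 unfolding solvable_def by blast
  obtain g2 where g2: "clique_flow (compat n1 n2 False False False False) a2 b2 g2"
    using solvable_separated bal2 unfolding solvable_def by blast
  have gl1: "flow a1 b1 g1" and gl2: "flow a2 b2 g2" using g1 g2 by (auto simp: clique_flow_def)
  \<comment> \<open>The old part is forward, so its marginals have nonnegative excess. This forces
    the new plan, taken among all arrows, to be forward as well.\<close>
  have fg1: "forward g1" using separated_forward[OF bal1 g1] forward_excess[OF fl1 fwd] by blast
  have "0 \<le> sum b2 {..x} - sum a2 {..x}" for x
    using forward_excess[of b2 a2 "flip (bw f)" x] fl2 bwd by (simp add: flow_flip)
  then have fg2: "forward (flip g2)" using separated_backward[OF bal2 g2] by simp
  define g where "g = (\<lambda>i j. g1 i j + g2 i j)"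
  have n1: "0 \<le> g1 i j" and n2: "0 \<le> g2 i j" for i j using gl1 gl2 flow_nonneg by blast+
  have g1z: "g1 i j = 0" if "\<not> i < j" for i j using that fg1 n1[of i j] by (auto simp: forward_def order_le_less)
  have g2z: "g2 i j = 0" if "\<not> j < i" for i j using that fg2 n2[of i j] by (auto simp: forward_def order_le_less)
  have fwg: "fw g = g1" and bwg: "bw g = g2"
    using g1z g2z by (auto simp: fw_def bw_def g_def fun_eq_iff not_less)
  have gl: "flow a b g"
    using gl1 gl2 by (auto simp: flow_def g_def sum.distrib ab(1,2))
  note ne' = balanced_flow[OF bal gl]
  have "compat n1 n2 n3 n4 c5 c6 (i, j) (i', j')" if pos: "0 < g i j" "0 < g i' j'" for i j i' j'
  proof -
    have sep: "i \<noteq> j'" "i' \<noteq> j" using ne'[OF pos(1)] ne'[OF pos(2)] by auto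
    have G1: "\<exists>y. x < y \<and> 0 < f x y" "\<exists>x. x < y \<and> 0 < f x y" if "0 < g1 x y" for x y
      using flow_same_row_pos[OF fl1 gl1 that] flow_same_column_pos[OF fl1 gl1 that] by (auto simp: fw_pos_iff)
    have G2: "\<exists>y. y < x \<and> 0 < f x y" "\<exists>x. y < x \<and> 0 < f x y" if "0 < g2 x y" for x y
      using flow_same_row_pos[OF fl2 gl2 that] flow_same_column_pos[OF fl2 gl2 that] by (auto simp: bw_pos_iff)
    have F: "compat m1 m2 n3 n4 c5 c6 (x, y) (x', y')" "x \<noteq> y'" "y \<noteq> x'" if "0 < f x y" "0 < f x' y'" for x y x' y'
      using f that ne[OF that(1)] ne[OF that(2)] by (auto simp: clique_flow_def)
    have FB: "compat n1 n2 n3 n4 c5 c6 (t, h) (t', h')"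
      if p: "0 < g1 t h" "0 < g2 t' h'" and d: "t \<noteq> h'" "h \<noteq> t'" for t h t' h'
    proof -
      have th: "t < h" "h' < t'" using p fg1 fg2 by (auto simp: forward_def)
      \<comment> \<open>Equal marginals provide, at each of the four ends of the new pair, an old
        arrow of the same direction with that end. Compatibility among these old arrows yields the
        conditions for the new pair.\<close>
      obtain h0 where h0: "t < h0" "0 < f t h0" using G1(1)[OF p(1)] by blast
      obtain t0 where t0: "t0 < h" "0 < f t0 h" using G1(2)[OF p(1)] by blast
      obtain h0' where h0': "h0' < t'" "0 < f t' h0'" using G2(1)[OF p(2)] by blast
      obtain t0' where t0': "h' < t0'" "0 < f t0' h'" using G2(2)[OF p(2)] by blast
      have M: "(if n4 \<or> c5 then y' \<le> y else \<not> (y' < y \<and> y < x')) \<and> (if n4 \<or> c6 then x \<le> x' else \<not> (y' < x \<and> x < x'))"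
        if "0 < f x y" "0 < f x' y'" "x < y" "y' < x'" for x y x' y'
        using compat_marginal[OF mc that(3,4) F(2,3)[OF that(1,2)]] F(1)[OF that(1,2)] by blast
      have "h' \<le> h" if "n4 \<or> c5" using M[OF t0(2) t0'(2) t0(1) t0'(1)] that by simp
      moreover have "t \<le> t'" if "n4 \<or> c6" using M[OF h0(2) h0'(2) h0(1) h0'(1)] that by simp
      moreover have "\<not> (h' < h \<and> h < t')" if "\<not> (n4 \<or> c5)"
      proof
        assume "h' < h \<and> h < t'"
        \<comment> \<open>The segment leaves out \<open>h\<close>, so that the old backward arrow
          found has its head strictly below \<open>h\<close>; its tail differs from \<open>h\<close>
          because \<open>h\<close> is a head. For the tail \<open>t\<close> below, the segment
          contains \<open>t\<close> for the mirrored reason.\<close>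
        then have "t' \<notin> {..<h}" "h' \<in> {..<h}" by auto
        then obtain p q where pq: "p \<notin> {..<h}" "q \<in> {..<h}" "0 < bw f p q"
          using backward_crossing[OF fl2 bwd gl2 fg2 p(2), of "{..<h}"] by (meson lessThan_iff le_less_trans)
        then have "p \<noteq> h" using F(3)[OF t0(2), of p q] by (auto simp: bw_pos_iff)
        then have "\<not> (q < h \<and> h < p)" "q < h" "h < p"
          using M[OF t0(2) _ t0(1), of p q] pq that by (auto simp: bw_pos_iff)
        then show False by blast
      qed
      moreover have "\<not> (h' < t \<and> t < t')" if "\<not> (n4 \<or> c6)"
      proof
        assume "h' < t \<and> t < t'"
        then have "t' \<notin> {..t}" "h' \<in> {..t}" by auto
        then obtain p q where pq: "p \<notin> {..t}" "q \<in> {..t}" "0 < bw f p q"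
          using backward_crossing[OF fl2 bwd gl2 fg2 p(2), of "{..t}"] by (meson atMost_iff order_trans)
        then have "q \<noteq> t" using F(2)[OF h0(2), of p q] by (auto simp: bw_pos_iff)
        then have "\<not> (q < t \<and> t < p)" "q < t" "t < p"
          using M[OF h0(2) _ h0(1), of p q] pq that by (auto simp: bw_pos_iff)
        then show False by blast
      qed
      ultimately show ?thesis using compat_marginal[OF mc th d] by presburger
    qed
    have "0 < g1 i j \<or> 0 < g2 i j" "0 < g1 i' j' \<or> 0 < g2 i' j'"
      using pos n1 n2 unfolding g_def by (smt (verit))+
    then consider "0 < g1 i j" "0 < g1 i' j'" | "0 < g2 i j" "0 < g2 i' j'" | "0 < g1 i j" "0 < g2 i' j'" | "0 < g2 i j" "0 < g1 i' j'"
      by blast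
    then show ?thesis
    proof cases
      case 1
      have th: "i < j" "i' < j'" using 1 fg1 by (auto simp: forward_def)
      \<comment> \<open>The overlap that \<open>n3\<close> requires compares a tail with a head
        only, so it is inherited from an old arrow at \<open>x\<close> and an old arrow at
        \<open>y'\<close>.\<close>
      have lt: "x < y'" if p: "n3" "0 < g1 x y" "0 < g1 x' y'" for x y x' y'
      proof -
        obtain v where v: "x < v" "0 < f x v" using G1(1)[OF p(2)] by blast
        obtain u where u: "u < y'" "0 < f u y'" using G1(2)[OF p(3)] by blast
        show ?thesis
          using compat_forward(2)[of x v u y', OF v(1) u(1) F(2)[OF v(2) u(2)] F(3)[OF v(2) u(2)] F(1)[OF v(2) u(2)] p(1)] by blast
      qed
      have "compat n1 n2 False False False False (i, j) (i', j')"
        using g1 1 by (simp add: clique_flow_def)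
      then show ?thesis
        using compat_forward_restrict[OF th sep(1) sep(2)[symmetric]] lt 1 by blast
    next
      case 2
      have th: "j < i" "j' < i'" using 2 fg2 by (auto simp: forward_def)
      have lt: "y < x'" if p: "n4" "0 < g2 x y" "0 < g2 x' y'" for x y x' y'
      proof -
        obtain v where v: "v < x'" "0 < f x' v" using G2(1)[OF p(3)] by blast
        obtain u where u: "y < u" "0 < f u y" using G2(2)[OF p(2)] by blast
        show ?thesis
          using compat_backward(2)[of y u v x', OF u(1) v(1) F(2)[OF u(2) v(2)] F(3)[OF u(2) v(2)] F(1)[OF u(2) v(2)] p(1)] by blast
      qed
      have "compat n1 n2 False False False False (i, j) (i', j')"
        using g2 2 by (simp add: clique_flow_def)
      then show ?thesis
        using compat_backward_restrict[OF th sep(1) sep(2)[symmetric]] lt 2 by blast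
    next
      case 3
      then show ?thesis using FB sep by blast
    next
      case 4
      then show ?thesis using FB[of i' j' i j] sep compat_commute by blast
    qed
  qed
  then have "clique_flow (compat n1 n2 n3 n4 c5 c6) a b g" using gl by (simp add: clique_flow_def)
  moreover have "same_marginals f g"
    using fl1 fl2 gl1 gl2 unfolding same_marginals_def fwg bwg by blast
  ultimately show thesis using that by blast
qed

text \<open>Inside one part the other four bits can only forbid pairs, so each part is also a clique
  flow of the separated relation, where uniqueness is known.\<close>

lemma fw_clique_flow:
  assumes bal: "balanced a b" and g: "clique_flow (compat n1 n2 n3 n4 c5 c6) a b g"
  shows "flow a' b' (fw g) \<Longrightarrow> clique_flow (compat n1 n2 False False False False) a' b' (fw g)"
    and "flow a' b' (bw g) \<Longrightarrow> clique_flow (compat n1 n2 False False False False) a' b' (bw g)"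
proof -
  have fl: "flow a b g" using g by (simp add: clique_flow_def)
  have F: "compat n1 n2 n3 n4 c5 c6 (x, y) (x', y')" "x \<noteq> y'" "y \<noteq> x'" if "0 < g x y" "0 < g x' y'" for x y x' y'
    using g that balanced_flow[OF bal fl that(1)] balanced_flow[OF bal fl that(2)] by (auto simp: clique_flow_def)
  show "flow a' b' (fw g) \<Longrightarrow> clique_flow (compat n1 n2 False False False False) a' b' (fw g)"
    unfolding clique_flow_def fw_pos_iff using compat_forward(1) F by metis
  show "flow a' b' (bw g) \<Longrightarrow> clique_flow (compat n1 n2 False False False False) a' b' (bw g)"
    unfolding clique_flow_def bw_pos_iff using compat_backward(1) F by metis
qed

lemma same_marginals_unique:
  assumes bal: "balanced a b" and g: "clique_flow (compat n1 n2 n3 n4 c5 c6) a b g"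
    and g': "clique_flow (compat n1 n2 n3 n4 c5 c6) a b g'" and same: "same_marginals g g'"
  shows "g = g'"
proof -
  have fl: "flow a b g" "flow a b g'" using g g' by (auto simp: clique_flow_def)
  obtain a1 b1 a2 b2 where *: "balanced a1 b1" "balanced a2 b2" "flow a1 b1 (fw g)" "flow a2 b2 (bw g)"
    "\<And>i j. g i j = fw g i j + bw g i j"
    using fw_bw_flow[OF bal fl(1)] by metis
  have **: "g' i j = fw g' i j + bw g' i j" for i j using fw_bw_flow[OF bal fl(2)] by metis
  have "flow a1 b1 (fw g')" "flow a2 b2 (bw g')"
    using same *(3,4) unfolding same_marginals_def flow_def by fastforce+
  then have "fw g = fw g'" "bw g = bw g'"
    using fw_clique_flow[OF bal g] fw_clique_flow[OF bal g'] * solvable_separated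
    unfolding solvable_def by metis+
  then show ?thesis using *(5) ** by (simp add: fun_eq_iff)
qed

lemma same_marginals_trans:
  assumes "same_marginals f g" "same_marginals g h"
  shows "same_marginals f h"
  using assms unfolding same_marginals_def flow_def by metis

text \<open>Existence is carried over from the bits \<open>True True\<close>. For uniqueness a
  competing plan is carried back; the unique plan there shows that all plans have the same part
  marginals, and these determine the plan.\<close>

lemma solvable_transfer:
  assumes mc: "marginal_class n3 n4 c5 c6"
    and solv: "solvable (compat True True n3 n4 c5 c6 :: 'v::{finite,linorder} arrow \<Rightarrow> _)"
  shows "solvable (compat n1 n2 n3 n4 c5 c6 :: 'v arrow \<Rightarrow> _)"
  unfolding solvable_def
proof (intro allI impI)
  fix a b :: "'v \<Rightarrow> real"
  assume bal: "balanced a b"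
  then obtain f where f: "clique_flow (compat True True n3 n4 c5 c6) a b f"
    and u: "\<And>g. clique_flow (compat True True n3 n4 c5 c6) a b g \<Longrightarrow> g = f"
    using solv unfolding solvable_def by metis
  obtain g where g: "clique_flow (compat n1 n2 n3 n4 c5 c6) a b g" "same_marginals f g"
    using marginal_transfer[OF bal f mc] by blast
  show "\<exists>!f. clique_flow (compat n1 n2 n3 n4 c5 c6) a b f"
  proof (rule ex1I[of _ g])
    fix g' assume g': "clique_flow (compat n1 n2 n3 n4 c5 c6) a b g'"
    obtain f' where "clique_flow (compat True True n3 n4 c5 c6) a b f'" "same_marginals g' f'"
      using marginal_transfer[OF bal g' mc] by blast
    then have "same_marginals g' f" using u by metis
    then show "g' = g" using same_marginals_unique[OF bal g' g(1)] same_marginals_trans g(2) by blast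
  qed (rule g(1))
qed

lemma solvable_marginal_class:
  assumes "marginal_class n3 n4 c5 c6"
  shows "solvable (compat n1 n2 n3 n4 c5 c6 :: 'v::{finite,linorder} arrow \<Rightarrow> _)"
proof (rule solvable_transfer[OF assms])
  show "solvable (compat True True n3 n4 c5 c6 :: 'v arrow \<Rightarrow> _)"
    using assms solvable_intersecting solvable_no_cross solvable_HTTH_cross solvable_THHT_cross
    unfolding marginal_class_def by (cases n4; cases c5; cases c6) simp_all
qed

section \<open>Both mixed types cross\<close>

text \<open>A backward arrow over \<open>i\<close> cannot also cover \<open>j\<close>, as
  \<open>HTHT\<close> does not nest, so the farthest tail among these arrows lies before
  \<open>j\<close> and serves as \<open>x\<close>. A backward arrow passing over that tail would
  have a still farther tail over \<open>i\<close>, or cross the arrow at the farthest tail, which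
  nesting of \<open>HHTT\<close> forbids. Without backward arrows over \<open>i\<close>, the gap is
  \<open>i\<close> itself.\<close>

lemma nesting_backward_gap:
  assumes bal: "balanced a b" and g: "clique_flow (compat n1 True n3 False c5 c6) a b g"
    and ij: "0 < g i j" "i < j"
  obtains x where "i \<le> x" "x < j" "\<And>p q. q \<le> x \<Longrightarrow> x < p \<Longrightarrow> \<not> 0 < g p q"
proof -
  have fl: "flow a b g" using g by (simp add: clique_flow_def)
  note ne = balanced_flow[OF bal fl]
  have K: "compat n1 True n3 False c5 c6 (x, y) (x', y')" "x \<noteq> y'" "y \<noteq> x'" if "0 < g x y" "0 < g x' y'" for x y x' y'
    using g that ne[OF that(1)] ne[OF that(2)] by (auto simp: clique_flow_def)
  define S where "S = {p. \<exists>q\<le>i. i < p \<and> 0 < g p q}"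
  show thesis
  proof (cases "S = {}")
    case True
    then show thesis using that[of i] ij(2) by (auto simp: S_def)
  next
    case False
    define p0 where "p0 = Max S"
    have "p0 \<in> S" using False by (simp add: p0_def)
    then obtain q0 where q0: "q0 \<le> i" "i < p0" "0 < g p0 q0" by (auto simp: S_def)
    have "q0 < i" using K(2)[OF ij(1) q0(3)] q0(1) by auto
    have "\<not> j < p0"
      using K[OF ij(1) q0(3)] \<open>q0 < i\<close> ij(2) q0(2) compat_fb[of i j q0 p0 n1 True n3 False c5 c6] by auto
    then have "p0 < j" using K(3)[OF ij(1) q0(3)] by auto
    moreover have "\<not> 0 < g p q" if "q \<le> p0" "p0 < p" for p q
    proof
      assume pos: "0 < g p q"
      show False
      proof (cases "q \<le> i")
        case True
        then have "p \<in> S" using q0 that pos unfolding S_def by (auto intro: less_trans)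
        then have "p \<le> p0" by (simp add: p0_def)
        then show False using that by simp
      next
        case False
        have "q < p0" using K(2)[OF q0(3) pos] that by auto
        moreover have "compat True n1 False n3 c6 c5 (q0, p0) (q, p)"
          using K(1)[OF q0(3) pos] by (simp add: compat_swap)
        ultimately show False
          using False \<open>q0 < i\<close> q0(2) that compat_ff[of q0 p0 q p True n1 False n3 c6 c5] by auto
      qed
    qed
    ultimately show thesis using that[of p0] q0(2) by auto
  qed
qed

text \<open>At the gap below a forward arrow, flow leaves the initial segment and none enters, so
  the excess would be positive there.\<close>

lemma nesting_backward_only:
  assumes bal: "balanced a b" and g: "clique_flow (compat n1 True n3 False c5 c6) a b g"
    and excess: "\<And>x. sum a {..x} - sum b {..x} \<le> 0"
  shows "forward (flip g)"
  unfolding forward_def flip_apply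
proof (intro allI impI, rule ccontr)
  fix i j assume pos: "0 < g j i" and "\<not> i < j"
  have fl: "flow a b g" using g by (simp add: clique_flow_def)
  have n: "\<And>i j. 0 \<le> g i j" using flow_nonneg[OF fl] .
  have "j < i" using balanced_flow(5)[OF bal fl pos] \<open>\<not> i < j\<close> by simp
  then obtain x where x: "j \<le> x" "x < i" "\<And>p q. q \<le> x \<Longrightarrow> x < p \<Longrightarrow> \<not> 0 < g p q"
    using nesting_backward_gap[OF bal g pos] by blast
  have "\<not> 0 < cut (flip g) {..x}"
    using cut_pos_iff[of "flip g" "{..x}"] n x(3) by (auto simp: not_le)
  moreover have "0 < cut g {..x}"
    using cut_pos_iff[of g "{..x}"] n x(1,2) pos by (auto simp: not_le)
  ultimately show False using flow_cut[OF fl, of "{..x}"] excess[of x] by simp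
qed

text \<open>Under nonpositive excess the plans of both relations consist of backward arrows, on
  which the two relations agree. Thus the separated case decides.\<close>

lemma clique_flow_ex1_backward:
  fixes a b :: "'v::{finite,linorder} \<Rightarrow> real"
  assumes bal: "balanced a b" and excess: "\<And>x. sum a {..x} - sum b {..x} \<le> 0"
  shows "\<exists>!f. clique_flow (compat n1 True n3 False c5 c6) a b f"
proof -
  let ?K = "compat n1 True n3 False c5 c6 :: 'v arrow \<Rightarrow> 'v arrow \<Rightarrow> bool"
    and ?L = "compat n1 True False False False False :: 'v arrow \<Rightarrow> 'v arrow \<Rightarrow> bool"
  have *: "clique_flow ?K a b g \<longleftrightarrow> clique_flow ?L a b g" if fg: "forward (flip g)" for g
  proof -
    have "?K (i, j) (i', j') \<longleftrightarrow> ?L (i, j) (i', j')"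
      if "flow a b g" "0 < g i j" "0 < g i' j'" for i j i' j'
    proof -
      have "j < i" "j' < i'" using fg that unfolding forward_def flip_apply by blast+
      moreover have "i \<noteq> j'" "j \<noteq> i'"
        using balanced_flow[OF bal that(1,2)] balanced_flow[OF bal that(1,3)] by auto
      ultimately show ?thesis using compat_backward(1) compat_backward_restrict by metis
    qed
    then show ?thesis unfolding clique_flow_def by blast
  qed
  obtain f where f: "clique_flow ?L a b f" and u: "\<And>g. clique_flow ?L a b g \<Longrightarrow> g = f"
    using solvable_separated bal unfolding solvable_def by metis
  have "forward (flip f)" using separated_backward[OF bal f] excess by blast
  then have K: "clique_flow ?K a b f" using * f by blast
  have unique: "g = f" if g: "clique_flow ?K a b g" for g
  proof -
    have "forward (flip g)" using nesting_backward_only[OF bal g] excess by blast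
    then show ?thesis using u * g by blast
  qed
  show ?thesis
  proof (rule ex1I[of _ f])
    show "clique_flow ?K a b f" by (rule K)
    show "g = f" if "clique_flow ?K a b g" for g using that by (rule unique)
  qed
qed

lemma cut_le_single:
  assumes n: "\<And>i j. 0 \<le> f i j" and single: "\<And>u v. u \<in> A \<Longrightarrow> v \<notin> A \<Longrightarrow> 0 < f u v \<Longrightarrow> u = i \<and> v = j"
  shows "cut f A \<le> f i j"
proof -
  have z: "f u v = 0" if "u \<in> A" "v \<notin> A" "u \<noteq> i \<or> v \<noteq> j" for u v
    using n[of u v] single[OF that(1,2)] that(3) by fastforce
  have "cut f A = (\<Sum>u\<in>A. if u = i then \<Sum>v\<in>-A. f i v else 0)"
    unfolding cut_def by (rule sum.cong) (auto intro!: sum.neutral simp: z)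
  also have "\<dots> = (if i \<in> A then \<Sum>v\<in>-A. f i v else 0)" by simp
  also have "\<dots> \<le> f i j"
  proof (cases "i \<in> A")
    case True
    then have "(\<Sum>v\<in>-A. f i v) = (\<Sum>v\<in>-A. if v = j then f i j else 0)"
      by (intro sum.cong) (auto simp: z)
    then show ?thesis using n[of i j] by simp
  qed (use n in simp)
  finally show ?thesis .
qed

text \<open>The position excluded by the last assumption, a backward arrow covering
  \<open>(i, j)\<close>, is the nesting of type \<open>HTHT\<close>, whose bit \<open>n4\<close> is
  arbitrary here.\<close>

lemma compat_outermost:
  assumes "i < j" "i \<le> x" "y \<le> j" "x \<noteq> y" "x \<noteq> j" "y \<noteq> i" "\<not> (y < i \<and> j < x)"
  shows "compat True n2 True n4 True True (i, j) (x, y)"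
proof -
  consider "x = i \<or> y = j" | "i < x" "x < y" "y < j" | "i < x" "y < j" "y < x"
    using assms by fastforce
  then show ?thesis
  proof cases
    case 1 then show ?thesis by (auto simp: compat_def)
  next
    case 2 then show ?thesis using assms compat_ff[of i j x y] by auto
  next
    case 3 then show ?thesis using assms compat_fb[of i j y x] by fastforce
  qed
qed

text \<open>
  Here a cone need not exist. The arrow \<open>(i, j)\<close> from the first tail to the last head fails to be
  compatible only with backward arrows covering it, and these cannot occur while the excess \<open>e\<close>
  of supply over demand is positive somewhere, since then some forward arrow lies below \<open>(i, j)\<close>.
  So \<open>(i, j)\<close> is filled until it is saturated or the maximal excess \<open>m\<close> is used up; in the latter
  case only backward arrows remain.
\<close>

lemma solvable_both_cross: "solvable (compat True True True False True True :: 'v::{finite,linorder} arrow \<Rightarrow> _)"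
  unfolding solvable_def
proof (intro allI impI)
  let ?K = "compat True True True False True True :: 'v arrow \<Rightarrow> 'v arrow \<Rightarrow> bool"
  fix a b :: "'v \<Rightarrow> real"
  assume "balanced a b"
  then show "\<exists>!f. clique_flow ?K a b f"
  proof (induction "support_size a b" arbitrary: a b rule: less_induct)
    case (less a b)
    note bal = less.prems
    have an: "\<And>v. 0 \<le> a v" and bn: "\<And>v. 0 \<le> b v" and tot: "sum a UNIV = sum b UNIV"
      and dj: "\<And>v. a v = 0 \<or> b v = 0"
      using bal by (auto simp: balanced_def)
    define e where "e x = sum a {..x} - sum b {..x}" for x
    show ?case
    proof (cases "\<forall>x. e x \<le> 0")
      case True
      then show ?thesis using clique_flow_ex1_backward[OF bal] by (simp add: e_def)
    next
      case False
      define m where "m = Max (range e)"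
      have "m \<in> range e" unfolding m_def by (intro Max_in) auto
      then obtain x0 where x0: "e x0 = m" by auto
      have le_m: "e x \<le> m" for x by (simp add: m_def)
      have "0 < m" using False le_m by (meson less_le_trans not_le)
      define i j where "i = Min {v. 0 < a v}" and "j = Max {v. 0 < b v}"
      have i_le: "i \<le> v" if "0 < a v" for v using that by (simp add: i_def)
      have j_ge: "v \<le> j" if "0 < b v" for v using that by (simp add: j_def)
      have ex_ab: "(\<exists>v\<le>x. 0 < a v) \<and> (\<exists>v>x. 0 < b v)" if "0 < e x" for x
      proof -
        have "sum b UNIV = sum b {..x} + sum b {x<..}"
          by (subst sum.union_disjoint[symmetric]) (auto intro!: sum.cong)
        moreover have "sum a {..x} \<le> sum a UNIV" using an by (intro sum_mono2) auto
        moreover have "0 \<le> sum b {..x}" using bn by (simp add: sum_nonneg)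
        ultimately have "0 < sum a {..x}" "0 < sum b {x<..}" using that tot unfolding e_def by simp_all
        then show ?thesis using sum_pos_iff[of a "{..x}"] sum_pos_iff[of b "{x<..}"] an bn by auto
      qed
      then have ex_a: "\<exists>v\<le>x0. 0 < a v" and ex_b: "\<exists>v>x0. 0 < b v" using x0 \<open>0 < m\<close> by blast+
      have i: "0 < a i" using ex_a Min_in[of "{v. 0 < a v}"] unfolding i_def by auto
      have j: "0 < b j" using ex_b Max_in[of "{v. 0 < b v}"] unfolding j_def by auto
      have "i \<le> x0" using ex_a i_le by (meson order_trans)
      have "x0 < j" using ex_b j_ge by (meson less_le_trans)
      have "i < j" using \<open>i \<le> x0\<close> \<open>x0 < j\<close> by simp
      define d where "d = min (min (a i) (b j)) m"
      have d: "0 \<le> d" "d \<le> a i" "d \<le> b j" "d \<le> m" using i j \<open>0 < m\<close> by (auto simp: d_def)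
      let ?a = "a(i := a i - d)" and ?b = "b(j := b j - d)"
      have bal': "balanced ?a ?b" using balanced_peel bal d by blast
      have e': "sum ?a {..x} - sum ?b {..x} = e x - (if i \<le> x \<and> x < j then d else 0)" for x
      proof -
        have "sum (u(k := u k - d)) {..x} = sum u {..x} - (if k \<le> x then d else 0)" for u :: "'v \<Rightarrow> real" and k
        proof (cases "k \<le> x")
          case True
          then show ?thesis by (subst (1 2) sum.remove[of _ k]) (auto intro: sum.cong)
        next
          case False
          then show ?thesis by (auto intro!: sum.cong)
        qed
        then show ?thesis using \<open>i < j\<close> by (auto simp: e_def not_less)
      qed
      \<comment> \<open>A covering backward arrow itself carries flow into the segment up to
        \<open>x0\<close>, so nonnegative excess there already forces a forward arrow out of it.
        That arrow lies within \<open>i\<close> and \<open>j\<close>, hence below the covering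
        arrow, and \<open>HTHT\<close> does not nest.\<close>
      have no_cover: "\<not> (y < i \<and> j < x)"
        if g: "clique_flow ?K a' b' g" and bal_g: "balanced a' b'" and pos: "0 < g x y"
          and sub: "\<And>v. 0 < a' v \<Longrightarrow> i \<le> v" "\<And>v. 0 < b' v \<Longrightarrow> v \<le> j"
          and ex: "0 \<le> sum a' {..x0} - sum b' {..x0}" for a' b' g x y
      proof
        assume c: "y < i \<and> j < x"
        have fl: "flow a' b' g" using g by (simp add: clique_flow_def)
        have n: "\<And>i j. 0 \<le> g i j" using flow_nonneg[OF fl] .
        have "y \<le> x0" "x0 < x" using c \<open>i \<le> x0\<close> \<open>x0 < j\<close> by auto
        then have "0 < cut (flip g) {..x0}" using cut_pos_iff[of "flip g"] n pos by (auto simp: not_le)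
        then have "0 < cut g {..x0}" using flow_cut[OF fl, of "{..x0}"] ex by simp
        then obtain p q where pq: "p \<le> x0" "x0 < q" "0 < g p q" using n by (auto simp: cut_pos_iff not_le)
        then have "i \<le> p" "q \<le> j" using sub balanced_flow[OF bal_g fl pq(3)] by blast+
        then have "p < q" "y < p" "q < x" using c pq by auto
        moreover have "?K (p, q) (x, y)" using g pq(3) pos by (simp add: clique_flow_def)
        ultimately show False
          using compat_fb[of p q y x True True True False True True] by auto
      qed
      show ?thesis
      proof (rule clique_flow_peel_ex1[OF bal d(1-3) compat_sym compat_refl])
        show "\<exists>!f. clique_flow ?K ?a ?b f"
        proof (cases "d = m")
          case True
          have "sum ?a {..x} - sum ?b {..x} \<le> 0" for x
          proof (cases "0 < e x")
            case pos: True
            then have "i \<le> x" "x < j" using ex_ab i_le j_ge by (meson order_trans, meson less_le_trans)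
            then show ?thesis unfolding e' using True le_m[of x] by simp
          next
            case False
            then show ?thesis unfolding e' using d(1) by auto
          qed
          then show ?thesis using clique_flow_ex1_backward[OF bal'] by blast
        next
          case False
          then have "d = a i \<or> d = b j" by (auto simp: d_def min_def split: if_splits)
          then show ?thesis using less.hyps[OF support_size_peel[of a i b j d] bal'] i j d(1) by blast
        qed
      next
        fix f x y assume f: "clique_flow ?K ?a ?b f" and pos: "0 < f x y"
        have fl: "flow ?a ?b f" using f by (simp add: clique_flow_def)
        have sub: "0 < a v" if "0 < ?a v" for v using that d(1) by (auto split: if_splits)
        have sub': "0 < b v" if "0 < ?b v" for v using that d(1) by (auto split: if_splits)
        note ne = balanced_flow[OF bal' fl pos]
        have a: "0 < a x" and b: "0 < b y" using sub sub' ne by blast+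
        have "0 \<le> sum ?a {..x0} - sum ?b {..x0}" unfolding e' using x0 d by simp
        then have "\<not> (y < i \<and> j < x)"
          using no_cover[OF f bal' pos] i_le[OF sub] j_ge[OF sub'] by blast
        moreover have "x \<noteq> j" "y \<noteq> i" using a b i j dj by (metis less_irrefl)+
        ultimately show "?K (i, j) (x, y)"
          using compat_outermost[OF \<open>i < j\<close>] i_le[OF a] j_ge[OF b] ne(5) by blast
      next
        fix g assume g: "clique_flow ?K a b g"
        then have fl: "flow a b g" by (simp add: clique_flow_def)
        have n: "\<And>i j. 0 \<le> g i j" using flow_nonneg[OF fl] .
        note ne = balanced_flow[OF bal fl]
        show "d \<le> g i j"
        proof (rule ccontr)
          assume less: "\<not> d \<le> g i j"
          then have "g i j < a i" "g i j < b j" using d by auto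
          then obtain i' j' where ij': "i' \<noteq> i" "j' \<noteq> j" "0 < g i j'" "0 < g i' j"
            using flow_unsaturated[OF fl] by blast
          have pos: "0 < a i'" "0 < b j'" using ne[OF ij'(3)] ne[OF ij'(4)] by auto
          then have dist: "distinct [i, i', j, j']" using ij' i j dj \<open>i < j\<close> by auto (metis less_irrefl)+
          have "?K (i, j') (i', j)" using g ij' by (simp add: clique_flow_def)
          then have "\<not> ?K (i, j) (i', j')" using compat_exclusive[OF dist] by blast
          then have out: "j' < i \<and> j < i'"
            using compat_outermost[of i j i' j'] \<open>i < j\<close> i_le[OF pos(1)] j_ge[OF pos(2)] dist by auto
          \<comment> \<open>Both \<open>(i, j')\<close> and \<open>(i', j)\<close> are backward. A
            forward arrow within \<open>i\<close> and \<open>j\<close> overlaps them or touches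
            them, and compatibility with the first forces its tail to be \<open>i\<close>, with the
            second its head to be \<open>j\<close>. So \<open>(i, j)\<close> alone carries flow
            across \<open>x0\<close>.\<close>
          have "cut g {..x0} \<le> g i j"
          proof (rule cut_le_single[OF n])
            fix p q assume "p \<in> {..x0}" "q \<notin> {..x0}" and pq: "0 < g p q"
            then have "p < q" by simp
            have "i \<le> p" "q \<le> j" using ne[OF pq] i_le j_ge by blast+
            moreover have "?K (p, q) (i, j')" "?K (p, q) (i', j)" using g pq ij' by (auto simp: clique_flow_def)
            moreover from calculation(1,2) have "j' < p" "q < i'" "i < q" "p < j" using \<open>p < q\<close> out by auto
            ultimately show "p = i \<and> q = j"
              using \<open>p < q\<close> out \<open>i < j\<close> compat_fb[of p q j' i True True True False True True]
                compat_fb[of p q j i' True True True False True True] by auto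
          qed
          moreover have "m \<le> cut g {..x0}"
            using flow_cut[OF fl, of "{..x0}"] cut_nonneg[of "flip g" "{..x0}"] n x0 by (simp add: e_def)
          ultimately show False using less d(4) by simp
        qed
      qed
    qed
  qed
qed

text \<open>The three conditions of the theorem as a plain disjunction. They are mutually exclusive
  by the values of \<open>n3\<close> and \<open>n4\<close>, so this agrees with "exactly
  one".\<close>

definition triangulating :: "bool \<Rightarrow> bool \<Rightarrow> bool \<Rightarrow> bool \<Rightarrow> bool \<Rightarrow> bool \<Rightarrow> bool" where
  "triangulating n1 n2 n3 n4 c5 c6 \<longleftrightarrow>
     (\<not> n3 \<and> \<not> n4 \<and> \<not> c5 \<and> \<not> c6) \<or> (n3 \<and> n4 \<and> c5 \<and> c6) \<or> (n3 \<noteq> n4 \<and> (c5 \<and> c6 \<longrightarrow> n1 \<and> n2))"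

text \<open>Reversing arrows reduces to \<open>n3\<close> being on or both \<open>n3\<close> and
  \<open>n4\<close> being off. With \<open>n3\<close> on, the good vector outside the marginal
  classes is the one treated by \<open>solvable_both_cross\<close>.\<close>

lemma solvable_if_triangulating:
  assumes "triangulating n1 n2 n3 n4 c5 c6"
  shows "solvable (compat n1 n2 n3 n4 c5 c6 :: 'v::{finite,linorder} arrow \<Rightarrow> _)"
proof -
  have *: "solvable (compat n1 n2 True n4 c5 c6 :: 'v arrow \<Rightarrow> _)"
    if "triangulating n1 n2 True n4 c5 c6" for n1 n2 n4 c5 c6
  proof (cases "marginal_class True n4 c5 c6")
    case True
    then show ?thesis by (rule solvable_marginal_class)
  next
    case False
    then have "n1" "n2" "\<not> n4" "c5" "c6"
      using that by (auto simp: marginal_class_def triangulating_def split: if_splits)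
    then show ?thesis using solvable_both_cross by simp
  qed
  consider "n3" | "n4" | "\<not> n3" "\<not> n4" by blast
  then show ?thesis
  proof cases
    case 1
    then show ?thesis using *[of n1 n2 n4 c5 c6] assms by simp
  next
    case 2
    then have "solvable (compat n2 n1 n4 n3 c6 c5 :: 'v arrow \<Rightarrow> _)"
      using *[of n2 n1 n3 c6 c5] assms by (auto simp: triangulating_def)
    then show ?thesis by (rule solvable_swap)
  next
    case 3
    then show ?thesis using solvable_separated[of n1 n2] assms by (simp add: triangulating_def)
  qed
qed

section \<open>The compatibility relation of a uniform complex\<close>

text \<open>For \<open>p < q\<close> the flag marks forward arrows, so two flags encode the type of
  a nesting or crossing pair.\<close>

definition arrow_between :: "bool \<Rightarrow> 'v \<Rightarrow> 'v \<Rightarrow> 'v arrow" where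
  "arrow_between u p q = (if u then (p, q) else (q, p))"

definition role_of :: "bool \<Rightarrow> role" where
  "role_of u = (if u then T else H)"

lemma role_of_inject [simp]: "role_of u = role_of v \<longleftrightarrow> u = v"
  by (simp add: role_of_def)

lemma pair_type_sorted:
  fixes p1 p2 p3 p4 :: "'v::linorder"
  assumes "p1 < p2" "p2 < p3" "p3 < p4" "endpoints \<alpha> \<beta> = {p1, p2, p3, p4}"
  shows "pair_type \<alpha> \<beta> = map (\<lambda>p. role_of (p = tail \<alpha> \<or> p = tail \<beta>)) [p1, p2, p3, p4]"
proof -
  have "sorted_list_of_set (endpoints \<alpha> \<beta>) = [p1, p2, p3, p4]"
    using assms sorted_list_of_set.idem_if_sorted_distinct[of "[p1, p2, p3, p4]"]
    by (simp add: ordered_facts[OF assms(1-3)] less_imp_le)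
  then show ?thesis by (simp add: pair_type_def role_of_def)
qed

lemma pair_type_nesting:
  fixes p1 p2 p3 p4 :: "'v::linorder"
  assumes "p1 < p2" "p2 < p3" "p3 < p4"
  shows "pair_type (arrow_between u p1 p4) (arrow_between v p2 p3) = map role_of [u, v, \<not> v, \<not> u]"
    and "pair_type (arrow_between v p2 p3) (arrow_between u p1 p4) = map role_of [u, v, \<not> v, \<not> u]"
proof -
  have "endpoints (arrow_between u p1 p4) (arrow_between v p2 p3) = {p1, p2, p3, p4}"
    "endpoints (arrow_between v p2 p3) (arrow_between u p1 p4) = {p1, p2, p3, p4}"
    by (auto simp: endpoints_def arrow_between_def)
  note this[THEN pair_type_sorted[OF assms]]
  then show "pair_type (arrow_between u p1 p4) (arrow_between v p2 p3) = map role_of [u, v, \<not> v, \<not> u]"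
    "pair_type (arrow_between v p2 p3) (arrow_between u p1 p4) = map role_of [u, v, \<not> v, \<not> u]"
    by (simp_all add: arrow_between_def ordered_facts[OF assms])
qed

lemma pair_type_crossing:
  fixes p1 p2 p3 p4 :: "'v::linorder"
  assumes "p1 < p2" "p2 < p3" "p3 < p4"
  shows "pair_type (arrow_between u p1 p3) (arrow_between v p2 p4) = map role_of [u, v, \<not> u, \<not> v]"
    and "pair_type (arrow_between v p2 p4) (arrow_between u p1 p3) = map role_of [u, v, \<not> u, \<not> v]"
proof -
  have "endpoints (arrow_between u p1 p3) (arrow_between v p2 p4) = {p1, p2, p3, p4}"
    "endpoints (arrow_between v p2 p4) (arrow_between u p1 p3) = {p1, p2, p3, p4}"
    by (auto simp: endpoints_def arrow_between_def)
  note this[THEN pair_type_sorted[OF assms]]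
  then show "pair_type (arrow_between u p1 p3) (arrow_between v p2 p4) = map role_of [u, v, \<not> u, \<not> v]"
    "pair_type (arrow_between v p2 p4) (arrow_between u p1 p3) = map role_of [u, v, \<not> u, \<not> v]"
    by (simp_all add: arrow_between_def ordered_facts[OF assms])
qed

lemma arrow_between_ends: "{tail \<alpha>, head \<alpha>} = {p, q} \<Longrightarrow> \<exists>u. \<alpha> = arrow_between u p q"
  by (cases \<alpha>) (auto simp: arrow_between_def doubleton_eq_iff)

lemma nesting_pairE:
  assumes "nesting_pair \<alpha> \<beta>"
  obtains p1 p2 p3 p4 u v where "p1 < p2" "p2 < p3" "p3 < p4"
    "(\<alpha> = arrow_between u p1 p4 \<and> \<beta> = arrow_between v p2 p3) \<or>
     (\<beta> = arrow_between u p1 p4 \<and> \<alpha> = arrow_between v p2 p3)"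
proof -
  obtain p1 p2 p3 p4 where p: "p1 < p2" "p2 < p3" "p3 < p4"
    and "{{tail \<alpha>, head \<alpha>}, {tail \<beta>, head \<beta>}} = {{p1, p4}, {p2, p3}}"
    using assms unfolding nesting_pair_def by blast
  then consider "{tail \<alpha>, head \<alpha>} = {p1, p4}" "{tail \<beta>, head \<beta>} = {p2, p3}"
    | "{tail \<alpha>, head \<alpha>} = {p2, p3}" "{tail \<beta>, head \<beta>} = {p1, p4}"
    by (subst (asm) doubleton_eq_iff) blast
  then show thesis
  proof cases
    case 1
    obtain u v where "\<alpha> = arrow_between u p1 p4" "\<beta> = arrow_between v p2 p3"
      using arrow_between_ends[OF 1(1)] arrow_between_ends[OF 1(2)] by (elim exE)
    then show thesis using that[OF p, of u v] by blast
  next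
    case 2
    obtain u v where "\<alpha> = arrow_between v p2 p3" "\<beta> = arrow_between u p1 p4"
      using arrow_between_ends[OF 2(1)] arrow_between_ends[OF 2(2)] by (elim exE)
    then show thesis using that[OF p, of u v] by blast
  qed
qed

lemma crossing_pairE:
  assumes "crossing_pair \<alpha> \<beta>"
  obtains p1 p2 p3 p4 u v where "p1 < p2" "p2 < p3" "p3 < p4"
    "(\<alpha> = arrow_between u p1 p3 \<and> \<beta> = arrow_between v p2 p4) \<or>
     (\<beta> = arrow_between u p1 p3 \<and> \<alpha> = arrow_between v p2 p4)"
proof -
  obtain p1 p2 p3 p4 where p: "p1 < p2" "p2 < p3" "p3 < p4"
    and "{{tail \<alpha>, head \<alpha>}, {tail \<beta>, head \<beta>}} = {{p1, p3}, {p2, p4}}"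
    using assms unfolding crossing_pair_def by blast
  then consider "{tail \<alpha>, head \<alpha>} = {p1, p3}" "{tail \<beta>, head \<beta>} = {p2, p4}"
    | "{tail \<alpha>, head \<alpha>} = {p2, p4}" "{tail \<beta>, head \<beta>} = {p1, p3}"
    by (subst (asm) doubleton_eq_iff) blast
  then show thesis
  proof cases
    case 1
    obtain u v where "\<alpha> = arrow_between u p1 p3" "\<beta> = arrow_between v p2 p4"
      using arrow_between_ends[OF 1(1)] arrow_between_ends[OF 1(2)] by (elim exE)
    then show thesis using that[OF p, of u v] by blast
  next
    case 2
    obtain u v where "\<alpha> = arrow_between v p2 p4" "\<beta> = arrow_between u p1 p3"
      using arrow_between_ends[OF 2(1)] arrow_between_ends[OF 2(2)] by (elim exE)
    then show thesis using that[OF p, of u v] by blast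
  qed
qed

lemma edge_commute: "edge \<Delta> \<alpha> \<beta> \<longleftrightarrow> edge \<Delta> \<beta> \<alpha>"
  by (auto simp: edge_def insert_commute)

lemma uniform_edge:
  assumes "uniform_flag_complex \<Delta>" "same_order_pattern [i1, j1, i2, j2] [i1', j1', i2', j2']"
  shows "edge \<Delta> (i1, j1) (i2, j2) \<longleftrightarrow> edge \<Delta> (i1', j1') (i2', j2')"
  using assms unfolding uniform_flag_complex_def by blast

lemma same_order_patternI:
  assumes "length xs = length ys"
    and "\<And>s t. s < length xs \<Longrightarrow> t < length xs \<Longrightarrow> xs ! s < xs ! t \<longleftrightarrow> ys ! s < ys ! t"
  shows "same_order_pattern xs ys"
proof -
  have "xs ! s = xs ! t \<longleftrightarrow> ys ! s = ys ! t" if "s < length xs" "t < length xs" for s t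
    using assms(2)[OF that] assms(2)[OF that(2,1)] by (metis less_irrefl linorder_neqE)
  then show ?thesis unfolding same_order_pattern_def using assms by simp
qed

lemma same_order_pattern_four:
  assumes "a < b \<longleftrightarrow> a' < b'" "a < c \<longleftrightarrow> a' < c'" "a < d \<longleftrightarrow> a' < d'"
    "b < a \<longleftrightarrow> b' < a'" "b < c \<longleftrightarrow> b' < c'" "b < d \<longleftrightarrow> b' < d'"
    "c < a \<longleftrightarrow> c' < a'" "c < b \<longleftrightarrow> c' < b'" "c < d \<longleftrightarrow> c' < d'"
    "d < a \<longleftrightarrow> d' < a'" "d < b \<longleftrightarrow> d' < b'" "d < c \<longleftrightarrow> d' < c'"
  shows "same_order_pattern [a, b, c, d] [a', b', c', d']"
proof (rule same_order_patternI)
  fix s t assume "s < length [a, b, c, d]" "t < length [a, b, c, d]"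
  then have "s \<in> {0, 1, 2, 3}" "t \<in> {0, 1, 2, 3}" by auto
  then show "[a, b, c, d] ! s < [a, b, c, d] ! t \<longleftrightarrow> [a', b', c', d'] ! s < [a', b', c', d'] ! t"
    using assms by (elim insertE emptyE) simp_all
qed simp

lemma uniform_nesting:
  assumes u: "uniform_flag_complex \<Delta>" and p: "p1 < p2" "p2 < p3" "p3 < p4" and q: "q1 < q2" "q2 < q3" "q3 < q4"
  shows "edge \<Delta> (arrow_between u p1 p4) (arrow_between v p2 p3) \<longleftrightarrow>
    edge \<Delta> (arrow_between u q1 q4) (arrow_between v q2 q3)"
  unfolding arrow_between_def
  by (cases u; cases v)
     (simp_all, (rule uniform_edge[OF u], rule same_order_pattern_four;
       simp add: ordered_facts[OF p] ordered_facts[OF q])+)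

lemma uniform_crossing:
  assumes u: "uniform_flag_complex \<Delta>" and p: "p1 < p2" "p2 < p3" "p3 < p4" and q: "q1 < q2" "q2 < q3" "q3 < q4"
  shows "edge \<Delta> (arrow_between u p1 p3) (arrow_between v p2 p4) \<longleftrightarrow>
    edge \<Delta> (arrow_between u q1 q3) (arrow_between v q2 q4)"
  unfolding arrow_between_def
  by (cases u; cases v)
     (simp_all, (rule uniform_edge[OF u], rule same_order_pattern_four;
       simp add: ordered_facts[OF p] ordered_facts[OF q])+)

lemma nesting_pair_between:
  "p1 < p2 \<Longrightarrow> p2 < p3 \<Longrightarrow> p3 < p4 \<Longrightarrow> nesting_pair (arrow_between u p1 p4) (arrow_between v p2 p3)"
  unfolding nesting_pair_def by (rule exI[of _ p1], rule exI[of _ p2], rule exI[of _ p3], rule exI[of _ p4])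
    (auto simp: arrow_between_def)

lemma crossing_pair_between:
  "p1 < p2 \<Longrightarrow> p2 < p3 \<Longrightarrow> p3 < p4 \<Longrightarrow> crossing_pair (arrow_between u p1 p3) (arrow_between v p2 p4)"
  unfolding crossing_pair_def by (rule exI[of _ p1], rule exI[of _ p2], rule exI[of _ p3], rule exI[of _ p4])
    (auto simp: arrow_between_def)

text \<open>Uniformity lets one quadruple decide for all of its type. The quadruple at hand also
  rules out vacuity, which makes \<open>nest\<close> and \<open>do_not_nest\<close>
  complementary.\<close>

lemma nest_iff_edge:
  assumes u: "uniform_flag_complex \<Delta>" and p: "p1 < p2" "p2 < p3" "p3 < p4"
  shows "nest \<Delta> (map role_of [u, v, \<not> v, \<not> u]) \<longleftrightarrow> edge \<Delta> (arrow_between u p1 p4) (arrow_between v p2 p3)" (is "?N \<longleftrightarrow> ?E")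
    and "do_not_nest \<Delta> (map role_of [u, v, \<not> v, \<not> u]) \<longleftrightarrow> \<not> edge \<Delta> (arrow_between u p1 p4) (arrow_between v p2 p3)" (is "?D \<longleftrightarrow> _")
proof -
  have *: "edge \<Delta> \<alpha> \<beta> \<longleftrightarrow> ?E"
    if np: "nesting_pair \<alpha> \<beta>" and type: "pair_type \<alpha> \<beta> = map role_of [u, v, \<not> v, \<not> u]" for \<alpha> \<beta>
  proof -
    obtain q1 q2 q3 q4 u' v' where q: "q1 < q2" "q2 < q3" "q3 < q4"
      and ab: "(\<alpha> = arrow_between u' q1 q4 \<and> \<beta> = arrow_between v' q2 q3) \<or>
        (\<beta> = arrow_between u' q1 q4 \<and> \<alpha> = arrow_between v' q2 q3)"
      using nesting_pairE[OF np] by metis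
    have "pair_type \<alpha> \<beta> = map role_of [u', v', \<not> v', \<not> u']"
      using ab pair_type_nesting[OF q] by auto
    then have "u' = u" "v' = v" using type by auto
    then show ?thesis using ab uniform_nesting[OF u q p, of u v] edge_commute[of \<Delta> \<alpha> \<beta>] by auto
  qed
  have **: "nesting_pair (arrow_between u p1 p4) (arrow_between v p2 p3)"
    "pair_type (arrow_between u p1 p4) (arrow_between v p2 p3) = map role_of [u, v, \<not> v, \<not> u]"
    using nesting_pair_between[OF p] pair_type_nesting[OF p] by blast+
  show "?N \<longleftrightarrow> ?E" unfolding nest_def using * ** by blast
  show "?D \<longleftrightarrow> \<not> ?E" unfolding do_not_nest_def using * ** by blast
qed

lemma cross_iff_edge:
  assumes u: "uniform_flag_complex \<Delta>" and p: "p1 < p2" "p2 < p3" "p3 < p4"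
  shows "cross \<Delta> (map role_of [u, v, \<not> u, \<not> v]) \<longleftrightarrow> edge \<Delta> (arrow_between u p1 p3) (arrow_between v p2 p4)" (is "?N \<longleftrightarrow> ?E")
    and "do_not_cross \<Delta> (map role_of [u, v, \<not> u, \<not> v]) \<longleftrightarrow> \<not> edge \<Delta> (arrow_between u p1 p3) (arrow_between v p2 p4)" (is "?D \<longleftrightarrow> _")
proof -
  have *: "edge \<Delta> \<alpha> \<beta> \<longleftrightarrow> ?E"
    if np: "crossing_pair \<alpha> \<beta>" and type: "pair_type \<alpha> \<beta> = map role_of [u, v, \<not> u, \<not> v]" for \<alpha> \<beta>
  proof -
    obtain q1 q2 q3 q4 u' v' where q: "q1 < q2" "q2 < q3" "q3 < q4"
      and ab: "(\<alpha> = arrow_between u' q1 q3 \<and> \<beta> = arrow_between v' q2 q4) \<or>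
        (\<beta> = arrow_between u' q1 q3 \<and> \<alpha> = arrow_between v' q2 q4)"
      using crossing_pairE[OF np] by metis
    have "pair_type \<alpha> \<beta> = map role_of [u', v', \<not> u', \<not> v']"
      using ab pair_type_crossing[OF q] by auto
    then have "u' = u" "v' = v" using type by auto
    then show ?thesis using ab uniform_crossing[OF u q p, of u v] edge_commute[of \<Delta> \<alpha> \<beta>] by auto
  qed
  have **: "crossing_pair (arrow_between u p1 p3) (arrow_between v p2 p4)"
    "pair_type (arrow_between u p1 p3) (arrow_between v p2 p4) = map role_of [u, v, \<not> u, \<not> v]"
    using crossing_pair_between[OF p] pair_type_crossing[OF p] by blast+
  show "?N \<longleftrightarrow> ?E" unfolding cross_def using * ** by blast
  show "?D \<longleftrightarrow> \<not> ?E" unfolding do_not_cross_def using * ** by blast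
qed

lemma edge_types:
  assumes u: "uniform_flag_complex \<Delta>" and p: "p1 < p2" "p2 < p3" "p3 < p4"
  shows "edge \<Delta> (p1, p4) (p2, p3) \<longleftrightarrow> nest \<Delta> [T, T, H, H]"
    and "edge \<Delta> (p4, p1) (p3, p2) \<longleftrightarrow> nest \<Delta> [H, H, T, T]"
    and "edge \<Delta> (p1, p4) (p3, p2) \<longleftrightarrow> nest \<Delta> [T, H, T, H]"
    and "edge \<Delta> (p4, p1) (p2, p3) \<longleftrightarrow> nest \<Delta> [H, T, H, T]"
    and "edge \<Delta> (p1, p3) (p4, p2) \<longleftrightarrow> cross \<Delta> [T, H, H, T]"
    and "edge \<Delta> (p3, p1) (p2, p4) \<longleftrightarrow> cross \<Delta> [H, T, T, H]"
    and "do_not_nest \<Delta> [T, H, T, H] \<longleftrightarrow> \<not> nest \<Delta> [T, H, T, H]"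
    and "do_not_nest \<Delta> [H, T, H, T] \<longleftrightarrow> \<not> nest \<Delta> [H, T, H, T]"
    and "do_not_cross \<Delta> [T, H, H, T] \<longleftrightarrow> \<not> cross \<Delta> [T, H, H, T]"
    and "do_not_cross \<Delta> [H, T, T, H] \<longleftrightarrow> \<not> cross \<Delta> [H, T, T, H]"
  using nest_iff_edge[OF u p, of True True] nest_iff_edge[OF u p, of False False]
    nest_iff_edge[OF u p, of True False] nest_iff_edge[OF u p, of False True]
    cross_iff_edge[OF u p, of True False] cross_iff_edge[OF u p, of False True]
  by (simp_all add: role_of_def arrow_between_def)

abbreviation complex_compat :: "'v::linorder arrow set set \<Rightarrow> 'v arrow \<Rightarrow> 'v arrow \<Rightarrow> bool" where
  "complex_compat \<Delta> \<equiv> compat (nest \<Delta> [T, T, H, H]) (nest \<Delta> [H, H, T, T]) (nest \<Delta> [T, H, T, H])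
     (nest \<Delta> [H, T, H, T]) (cross \<Delta> [T, H, H, T]) (cross \<Delta> [H, T, T, H])"

lemma permissible_exclusive:
  "permissible \<Delta> \<Longrightarrow> distinct [i, i', j, j'] \<Longrightarrow> edge \<Delta> (i, j) (i', j') \<noteq> edge \<Delta> (i, j') (i', j)"
proof -
  assume "permissible \<Delta>" and d: "distinct [i, i', j, j']"
  then have "\<forall>i1 i2 j1 j2. distinct [i1, i2, j1, j2] \<longrightarrow>
      (edge \<Delta> (i1, j1) (i2, j2) \<noteq> edge \<Delta> (i1, j2) (i2, j1))"
    unfolding permissible_def by (elim conjE)
  then show ?thesis using d by metis
qed

lemma permissible_shared_end:
  assumes "permissible \<Delta>" "distinct [i, j, k]"
  shows "edge \<Delta> (i, j) (i, k)" "edge \<Delta> (j, i) (k, i)"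
proof -
  have "\<forall>i j k. distinct [i, j, k] \<longrightarrow> edge \<Delta> (i, j) (i, k) \<and> edge \<Delta> (j, i) (k, i)"
    using assms(1) unfolding permissible_def by (elim conjE)
  then show "edge \<Delta> (i, j) (i, k)" "edge \<Delta> (j, i) (k, i)" using assms(2) by simp_all
qed

lemma permissible_admissible: "permissible \<Delta> \<Longrightarrow> \<sigma> \<in> \<Delta> \<Longrightarrow> admissible \<sigma>"
  unfolding permissible_def by (elim conjE) simp

lemma admissible_disjoint: "admissible \<sigma> \<Longrightarrow> (i, j) \<in> \<sigma> \<Longrightarrow> (i', j') \<in> \<sigma> \<Longrightarrow> i \<noteq> j'"
  unfolding admissible_def by blast

text \<open>The bits record one matching per type. The other one is decided by the exactly-one
  clause of permissibility on the side of edges and by \<open>compat_exclusive\<close> on the side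
  of compatibility.\<close>

lemma edge_iff_compat:
  fixes \<Delta> :: "'v::{finite,linorder} arrow set set"
  assumes perm: "permissible \<Delta>" and u: "uniform_flag_complex \<Delta>" and d: "distinct [i, i', j, j']"
  shows "edge \<Delta> (i, j) (i', j') \<longleftrightarrow> complex_compat \<Delta> (i, j) (i', j')"
proof -
  note ex = permissible_exclusive[OF perm]
  have 1: "edge \<Delta> (i, j) (i', j') \<longleftrightarrow> complex_compat \<Delta> (i, j) (i', j')"
    if d: "distinct [i, i', j, j']" and lt: "i < i'" "j < j'" for i i' j j'
  proof -
    note ct = compat_types[where ?n1.0="nest \<Delta> [T, T, H, H]" and ?n2.0="nest \<Delta> [H, H, T, T]"
      and ?n3.0="nest \<Delta> [T, H, T, H]" and ?n4.0="nest \<Delta> [H, T, H, T]"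
      and ?c5.0="cross \<Delta> [T, H, H, T]" and ?c6.0="cross \<Delta> [H, T, T, H]"]
    have "i < j \<or> j < i" "i < j' \<or> j' < i" "i' < j \<or> j < i'" "i' < j' \<or> j' < i'"
      using d by (auto simp: neq_iff)
    then consider "i < i'" "i' < j" "j < j'" | "i < j" "j < i'" "i' < j'" | "i < j" "j < j'" "j' < i'"
      | "j < i" "i < i'" "i' < j'" | "j < i" "i < j'" "j' < i'" | "j < j'" "j' < i" "i < i'"
      using lt by blast
    then show ?thesis
    proof cases
      case 1 then show ?thesis using ex[OF d] edge_types(1)[OF u 1] ct(2)[OF 1] by simp
    next
      case 2 then show ?thesis using ex[OF d] edge_types(3)[OF u 2] ct(6)[OF 2] by simp
    next
      case 3 then show ?thesis using ex[OF d] edge_types(5)[OF u 3] ct(10)[OF 3]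
        edge_commute[of \<Delta> "(i, j')"] by simp
    next
      case 4 then show ?thesis using ex[OF d] edge_types(6)[OF u 4] ct(12)[OF 4]
        edge_commute[of \<Delta> "(i, j')"] by simp
    next
      case 5 then show ?thesis using ex[OF d] edge_types(4)[OF u 5] ct(8)[OF 5]
        edge_commute[of \<Delta> "(i, j')"] by simp
    next
      case 6 then show ?thesis using ex[OF d] edge_types(2)[OF u 6] ct(4)[OF 6]
        edge_commute[of \<Delta> "(i, j')"] by simp
    qed
  qed
  have 2: "edge \<Delta> (i, j) (i', j') \<longleftrightarrow> complex_compat \<Delta> (i, j) (i', j')"
    if "distinct [i, i', j, j']" "i < i'" for i i' j j'
  proof (cases "j < j'")
    case True
    then show ?thesis using 1 that by blast
  next
    case False
    then have "j' < j" "distinct [i, i', j', j]" using that(1) by auto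
    then have "edge \<Delta> (i, j') (i', j) \<longleftrightarrow> complex_compat \<Delta> (i, j') (i', j)" using 1 that(2) by blast
    then show ?thesis using ex[OF that(1)] compat_exclusive[OF that(1)] by metis
  qed
  have "i < i' \<or> i' < i" using d by (auto simp: neq_iff)
  then show ?thesis
  proof
    assume "i < i'" then show ?thesis using 2 d by blast
  next
    assume "i' < i"
    moreover have "distinct [i', i, j', j]" using d by auto
    ultimately have "edge \<Delta> (i', j') (i, j) \<longleftrightarrow> complex_compat \<Delta> (i', j') (i, j)" using 2 by blast
    then show ?thesis using edge_commute compat_commute by metis
  qed
qed

text \<open>Flagness reduces faces to pairs. Pairs sharing a tail or a head are always edges, pairs
  with four ends follow the bits, and admissibility excludes contact of a head with a tail.\<close>

lemma face_iff_compat: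
  fixes \<Delta> :: "'v::{finite,linorder} arrow set set"
  assumes perm: "permissible \<Delta>" and u: "uniform_flag_complex \<Delta>"
  shows "\<sigma> \<in> \<Delta> \<longleftrightarrow> admissible \<sigma> \<and> (\<forall>\<alpha>\<in>\<sigma>. \<forall>\<beta>\<in>\<sigma>. complex_compat \<Delta> \<alpha> \<beta>)"
proof -
  have adm_d: "distinct [i, i', j, j']"
    if "admissible \<sigma>" "(i, j) \<in> \<sigma>" "(i', j') \<in> \<sigma>" "i \<noteq> i'" "j \<noteq> j'" for i j i' j'
    using admissible_disjoint[OF that(1)] that(2-5) by auto
  have adm_a: "i \<noteq> j" if "admissible \<sigma>" "(i, j) \<in> \<sigma>" for i j
    using admissible_disjoint[OF that(1)] that(2) by blast
  show ?thesis
  proof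
    assume s: "\<sigma> \<in> \<Delta>"
    have adm: "admissible \<sigma>" using permissible_admissible[OF perm s] .
    have "arrow_complex \<Delta>" using perm unfolding permissible_def by (elim conjE)
    then have sub: "\<tau> \<in> \<Delta>" if "\<tau> \<subseteq> \<sigma>" for \<tau> using s that unfolding arrow_complex_def by (elim conjE) simp
    have "complex_compat \<Delta> (i, j) (i', j')" if m: "(i, j) \<in> \<sigma>" "(i', j') \<in> \<sigma>" for i j i' j'
    proof (cases "i = i' \<or> j = j'")
      case True
      then show ?thesis by (auto simp: compat_def)
    next
      case False
      then have d: "distinct [i, i', j, j']" using adm_d[OF adm m] by blast
      have "{(i, j), (i', j')} \<in> \<Delta>"
        using sub m by simp
      then have "edge \<Delta> (i, j) (i', j')" using False by (auto simp: edge_def)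
      then show ?thesis using edge_iff_compat[OF perm u d] by blast
    qed
    then show "admissible \<sigma> \<and> (\<forall>\<alpha>\<in>\<sigma>. \<forall>\<beta>\<in>\<sigma>. complex_compat \<Delta> \<alpha> \<beta>)" using adm by auto
  next
    assume "admissible \<sigma> \<and> (\<forall>\<alpha>\<in>\<sigma>. \<forall>\<beta>\<in>\<sigma>. complex_compat \<Delta> \<alpha> \<beta>)"
    then have adm: "admissible \<sigma>" and K: "\<And>\<alpha> \<beta>. \<alpha> \<in> \<sigma> \<Longrightarrow> \<beta> \<in> \<sigma> \<Longrightarrow> complex_compat \<Delta> \<alpha> \<beta>" by auto
    have "edge \<Delta> (i, j) (i', j')" if m: "(i, j) \<in> \<sigma>" "(i', j') \<in> \<sigma>" and ne: "(i, j) \<noteq> (i', j')" for i j i' j'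
    proof -
      consider "i = i'" "j \<noteq> j'" | "i \<noteq> i'" "j = j'" | "i \<noteq> i'" "j \<noteq> j'" using ne by blast
      then show ?thesis
      proof cases
        case 1
        then have "distinct [i, j, j']" using adm_a[OF adm m(1)] adm_a[OF adm m(2)] by auto
        then show ?thesis using permissible_shared_end(1)[OF perm] 1 by simp
      next
        case 2
        then have "distinct [j, i, i']" using adm_a[OF adm m(1)] adm_a[OF adm m(2)] by auto
        then show ?thesis using permissible_shared_end(2)[OF perm] 2 by simp
      next
        case 3
        then show ?thesis using edge_iff_compat[OF perm u adm_d[OF adm m 3]] K[OF m] by blast
      qed
    qed
    moreover have "\<sigma> \<subseteq> arrows" using adm_a[OF adm] by (auto simp: arrows_def)
    ultimately have "\<sigma> \<in> clique_complex \<Delta>" unfolding clique_complex_def by auto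
    then show "\<sigma> \<in> \<Delta>" using u unfolding uniform_flag_complex_def flag_complex_def by blast
  qed
qed

section \<open>Obstructions on six nodes\<close>

text \<open>No arrow can carry flow into \<open>p2\<close>. Each candidate is incompatible with both
  arrows from some other tail to \<open>p4\<close> and \<open>p5\<close>; that tail would have to
  send its whole supply \<open>c\<close> to \<open>p2\<close> too, exceeding the demand
  \<open>c\<close> there. The three candidates block the three tails cyclically, in one direction
  for \<open>n3\<close> off and in the other for \<open>n3\<close> on.\<close>

lemma transportation_obstruction:
  fixes p1 p2 p3 p4 p5 p6 :: "'v::{finite,linorder}"
  assumes p: "p1 < p2" "p2 < p3" "p3 < p4" "p4 < p5" "p5 < p6" and c: "0 < c"
    and f: "clique_flow (compat n1 n2 n3 n4 c5 c6)
      (\<lambda>v. if v \<in> {p1, p3, p6} then c else 0) (\<lambda>v. if v \<in> {p2, p4, p5} then c else 0) f"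
  shows "\<not> (n3 = n4 \<and> c5 \<noteq> n3)"
proof
  assume n: "n3 = n4 \<and> c5 \<noteq> n3"
  let ?a = "\<lambda>v. if v \<in> {p1, p3, p6} then c else 0" and ?b = "\<lambda>v. if v \<in> {p2, p4, p5} then c else 0"
  have fl: "flow ?a ?b f" using f by (simp add: clique_flow_def)
  have n0: "\<And>i j. 0 \<le> f i j" using flow_nonneg[OF fl] .
  have K: "f i j = 0 \<or> f i' j' = 0" if "\<not> compat n1 n2 n3 n4 c5 c6 (i, j) (i', j')" for i j i' j'
    using f that n0[of i j] n0[of i' j'] unfolding clique_flow_def by (metis order_le_less)
  have lt: "p1 < p3" "p1 < p4" "p1 < p5" "p1 < p6" "p2 < p4" "p2 < p5" "p2 < p6" "p3 < p5" "p3 < p6" "p4 < p6"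
    using p by order+
  have ne: "p2 \<noteq> p4" "p2 \<noteq> p5" "p4 \<noteq> p5" "p1 \<noteq> p3" "p1 \<noteq> p6" "p3 \<noteq> p6" using p lt by auto
  have row: "f i p2 + f i p4 + f i p5 = c" if "i \<in> {p1, p3, p6}" for i
  proof -
    have "c = (\<Sum>j\<in>UNIV. f i j)" using fl that by (simp add: flow_def)
    also have "\<dots> = (\<Sum>j\<in>{p2, p4, p5}. f i j)"
    proof (rule sum.mono_neutral_right)
      show "\<forall>j\<in>UNIV - {p2, p4, p5}. f i j = 0"
        using flow_le_column[OF fl, of i] n0[of i] by (auto intro: antisym split: if_splits) (metis antisym)+
    qed auto
    also have "\<dots> = f i p2 + f i p4 + f i p5" using ne by (simp add: add.assoc)
    finally show ?thesis by simp
  qed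
  have column: "f p1 j + f p3 j + f p6 j = c" if "j \<in> {p2, p4, p5}" for j
  proof -
    have "c = (\<Sum>i\<in>UNIV. f i j)" using fl that by (simp add: flow_def)
    also have "\<dots> = (\<Sum>i\<in>{p1, p3, p6}. f i j)"
    proof (rule sum.mono_neutral_right)
      show "\<forall>i\<in>UNIV - {p1, p3, p6}. f i j = 0"
        using flow_le_row[OF fl, of _ j] n0[of _ j] by (auto intro: antisym split: if_splits) (metis antisym)+
    qed auto
    also have "\<dots> = f p1 j + f p3 j + f p6 j" using ne by (simp add: add.assoc)
    finally show ?thesis by simp
  qed
  note rc = row[of p1] row[of p3] row[of p6] column[of p2] column[of p4] column[of p5]
  show False
  proof (cases n3)
    case False
    have z: "f p1 p4 = 0 \<or> f p3 p2 = 0" "f p1 p5 = 0 \<or> f p3 p2 = 0"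
      "f p1 p2 = 0 \<or> f p6 p4 = 0" "f p1 p2 = 0 \<or> f p6 p5 = 0"
      "f p3 p4 = 0 \<or> f p6 p2 = 0" "f p3 p5 = 0 \<or> f p6 p2 = 0"
      using False n p lt by (intro K; simp add: compat_types(5,7,10))+
    show False using rc z n0 c by (simp, smt (verit))
  next
    case True
    have z: "f p1 p2 = 0 \<or> f p3 p4 = 0" "f p1 p2 = 0 \<or> f p3 p5 = 0"
      "f p1 p4 = 0 \<or> f p6 p2 = 0" "f p1 p5 = 0 \<or> f p6 p2 = 0"
      "f p3 p2 = 0 \<or> f p6 p4 = 0" "f p3 p2 = 0 \<or> f p6 p5 = 0"
      using True n p lt by (intro K; simp add: compat_types(6,8,9))+
    show False using rc z n0 c by (simp, smt (verit))
  qed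
qed

definition hexagon :: "'v \<Rightarrow> 'v \<Rightarrow> 'v \<Rightarrow> 'v \<Rightarrow> 'v \<Rightarrow> 'v \<Rightarrow> 'v arrow set" where
  "hexagon t0 h0 t1 h1 t2 h2 = {(t0, h0), (t1, h0), (t1, h1), (t2, h1), (t2, h2), (t0, h2)}"

lemma hexagon_not_forest:
  assumes "distinct [t0, h0, t1, h1, t2, h2]"
  shows "\<not> forest (underlying_edges (hexagon t0 h0 t1 h1 t2 h2))"
proof -
  let ?E = "underlying_edges (hexagon t0 h0 t1 h1 t2 h2)" and ?vs = "[t0, h0, t1, h1, t2, h2]"
  have e: "{t0, h0} \<in> ?E" "{h0, t1} \<in> ?E" "{t1, h1} \<in> ?E" "{h1, t2} \<in> ?E" "{t2, h2} \<in> ?E" "{h2, t0} \<in> ?E"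
    unfolding underlying_edges_def hexagon_def by (auto simp: insert_commute)
  have "graph_cycle ?E ?vs"
    unfolding graph_cycle_def
  proof (intro conjI allI impI)
    fix k assume "k < length ?vs"
    then have "k \<in> {0, 1, 2, 3, 4, 5}" by auto
    then show "{?vs ! k, ?vs ! (Suc k mod length ?vs)} \<in> ?E" using e by (elim insertE emptyE) simp_all
  qed (use assms in simp_all)
  then show ?thesis unfolding forest_def by blast
qed

text \<open>On the word \<open>THTHTH\<close> the three arrows \<open>(p1, p4)\<close>,
  \<open>(p5, p2)\<close>, \<open>(p3, p6)\<close> between opposite nodes cross pairwise: the two
  forward ones because \<open>TTHH\<close> does not nest, the others by the two mixed bits. Either
  of two matchings completes them to a six-cycle, and which one is compatible depends on whether
  \<open>n3\<close> or \<open>n4\<close> holds.\<close>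

lemma hexagon_clique:
  fixes p1 p2 p3 p4 p5 p6 :: "'v::linorder"
  assumes p: "p1 < p2" "p2 < p3" "p3 < p4" "p4 < p5" "p5 < p6" and n: "n3 \<noteq> n4"
  defines "\<sigma> \<equiv> (if n4 then hexagon p1 p2 p5 p6 p3 p4 else hexagon p1 p4 p5 p2 p3 p6)"
  shows "\<forall>\<alpha>\<in>\<sigma>. \<forall>\<beta>\<in>\<sigma>. compat False n2 n3 n4 True True \<alpha> \<beta>"
    and "\<sigma> \<subseteq> {p1, p3, p5} \<times> {p2, p4, p6}"
    and "\<not> forest (underlying_edges \<sigma>)"
proof -
  have lt: "p1 < p3" "p1 < p4" "p1 < p5" "p1 < p6" "p2 < p4" "p2 < p5" "p2 < p6" "p3 < p5" "p3 < p6" "p4 < p6"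
    using p by order+
  note facts = p lt p[THEN less_not_sym] lt[THEN less_not_sym] p[THEN less_imp_neq] lt[THEN less_imp_neq]
    p[THEN less_imp_not_eq2] lt[THEN less_imp_not_eq2]
  show "\<forall>\<alpha>\<in>\<sigma>. \<forall>\<beta>\<in>\<sigma>. compat False n2 n3 n4 True True \<alpha> \<beta>"
    using n by (cases n4) (simp_all add: \<sigma>_def hexagon_def compat_def compat0_def facts)
  show "\<sigma> \<subseteq> {p1, p3, p5} \<times> {p2, p4, p6}" by (auto simp: \<sigma>_def hexagon_def)
  show "\<not> forest (underlying_edges \<sigma>)"
    unfolding \<sigma>_def by (simp add: hexagon_not_forest facts)
qed

lemma six_nodes:
  assumes "6 \<le> CARD('v)"
  obtains p1 p2 p3 p4 p5 p6 :: "'v::{finite,linorder}" where "p1 < p2" "p2 < p3" "p3 < p4" "p4 < p5" "p5 < p6"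
proof -
  let ?xs = "sorted_list_of_set (UNIV :: 'v set)"
  have "?xs ! i < ?xs ! Suc i" if "Suc i < 6" for i
    using that assms strict_sorted_list_of_set[of "UNIV :: 'v set"]
    by (intro sorted_wrt_nth_less[where P = "(<)"]) auto
  from this[of 0] this[of 1] this[of 2] this[of 3] this[of 4] show thesis
    by (intro that[of "?xs ! 0" "?xs ! 1" "?xs ! 2" "?xs ! 3" "?xs ! 4" "?xs ! 5"]) (simp_all add: numeral_eq_Suc)
qed

lemma underlying_edges_swap: "underlying_edges (prod.swap ` \<sigma>) = underlying_edges \<sigma>"
  unfolding underlying_edges_def by (auto simp: insert_commute)

lemma admissibleI: "I \<inter> J = {} \<Longrightarrow> \<sigma> \<subseteq> I \<times> J \<Longrightarrow> admissible \<sigma>"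
  unfolding admissible_def by blast

text \<open>Otherwise flagness would make the hexagon a face, against the forest condition. For
  \<open>HHTT\<close> the same hexagon is used with all arrows reversed, which leaves its underlying
  graph unchanged.\<close>

lemma permissible_nests:
  fixes \<Delta> :: "'v::{finite,linorder} arrow set set"
  assumes perm: "permissible \<Delta>" and u: "uniform_flag_complex \<Delta>" and card: "6 \<le> CARD('v)"
    and n: "nest \<Delta> [T, H, T, H] \<noteq> nest \<Delta> [H, T, H, T]" and c: "cross \<Delta> [T, H, H, T]" "cross \<Delta> [H, T, T, H]"
  shows "nest \<Delta> [T, T, H, H] \<and> nest \<Delta> [H, H, T, T]"
proof -
  obtain p1 p2 p3 p4 p5 p6 :: 'v where p: "p1 < p2" "p2 < p3" "p3 < p4" "p4 < p5" "p5 < p6"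
    using six_nodes[OF card] by metis
  have dj: "{p1, p3, p5} \<inter> {p2, p4, p6} = {}" using p by auto
  have forest: "forest (underlying_edges \<sigma>)" if "\<sigma> \<in> \<Delta>" for \<sigma>
    using perm that unfolding permissible_def by (elim conjE) simp
  have "nest \<Delta> [T, T, H, H]"
  proof (rule ccontr)
    assume neg: "\<not> nest \<Delta> [T, T, H, H]"
    define \<sigma> where "\<sigma> = (if nest \<Delta> [H, T, H, T] then hexagon p1 p2 p5 p6 p3 p4 else hexagon p1 p4 p5 p2 p3 p6)"
    note hex = hexagon_clique[OF p n, folded \<sigma>_def]
    have K: "\<forall>\<alpha>\<in>\<sigma>. \<forall>\<beta>\<in>\<sigma>. complex_compat \<Delta> \<alpha> \<beta>"
      using hex(1)[of "nest \<Delta> [H, H, T, T]"] neg c by simp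
    note s = hex(2) and nf = hex(3)
    have "admissible \<sigma>" using dj s by (rule admissibleI)
    then show False using forest nf face_iff_compat[OF perm u] K by blast
  qed
  moreover have "nest \<Delta> [H, H, T, T]"
  proof (rule ccontr)
    assume neg: "\<not> nest \<Delta> [H, H, T, T]"
    define \<sigma> where "\<sigma> = (if nest \<Delta> [T, H, T, H] then hexagon p1 p2 p5 p6 p3 p4 else hexagon p1 p4 p5 p2 p3 p6)"
    note hex = hexagon_clique[OF p n[symmetric], folded \<sigma>_def]
    have K: "\<forall>\<alpha>\<in>\<sigma>. \<forall>\<beta>\<in>\<sigma>. compat (nest \<Delta> [H, H, T, T]) (nest \<Delta> [T, T, H, H])
        (nest \<Delta> [H, T, H, T]) (nest \<Delta> [T, H, T, H]) (cross \<Delta> [H, T, T, H]) (cross \<Delta> [T, H, H, T]) \<alpha> \<beta>"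
      using hex(1)[of "nest \<Delta> [T, T, H, H]"] neg c by simp
    note s = hex(2) and nf = hex(3)
    have "prod.swap ` \<sigma> \<subseteq> {p2, p4, p6} \<times> {p1, p3, p5}"
      using image_mono[OF s, of prod.swap] by (simp only: product_swap)
    then have "admissible (prod.swap ` \<sigma>)" using dj Int_commute by (metis admissibleI)
    moreover have "\<forall>\<alpha>\<in>prod.swap ` \<sigma>. \<forall>\<beta>\<in>prod.swap ` \<sigma>. complex_compat \<Delta> \<alpha> \<beta>"
    proof (intro ballI, elim imageE)
      fix \<alpha> \<beta> a b assume "\<alpha> = prod.swap a" "\<beta> = prod.swap b" "a \<in> \<sigma>" "b \<in> \<sigma>"
      then show "complex_compat \<Delta> \<alpha> \<beta>"
        using K by (cases a; cases b) (simp add: compat_swap[of "nest \<Delta> [T, T, H, H]"])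
    qed
    ultimately have "prod.swap ` \<sigma> \<in> \<Delta>" using face_iff_compat[OF perm u] by blast
    then show False using forest nf underlying_edges_swap by metis
  qed
  ultimately show ?thesis by blast
qed

section \<open>From flows to the root polytope\<close>

definition flow_point :: "('v::finite \<Rightarrow> 'v \<Rightarrow> real) \<Rightarrow> real ^ 'v" where
  "flow_point f = (\<Sum>\<alpha>\<in>UNIV. f (tail \<alpha>) (head \<alpha>) *\<^sub>R arrow_vertex \<alpha>)"

definition pos_part :: "real ^ 'v \<Rightarrow> 'v \<Rightarrow> real" where
  "pos_part x v = max 0 (x $ v)"

definition neg_part :: "real ^ 'v \<Rightarrow> 'v \<Rightarrow> real" where
  "neg_part x v = max 0 (- (x $ v))"

definition l1_sphere :: "(real ^ 'v::finite) set" where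
  "l1_sphere = {x. (\<Sum>v\<in>UNIV. x $ v) = 0 \<and> (\<Sum>v\<in>UNIV. \<bar>x $ v\<bar>) = 2}"

definition l1_ball :: "(real ^ 'v::finite) set" where
  "l1_ball = {x. (\<Sum>v\<in>UNIV. x $ v) = 0 \<and> (\<Sum>v\<in>UNIV. \<bar>x $ v\<bar>) \<le> 2}"

lemma sum_arrows: "(\<Sum>\<alpha>\<in>UNIV. g (tail \<alpha>) (head \<alpha>)) = (\<Sum>i\<in>UNIV. \<Sum>j\<in>UNIV. g i j)"
  for g :: "'v::finite \<Rightarrow> 'v \<Rightarrow> 'b::comm_monoid_add"
  unfolding UNIV_Times_UNIV[symmetric] by (simp add: sum.cartesian_product case_prod_beta)

lemma flow_point_nth: "flow_point f $ v = (\<Sum>i\<in>UNIV. f i v) - (\<Sum>j\<in>UNIV. f v j)"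
proof -
  have "flow_point f $ v = (\<Sum>\<alpha>\<in>UNIV. (if v = head \<alpha> then f (tail \<alpha>) (head \<alpha>) else 0) -
      (if v = tail \<alpha> then f (tail \<alpha>) (head \<alpha>) else 0))"
    unfolding flow_point_def arrow_vertex_def by (auto simp: axis_def intro!: sum.cong)
  also have "\<dots> = (\<Sum>i\<in>UNIV. \<Sum>j\<in>UNIV. (if v = j then f i j else 0) - (if v = i then f i j else 0))"
    using sum_arrows[of "\<lambda>i j. (if v = j then f i j else 0) - (if v = i then f i j else 0)"] by simp
  also have "\<dots> = (\<Sum>i\<in>UNIV. \<Sum>j\<in>UNIV. if v = j then f i j else 0) - (\<Sum>i\<in>UNIV. \<Sum>j\<in>UNIV. if v = i then f i j else 0)"
    by (simp add: sum_subtractf)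
  also have "(\<Sum>i\<in>UNIV. \<Sum>j\<in>UNIV. if v = j then f i j else 0) = (\<Sum>i\<in>UNIV. f i v)"
    by simp
  also have "(\<Sum>i\<in>UNIV. \<Sum>j\<in>UNIV. if v = i then f i j else 0) = (\<Sum>j\<in>UNIV. f v j)"
    by (subst sum.swap) simp
  finally show ?thesis .
qed

lemma flow_point_sum: "(\<Sum>v\<in>UNIV. flow_point f $ v) = 0"
  unfolding flow_point_nth sum_subtractf by (subst sum.swap) simp

lemma flow_point_flow:
  assumes "flow (neg_part x) (pos_part x) f"
  shows "flow_point f = x"
  using assms by (auto simp: vec_eq_iff flow_point_nth flow_def pos_part_def neg_part_def)

lemma balanced_parts:
  fixes x :: "real ^ 'v::finite"
  assumes "(\<Sum>v\<in>UNIV. x $ v) = 0"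
  shows "balanced (neg_part x) (pos_part x)"
proof -
  have "(\<Sum>v\<in>UNIV. pos_part x v - neg_part x v) = (\<Sum>v\<in>UNIV. x $ v)"
    by (intro sum.cong) (auto simp: pos_part_def neg_part_def)
  then have "sum (pos_part x) UNIV = sum (neg_part x) UNIV" using assms by (simp add: sum_subtractf)
  then show ?thesis by (auto simp: balanced_def pos_part_def neg_part_def)
qed

lemma l1_norm_parts:
  fixes x :: "real ^ 'v::finite"
  assumes "(\<Sum>v\<in>UNIV. x $ v) = 0"
  shows "(\<Sum>v\<in>UNIV. \<bar>x $ v\<bar>) = 2 * sum (neg_part x) UNIV"
proof -
  have "(\<Sum>v\<in>UNIV. \<bar>x $ v\<bar>) = (\<Sum>v\<in>UNIV. pos_part x v + neg_part x v)"
    by (intro sum.cong) (auto simp: pos_part_def neg_part_def)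
  then show ?thesis using balanced_parts[OF assms] by (simp add: balanced_def sum.distrib)
qed

lemma flow_total:
  assumes "flow a b f"
  shows "(\<Sum>\<alpha>\<in>UNIV. f (tail \<alpha>) (head \<alpha>)) = sum a UNIV"
  using assms by (simp add: sum_arrows flow_def)

text \<open>Admissibility prevents cancellation: no node has both inflow and outflow, so the
  marginals can be recovered from the signs of the coordinates of the point.\<close>

lemma admissible_flow:
  assumes adm: "admissible \<sigma>" and n: "\<And>i j. 0 \<le> f i j" and supp: "\<And>i j. (i, j) \<notin> \<sigma> \<Longrightarrow> f i j = 0"
  shows "flow (neg_part (flow_point f)) (pos_part (flow_point f)) f"
proof -
  have z: "(\<Sum>i\<in>UNIV. f i v) = 0 \<or> (\<Sum>j\<in>UNIV. f v j) = 0" for v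
  proof (rule ccontr)
    assume "\<not> ?thesis"
    then obtain i j where "f i v \<noteq> 0" "f v j \<noteq> 0" by (metis sum.neutral)
    then have "(i, v) \<in> \<sigma>" "(v, j) \<in> \<sigma>" using supp by blast+
    then show False using adm unfolding admissible_def by blast
  qed
  have s: "0 \<le> (\<Sum>i\<in>UNIV. f i v)" "0 \<le> (\<Sum>j\<in>UNIV. f v j)" for v using n by (simp_all add: sum_nonneg)
  have "(\<Sum>j\<in>UNIV. f v j) = neg_part (flow_point f) v" "(\<Sum>i\<in>UNIV. f i v) = pos_part (flow_point f) v" for v
    using z[of v] s[of v] by (auto simp: neg_part_def pos_part_def flow_point_nth)
  then show ?thesis using n by (simp add: flow_def)
qed

lemma axis_diff_eq:
  assumes "i \<noteq> j" "axis j (1::real) - axis i 1 = axis j' 1 - axis i' 1"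
  shows "i = i'" "j = j'"
proof -
  have *: "(if v = j then 1 else 0) - (if v = i then 1 else (0::real)) = (if v = j' then 1 else 0) - (if v = i' then 1 else 0)" for v
    using arg_cong[OF assms(2), of "\<lambda>x. x $ v"] by (simp add: axis_def)
  show "i = i'" using *[of i] assms(1) by (auto split: if_splits)
  show "j = j'" using *[of j] assms(1) by (auto split: if_splits)
qed

lemma inj_arrow_vertex: "inj_on arrow_vertex arrows"
  unfolding inj_on_def arrows_def arrow_vertex_def using axis_diff_eq by fastforce

lemma admissible_arrows: "admissible \<sigma> \<Longrightarrow> \<sigma> \<subseteq> arrows"
  unfolding admissible_def arrows_def by auto

lemma hull_iff_flow_point:
  fixes \<sigma> :: "'v::finite arrow set"
  assumes "\<sigma> \<subseteq> arrows"
  shows "x \<in> convex hull (arrow_vertex ` \<sigma>) \<longleftrightarrow>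
    (\<exists>f. (\<forall>i j. 0 \<le> f i j) \<and> (\<forall>i j. (i, j) \<notin> \<sigma> \<longrightarrow> f i j = 0) \<and>
      (\<Sum>\<alpha>\<in>UNIV. f (tail \<alpha>) (head \<alpha>)) = 1 \<and> flow_point f = x)" (is "?L \<longleftrightarrow> (\<exists>f. ?P f)")
proof
  have inj: "inj_on arrow_vertex \<sigma>" using inj_arrow_vertex assms by (rule inj_on_subset)
  have restr: "(\<Sum>\<alpha>\<in>UNIV. f (tail \<alpha>) (head \<alpha>)) = (\<Sum>\<alpha>\<in>\<sigma>. f (tail \<alpha>) (head \<alpha>))"
    "flow_point f = (\<Sum>\<alpha>\<in>\<sigma>. f (tail \<alpha>) (head \<alpha>) *\<^sub>R arrow_vertex \<alpha>)"
    if "\<forall>i j. (i, j) \<notin> \<sigma> \<longrightarrow> f i j = 0" for f :: "'v \<Rightarrow> 'v \<Rightarrow> real"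
    unfolding flow_point_def using that by (auto intro!: sum.mono_neutral_right)
  {
    assume ?L
    then obtain u where u: "\<forall>y\<in>arrow_vertex ` \<sigma>. 0 \<le> u y" "sum u (arrow_vertex ` \<sigma>) = 1"
      "(\<Sum>y\<in>arrow_vertex ` \<sigma>. u y *\<^sub>R y) = x"
      by (auto simp: convex_hull_finite)
    define f where "f i j = (if (i, j) \<in> \<sigma> then u (arrow_vertex (i, j)) else 0)" for i j
    have z: "\<forall>i j. (i, j) \<notin> \<sigma> \<longrightarrow> f i j = 0" by (simp add: f_def)
    have "(\<Sum>\<alpha>\<in>\<sigma>. f (tail \<alpha>) (head \<alpha>)) = 1" "(\<Sum>\<alpha>\<in>\<sigma>. f (tail \<alpha>) (head \<alpha>) *\<^sub>R arrow_vertex \<alpha>) = x"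
      using u(2,3) by (simp_all add: f_def sum.reindex[OF inj])
    then have "?P f" using u(1) z by (simp add: restr[OF z]) (auto simp: f_def)
    then show "\<exists>f. ?P f" by blast
  }
  {
    assume "\<exists>f. ?P f"
    then obtain f where f: "?P f" by blast
    then have z: "\<forall>i j. (i, j) \<notin> \<sigma> \<longrightarrow> f i j = 0" by blast
    define u where "u y = (let \<alpha> = the_inv_into \<sigma> arrow_vertex y in f (tail \<alpha>) (head \<alpha>))" for y
    have u: "u (arrow_vertex \<alpha>) = f (tail \<alpha>) (head \<alpha>)" if "\<alpha> \<in> \<sigma>" for \<alpha>
      using that by (simp add: u_def the_inv_into_f_f[OF inj])
    have "(\<Sum>y\<in>arrow_vertex ` \<sigma>. u y) = 1" "(\<Sum>y\<in>arrow_vertex ` \<sigma>. u y *\<^sub>R y) = x"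
      using f by (simp_all add: restr[OF z] sum.reindex[OF inj] u)
    moreover have "\<forall>y\<in>arrow_vertex ` \<sigma>. 0 \<le> u y" using f u by auto
    ultimately show ?L by (auto simp: convex_hull_finite)
  }
qed

lemma l1_sphere_flow_in_hull:
  assumes x: "x \<in> l1_sphere" and f: "flow (neg_part x) (pos_part x) f"
    and "\<sigma> \<subseteq> arrows" and "\<And>i j. 0 < f i j \<Longrightarrow> (i, j) \<in> \<sigma>"
  shows "x \<in> convex hull (arrow_vertex ` \<sigma>)"
proof -
  have "f i j = 0" if "(i, j) \<notin> \<sigma>" for i j using assms(4)[of i j] that flow_nonneg[OF f, of i j] by fastforce
  moreover have "(\<Sum>\<alpha>\<in>UNIV. f (tail \<alpha>) (head \<alpha>)) = 1"
    using flow_total[OF f] l1_norm_parts[of x] x by (simp add: l1_sphere_def)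
  ultimately show ?thesis
    unfolding hull_iff_flow_point[OF assms(3)] using flow_nonneg[OF f] flow_point_flow[OF f] by blast
qed

section \<open>The root polytope as an l1 ball and its relative frontier\<close>

lemma root_polytope_hull: "(root_polytope :: (real, 'v::finite) vec set) = convex hull (arrow_vertex ` arrows)"
proof -
  have "{axis j 1 - axis i 1 | i j. i \<noteq> j} = (arrow_vertex ` arrows :: (real, 'v) vec set)"
  proof (intro set_eqI iffI)
    fix x :: "(real, 'v) vec" assume "x \<in> {axis j 1 - axis i 1 | i j. i \<noteq> j}"
    then obtain i j where "x = arrow_vertex (i, j)" "(i, j) \<in> arrows"
      by (auto simp: arrow_vertex_def arrows_def)
    then show "x \<in> arrow_vertex ` arrows" by blast
  next
    fix x :: "(real, 'v) vec" assume "x \<in> arrow_vertex ` arrows"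
    then obtain i j where "x = axis j 1 - axis i 1" "i \<noteq> j"
      by (auto simp: arrow_vertex_def arrows_def)
    then show "x \<in> {axis j 1 - axis i 1 | i j. i \<noteq> j}" by blast
  qed
  then show ?thesis by (simp add: root_polytope_def)
qed

text \<open>The radius 2 is the l1 norm of an arrow. A point of the sphere is a convex combination
  of arrows through any flow between its two parts, and the separated relation supplies one; the
  remaining points follow by scaling towards 0, the midpoint of two opposite arrows.\<close>

lemma root_polytope_eq_l1_ball:
  assumes card: "2 \<le> CARD('v)"
  shows "(root_polytope :: (real, 'v::{finite,linorder}) vec set) = l1_ball"
proof
  have "convex (l1_ball :: (real, 'v) vec set)"
    unfolding convex_def l1_ball_def
  proof (clarsimp simp: sum.distrib sum_distrib_left[symmetric])
    fix x y :: "(real, 'v) vec" and u v :: real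
    assume *: "(\<Sum>v\<in>UNIV. \<bar>x $ v\<bar>) \<le> 2" "(\<Sum>v\<in>UNIV. \<bar>y $ v\<bar>) \<le> 2" "0 \<le> u" "0 \<le> v" "u + v = 1"
    have "(\<Sum>i\<in>UNIV. \<bar>u * x $ i + v * y $ i\<bar>) \<le> (\<Sum>i\<in>UNIV. u * \<bar>x $ i\<bar> + v * \<bar>y $ i\<bar>)"
      using * by (intro sum_mono) (metis abs_mult abs_of_nonneg abs_triangle_ineq)
    also have "\<dots> = u * (\<Sum>i\<in>UNIV. \<bar>x $ i\<bar>) + v * (\<Sum>i\<in>UNIV. \<bar>y $ i\<bar>)"
      by (simp add: sum.distrib sum_distrib_left)
    also have "\<dots> \<le> u * 2 + v * 2" using * by (intro add_mono mult_left_mono)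
    finally show "(\<Sum>i\<in>UNIV. \<bar>u * x $ i + v * y $ i\<bar>) \<le> 2" using * by simp
  qed
  moreover have "arrow_vertex \<alpha> \<in> (l1_ball :: (real, 'v) vec set)" if "\<alpha> \<in> arrows" for \<alpha> :: "'v arrow"
  proof -
    have ne: "tail \<alpha> \<noteq> head \<alpha>" using that by (auto simp: arrows_def)
    have "(\<Sum>v\<in>UNIV. arrow_vertex \<alpha> $ v) = 0"
      by (simp add: arrow_vertex_def axis_def sum_subtractf)
    moreover have "(\<Sum>v\<in>UNIV. \<bar>arrow_vertex \<alpha> $ v\<bar>) = (\<Sum>v\<in>UNIV. (if v = head \<alpha> then 1 else 0) + (if v = tail \<alpha> then 1 else 0))"
      using ne by (intro sum.cong) (auto simp: arrow_vertex_def axis_def)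
    ultimately show ?thesis by (simp add: l1_ball_def sum.distrib)
  qed
  ultimately show "root_polytope \<subseteq> (l1_ball :: (real, 'v) vec set)"
    unfolding root_polytope_hull by (intro hull_minimal) auto
next
  have sphere: "x \<in> root_polytope" if x: "x \<in> l1_sphere" for x :: "(real, 'v) vec"
  proof -
    have bal: "balanced (neg_part x) (pos_part x)" using x balanced_parts[of x] by (simp add: l1_sphere_def)
    then obtain f where f: "flow (neg_part x) (pos_part x) f"
      using solvable_separated unfolding solvable_def clique_flow_def by metis
    then have "(i, j) \<in> arrows" if "0 < f i j" for i j
      using balanced_flow(5)[OF bal f that] by (simp add: arrows_def)
    then show ?thesis using l1_sphere_flow_in_hull[OF x f] unfolding root_polytope_hull by blast
  qed
  obtain p q :: 'v where pq: "p \<noteq> q"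
    using card card_le_Suc0_iff_eq[of "UNIV :: 'v set"] by fastforce
  have "arrow_vertex (p, q) \<in> root_polytope" "arrow_vertex (q, p) \<in> root_polytope"
    unfolding root_polytope_hull using pq by (auto intro!: hull_inc simp: arrows_def)
  moreover have conv: "convex (root_polytope :: (real, 'v) vec set)" by (simp add: root_polytope_def)
  ultimately have "(1/2) *\<^sub>R arrow_vertex (p, q) + (1/2) *\<^sub>R arrow_vertex (q, p) \<in> root_polytope"
    by (intro convexD) auto
  then have zero: "0 \<in> (root_polytope :: (real, 'v) vec set)"
    by (simp add: arrow_vertex_def scaleR_diff_right)
  show "l1_ball \<subseteq> (root_polytope :: (real, 'v) vec set)"
  proof
    fix x :: "(real, 'v) vec" assume x: "x \<in> l1_ball"
    define N where "N = (\<Sum>v\<in>UNIV. \<bar>x $ v\<bar>)"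
    have N: "0 \<le> N" "N \<le> 2" using x by (auto simp: N_def l1_ball_def sum_nonneg)
    show "x \<in> root_polytope"
    proof (cases "N = 0")
      case True
      then have "x = 0" by (simp add: N_def sum_nonneg_eq_0_iff vec_eq_iff)
      then show ?thesis using zero by simp
    next
      case False
      define y where "y = (2 / N) *\<^sub>R x"
      have "(\<Sum>v\<in>UNIV. y $ v) = 2 / N * (\<Sum>v\<in>UNIV. x $ v)"
        unfolding sum_distrib_left by (simp add: y_def)
      moreover have "(\<Sum>v\<in>UNIV. \<bar>y $ v\<bar>) = 2 / N * N"
        unfolding N_def sum_distrib_left using N(1) by (simp add: y_def abs_mult N_def)
      ultimately have "(\<Sum>v\<in>UNIV. y $ v) = 0" "(\<Sum>v\<in>UNIV. \<bar>y $ v\<bar>) = 2"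
        using x False by (simp_all add: l1_ball_def)
      then have "y \<in> root_polytope" by (intro sphere) (simp add: l1_sphere_def)
      then have "(N / 2) *\<^sub>R y + (1 - N / 2) *\<^sub>R 0 \<in> root_polytope"
        using zero N by (intro convexD[OF conv]) auto
      then show ?thesis using False by (simp add: y_def)
    qed
  qed
qed

text \<open>A point of the relative interior can be pushed slightly away from 0 within the polytope,
  so its norm is below 2. Conversely, norm below 2 is an open condition, and the affine hull lies in
  the hyperplane of coordinate sum 0.\<close>

lemma rel_frontier_root_polytope:
  assumes card: "2 \<le> CARD('v)"
  shows "rel_frontier (root_polytope :: (real, 'v::{finite,linorder}) vec set) = l1_sphere"
proof -
  let ?P = "root_polytope :: (real, 'v) vec set" and ?N = "\<lambda>x :: (real, 'v) vec. \<Sum>v\<in>UNIV. \<bar>x $ v\<bar>"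
  note ball = root_polytope_eq_l1_ball[OF card]
  have closed: "closed ?P"
    unfolding root_polytope_hull by (intro compact_imp_closed finite_imp_compact_convex_hull) auto
  have interior: "x \<in> rel_interior ?P \<longleftrightarrow> x \<in> ?P \<and> ?N x < 2" for x
  proof
    assume r: "x \<in> rel_interior ?P"
    have "0 \<in> ?P" unfolding ball by (simp add: l1_ball_def)
    moreover have "convex ?P" by (simp add: root_polytope_def)
    ultimately obtain e where e: "1 < e" "(1 - e) *\<^sub>R 0 + e *\<^sub>R x \<in> ?P"
      using r convex_rel_interior_iff[of ?P x] by (metis empty_iff)
    then have "e * ?N x \<le> 2" unfolding ball by (simp add: l1_ball_def abs_mult flip: sum_distrib_left)
    moreover have "e * 2 \<le> e * ?N x" if "2 \<le> ?N x" using that e(1) by (intro mult_left_mono) auto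
    ultimately have "?N x < 2" using e(1) by linarith
    then show "x \<in> ?P \<and> ?N x < 2" using r rel_interior_subset by blast
  next
    assume x: "x \<in> ?P \<and> ?N x < 2"
    have "subspace {y :: (real, 'v) vec. (\<Sum>v\<in>UNIV. y $ v) = 0}"
      by (auto simp: subspace_def sum.distrib simp flip: sum_distrib_left)
    then have "affine hull ?P \<subseteq> {y. (\<Sum>v\<in>UNIV. y $ v) = 0}"
      by (intro hull_minimal subspace_imp_affine) (auto simp: ball l1_ball_def)
    moreover have "open {y. ?N y < 2}" by (intro open_Collect_less continuous_intros)
    ultimately show "x \<in> rel_interior ?P"
      unfolding mem_rel_interior using x by (intro exI[of _ "{y. ?N y < 2}"]) (auto simp: ball l1_ball_def)
  qed
  show ?thesis
  proof (rule set_eqI)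
    fix x
    have "x \<in> rel_frontier ?P \<longleftrightarrow> x \<in> ?P \<and> \<not> ?N x < 2"
      unfolding rel_frontier_def closure_closed[OF closed] Diff_iff interior by blast
    also have "\<dots> \<longleftrightarrow> x \<in> l1_sphere"
      unfolding ball l1_ball_def l1_sphere_def mem_Collect_eq by linarith
    finally show "x \<in> rel_frontier ?P \<longleftrightarrow> x \<in> l1_sphere" .
  qed
qed

text \<open>Keeps only the pairwise description of faces, so that the geometry below is independent
  of types and bits.\<close>

locale compatible_faces =
  fixes \<Delta> :: "'v::{finite,linorder} arrow set set" and K :: "'v arrow \<Rightarrow> 'v arrow \<Rightarrow> bool"
  assumes face_iff: "\<And>\<sigma>. \<sigma> \<in> \<Delta> \<longleftrightarrow> admissible \<sigma> \<and> (\<forall>\<alpha>\<in>\<sigma>. \<forall>\<beta>\<in>\<sigma>. K \<alpha> \<beta>)"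
    and card: "2 \<le> CARD('v)"
begin

lemma face_arrows: "\<sigma> \<in> \<Delta> \<Longrightarrow> \<sigma> \<subseteq> arrows"
  using face_iff admissible_arrows by blast

lemma face_subset: "\<sigma> \<in> \<Delta> \<Longrightarrow> \<tau> \<subseteq> \<sigma> \<Longrightarrow> \<tau> \<in> \<Delta>"
  unfolding face_iff admissible_def by (meson order_trans subsetD)

lemma face_clique_flow:
  assumes s: "\<sigma> \<in> \<Delta>" and n: "\<And>i j. 0 \<le> f i j" and supp: "\<And>i j. (i, j) \<notin> \<sigma> \<Longrightarrow> f i j = 0"
  shows "clique_flow K (neg_part (flow_point f)) (pos_part (flow_point f)) f"
proof -
  have "flow (neg_part (flow_point f)) (pos_part (flow_point f)) f"
    using admissible_flow[of \<sigma> f] s n supp face_iff by blast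
  moreover have "(i, j) \<in> \<sigma>" if "0 < f i j" for i j using supp[of i j] that by fastforce
  ultimately show ?thesis using s unfolding clique_flow_def face_iff by blast
qed

lemma hull_clique_flow:
  assumes "\<sigma> \<in> \<Delta>" "x \<in> convex hull (arrow_vertex ` \<sigma>)"
  obtains f where "clique_flow K (neg_part x) (pos_part x) f" "\<And>i j. (i, j) \<notin> \<sigma> \<Longrightarrow> f i j = 0" "x \<in> l1_sphere"
proof -
  obtain f where f: "\<forall>i j. 0 \<le> f i j" "\<forall>i j. (i, j) \<notin> \<sigma> \<longrightarrow> f i j = 0"
      "(\<Sum>\<alpha>\<in>UNIV. f (tail \<alpha>) (head \<alpha>)) = 1" "flow_point f = x"
    using assms(2) unfolding hull_iff_flow_point[OF face_arrows[OF assms(1)]] by blast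
  have c: "clique_flow K (neg_part x) (pos_part x) f" using face_clique_flow[OF assms(1)] f by metis
  have "(\<Sum>v\<in>UNIV. x $ v) = 0" using flow_point_sum f(4) by metis
  then have "x \<in> l1_sphere"
    using l1_norm_parts[of x] flow_total[of "neg_part x" "pos_part x" f] c f(3) by (simp add: l1_sphere_def clique_flow_def)
  then show thesis using that[OF c] f(2) by blast
qed

lemma represents_imp_clique_flow:
  assumes "represents_boundary_triangulation \<Delta>" "x \<in> l1_sphere"
  shows "\<exists>f. clique_flow K (neg_part x) (pos_part x) f"
proof -
  have "x \<in> (\<Union>\<sigma>\<in>\<Delta>. convex hull (arrow_vertex ` \<sigma>))"
    using assms rel_frontier_root_polytope[OF card] unfolding represents_boundary_triangulation_def by simp
  then show ?thesis using hull_clique_flow by blast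
qed

lemma represents_imp_balanced_clique_flow:
  assumes rep: "represents_boundary_triangulation \<Delta>" and bal: "balanced a b" and total: "sum a UNIV = 1"
  shows "\<exists>f. clique_flow K a b f"
proof -
  define x :: "(real, 'v) vec" where "x = (\<chi> v. b v - a v)"
  have z: "0 \<le> a v \<and> 0 \<le> b v \<and> (a v = 0 \<or> b v = 0)" for v using bal by (simp add: balanced_def)
  have parts: "neg_part x = a" "pos_part x = b"
    using z by (auto simp: fun_eq_iff neg_part_def pos_part_def x_def) (smt (verit))+
  have s: "(\<Sum>v\<in>UNIV. x $ v) = 0" using bal by (simp add: x_def balanced_def sum_subtractf)
  then have "x \<in> l1_sphere" using l1_norm_parts[OF s] total by (simp add: l1_sphere_def parts)
  then show ?thesis using represents_imp_clique_flow[OF rep] parts by metis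
qed

text \<open>Barycentric coordinates in a face are the entries of a clique flow. A point in two hulls
  therefore has one flow, supported on both faces, and a point of the sphere lies in the hull of the
  support of its flow.\<close>

lemma represents_if_solvable:
  assumes solv: "solvable K"
  shows "represents_boundary_triangulation \<Delta>"
proof -
  have unique: "f = g" if "clique_flow K (neg_part x) (pos_part x) f" "clique_flow K (neg_part x) (pos_part x) g"
    "(\<Sum>v\<in>UNIV. x $ v) = 0" for x f g
    using solv balanced_parts[OF that(3)] that unfolding solvable_def by blast
  have indep: "\<not> affine_dependent (arrow_vertex ` \<sigma>)" if s: "\<sigma> \<in> \<Delta>" for \<sigma>
  proof
    have inj: "inj_on arrow_vertex \<sigma>" using inj_arrow_vertex face_arrows[OF s] by (rule inj_on_subset)
    \<comment> \<open>A dependency \<open>U\<close> perturbs the constant flow \<open>M\<close> on \<open>\<sigma>\<close> to a second clique flow of the same point.\<close>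
    assume "affine_dependent (arrow_vertex ` \<sigma>)"
    then obtain U where U: "\<exists>v\<in>arrow_vertex ` \<sigma>. U v \<noteq> 0" "(\<Sum>v\<in>arrow_vertex ` \<sigma>. U v *\<^sub>R v) = 0"
      by (auto simp: affine_dependent_explicit_finite)
    define M where "M = (\<Sum>v\<in>arrow_vertex ` \<sigma>. \<bar>U v\<bar>)"
    have M: "\<bar>U v\<bar> \<le> M" if "v \<in> arrow_vertex ` \<sigma>" for v
      unfolding M_def using that by (intro member_le_sum) auto
    define f where "f i j = (if (i, j) \<in> \<sigma> then M else 0)" for i j
    define g where "g i j = (if (i, j) \<in> \<sigma> then M + U (arrow_vertex (i, j)) else 0)" for i j
    have "0 \<le> M" by (simp add: M_def sum_nonneg)
    have fn: "0 \<le> f i j" for i j using \<open>0 \<le> M\<close> by (simp add: f_def)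
    have gn: "0 \<le> g i j" for i j using M[of "arrow_vertex (i, j)"] by (auto simp: g_def)
    have "flow_point g - flow_point f = (\<Sum>\<alpha>\<in>UNIV. (if \<alpha> \<in> \<sigma> then U (arrow_vertex \<alpha>) *\<^sub>R arrow_vertex \<alpha> else 0))"
      unfolding flow_point_def sum_subtractf[symmetric]
      by (intro sum.cong) (auto simp: f_def g_def algebra_simps)
    also have "\<dots> = (\<Sum>\<alpha>\<in>\<sigma>. U (arrow_vertex \<alpha>) *\<^sub>R arrow_vertex \<alpha>)" by (simp add: sum.If_cases)
    also have "\<dots> = 0" using U(2) by (simp add: sum.reindex[OF inj])
    finally have eq: "flow_point g = flow_point f" by simp
    have cf: "clique_flow K (neg_part (flow_point f)) (pos_part (flow_point f)) f"
      by (rule face_clique_flow[OF s fn]) (simp add: f_def)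
    have cg: "clique_flow K (neg_part (flow_point g)) (pos_part (flow_point g)) g"
      by (rule face_clique_flow[OF s gn]) (simp add: g_def)
    have "f = g" using unique[OF cf cg[unfolded eq] flow_point_sum] .
    have "U (arrow_vertex \<alpha>) = 0" if "\<alpha> \<in> \<sigma>" for \<alpha>
    proof -
      have "f (tail \<alpha>) (head \<alpha>) = g (tail \<alpha>) (head \<alpha>)" using \<open>f = g\<close> by simp
      then show ?thesis using that by (simp add: f_def g_def)
    qed
    then show False using U(1) by auto
  qed
  have inter: "convex hull (arrow_vertex ` \<sigma>) \<inter> convex hull (arrow_vertex ` \<tau>) = convex hull (arrow_vertex ` (\<sigma> \<inter> \<tau>))"
    if s: "\<sigma> \<in> \<Delta>" and t: "\<tau> \<in> \<Delta>" for \<sigma> \<tau>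
  proof
    show "convex hull (arrow_vertex ` (\<sigma> \<inter> \<tau>)) \<subseteq> convex hull (arrow_vertex ` \<sigma>) \<inter> convex hull (arrow_vertex ` \<tau>)"
      by (simp add: hull_mono image_mono)
    show "convex hull (arrow_vertex ` \<sigma>) \<inter> convex hull (arrow_vertex ` \<tau>) \<subseteq> convex hull (arrow_vertex ` (\<sigma> \<inter> \<tau>))"
    proof
      fix x assume x: "x \<in> convex hull (arrow_vertex ` \<sigma>) \<inter> convex hull (arrow_vertex ` \<tau>)"
      obtain f where f: "clique_flow K (neg_part x) (pos_part x) f" "\<And>i j. (i, j) \<notin> \<sigma> \<Longrightarrow> f i j = 0" "x \<in> l1_sphere"
        using hull_clique_flow[OF s] x by blast
      obtain g where g: "clique_flow K (neg_part x) (pos_part x) g" "\<And>i j. (i, j) \<notin> \<tau> \<Longrightarrow> g i j = 0"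
        using hull_clique_flow[OF t] x by blast
      have "f = g" using unique[OF f(1) g(1)] f(3) by (simp add: l1_sphere_def)
      then have "(i, j) \<in> \<sigma> \<inter> \<tau>" if "0 < f i j" for i j using f(2)[of i j] g(2)[of i j] that by fastforce
      moreover have "\<sigma> \<inter> \<tau> \<subseteq> arrows" using face_arrows[OF s] by blast
      ultimately show "x \<in> convex hull (arrow_vertex ` (\<sigma> \<inter> \<tau>))"
        using l1_sphere_flow_in_hull[OF f(3), of f "\<sigma> \<inter> \<tau>"] f(1) by (simp add: clique_flow_def)
    qed
  qed
  have face: "F face_of convex hull (arrow_vertex ` \<sigma>) \<longleftrightarrow> (\<exists>\<tau>\<subseteq>\<sigma>. F = convex hull (arrow_vertex ` \<tau>))"
    if "\<sigma> \<in> \<Delta>" for F \<sigma>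
    using face_of_convex_hull_affine_independent[OF indep[OF that], of F] by (metis subset_imageE image_mono)
  have "simplicial_complex ((\<lambda>\<sigma>. convex hull (arrow_vertex ` \<sigma>)) ` \<Delta>)"
    unfolding simplicial_complex_def
  proof (intro conjI ballI allI impI)
    show "finite ((\<lambda>\<sigma>. convex hull (arrow_vertex ` \<sigma>)) ` \<Delta>)" by (intro finite_imageI finite)
    fix S assume "S \<in> (\<lambda>\<sigma>. convex hull (arrow_vertex ` \<sigma>)) ` \<Delta>"
    then obtain \<sigma> where s: "\<sigma> \<in> \<Delta>" "S = convex hull (arrow_vertex ` \<sigma>)" by blast
    \<comment> \<open>The empty face is included, as a simplex of dimension \<open>-1\<close>; hence
      the integer subtraction.\<close>
    show "\<exists>n. n simplex S"
      unfolding simplex_def s(2) using indep[OF s(1)]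
      by (intro exI[of _ "int (card (arrow_vertex ` \<sigma>)) - 1"] exI[of _ "arrow_vertex ` \<sigma>"]) simp
  next
    fix F S assume "S \<in> (\<lambda>\<sigma>. convex hull (arrow_vertex ` \<sigma>)) ` \<Delta> \<and> F face_of S"
    then show "F \<in> (\<lambda>\<sigma>. convex hull (arrow_vertex ` \<sigma>)) ` \<Delta>" using face face_subset by blast
  next
    fix S S' assume "S \<in> (\<lambda>\<sigma>. convex hull (arrow_vertex ` \<sigma>)) ` \<Delta> \<and> S' \<in> (\<lambda>\<sigma>. convex hull (arrow_vertex ` \<sigma>)) ` \<Delta>"
    then obtain \<sigma> \<tau> where "\<sigma> \<in> \<Delta>" "S = convex hull (arrow_vertex ` \<sigma>)" "\<tau> \<in> \<Delta>" "S' = convex hull (arrow_vertex ` \<tau>)" by blast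
    then show "(S \<inter> S') face_of S" using inter face by blast
  qed
  moreover have "(\<Union>\<sigma>\<in>\<Delta>. convex hull (arrow_vertex ` \<sigma>)) = l1_sphere"
  proof
    show "(\<Union>\<sigma>\<in>\<Delta>. convex hull (arrow_vertex ` \<sigma>)) \<subseteq> l1_sphere" using hull_clique_flow by blast
    show "l1_sphere \<subseteq> (\<Union>\<sigma>\<in>\<Delta>. convex hull (arrow_vertex ` \<sigma>))"
    proof
      fix x :: "(real, 'v) vec" assume x: "x \<in> l1_sphere"
      then have bal: "balanced (neg_part x) (pos_part x)" using balanced_parts[of x] by (simp add: l1_sphere_def)
      then obtain f where f: "clique_flow K (neg_part x) (pos_part x) f" using solv unfolding solvable_def by blast
      then have fl: "flow (neg_part x) (pos_part x) f" by (simp add: clique_flow_def)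
      define \<sigma> where "\<sigma> = {(i, j). 0 < f i j}"
      have "\<sigma> \<subseteq> {v. 0 < neg_part x v} \<times> {v. 0 < pos_part x v}"
        using balanced_flow(3,4)[OF bal fl] by (auto simp: \<sigma>_def)
      moreover have "{v. 0 < neg_part x v} \<inter> {v. 0 < pos_part x v} = {}"
        by (auto simp: neg_part_def pos_part_def)
      ultimately have "admissible \<sigma>" unfolding admissible_def by blast
      then have "\<sigma> \<in> \<Delta>" using f unfolding face_iff clique_flow_def by (auto simp: \<sigma>_def)
      moreover from this have "x \<in> convex hull (arrow_vertex ` \<sigma>)"
        using l1_sphere_flow_in_hull[OF x fl face_arrows] by (simp add: \<sigma>_def)
      ultimately show "x \<in> (\<Union>\<sigma>\<in>\<Delta>. convex hull (arrow_vertex ` \<sigma>))" by blast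
    qed
  qed
  ultimately show ?thesis
    unfolding represents_boundary_triangulation_def using indep rel_frontier_root_polytope[OF card] by simp
qed

end

lemma three_nodes_balanced:
  fixes p1 p2 p3 q1 q2 q3 :: "'v::finite"
  assumes "distinct [p1, p2, p3, q1, q2, q3]"
  shows "balanced (\<lambda>v. if v \<in> {p1, p2, p3} then 1 / 3 else 0) (\<lambda>v. if v \<in> {q1, q2, q3} then 1 / 3 else 0)"
    and "(\<Sum>v\<in>UNIV. if v \<in> {p1, p2, p3} then 1 / 3 else 0 :: real) = 1"
proof -
  have *: "(\<Sum>v\<in>UNIV. if v \<in> {x, y, z} then 1 / 3 else 0 :: real) = 1" if "distinct [x, y, z]" for x y z :: 'v
  proof -
    have "card {x, y, z} = 3" using that by simp
    then show ?thesis by (simp add: sum.If_cases del: insert_iff)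
  qed
  show "(\<Sum>v\<in>UNIV. if v \<in> {p1, p2, p3} then 1 / 3 else 0 :: real) = 1" using assms by (intro *) simp
  moreover have "(\<Sum>v\<in>UNIV. if v \<in> {q1, q2, q3} then 1 / 3 else 0 :: real) = 1" using assms by (intro *) simp
  moreover have "{p1, p2, p3} \<inter> {q1, q2, q3} = {}" using assms by auto
  ultimately show "balanced (\<lambda>v. if v \<in> {p1, p2, p3} then 1 / 3 else 0) (\<lambda>v. if v \<in> {q1, q2, q3} then 1 / 3 else 0)"
    unfolding balanced_def by (simp only:) auto
qed

text \<open>If \<open>THTH\<close> and \<open>HTHT\<close> agree, the barycentric problem on
  \<open>THTHHT\<close> forces the bit of \<open>THHT\<close> to equal theirs, and the problem with
  roles reversed does the same for \<open>HTTH\<close>. If they differ,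
  \<open>permissible_nests\<close> supplies the remaining clause.\<close>

lemma represents_iff_triangulating:
  fixes \<Delta> :: "'v::{finite,linorder} arrow set set"
  assumes six: "6 \<le> CARD('v)" and perm: "permissible \<Delta>" and u: "uniform_flag_complex \<Delta>"
  shows "represents_boundary_triangulation \<Delta> \<longleftrightarrow>
    triangulating (nest \<Delta> [T, T, H, H]) (nest \<Delta> [H, H, T, T]) (nest \<Delta> [T, H, T, H])
      (nest \<Delta> [H, T, H, T]) (cross \<Delta> [T, H, H, T]) (cross \<Delta> [H, T, T, H])"
proof -
  interpret compatible_faces \<Delta> "complex_compat \<Delta>"
    using face_iff_compat[OF perm u] six by unfold_locales auto
  show ?thesis
  proof
    assume rep: "represents_boundary_triangulation \<Delta>"
    obtain p1 p2 p3 p4 p5 p6 :: 'v where p: "p1 < p2" "p2 < p3" "p3 < p4" "p4 < p5" "p5 < p6"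
      using six_nodes[OF six] by metis
    have dist: "distinct [p1, p3, p6, p2, p4, p5]" "distinct [p2, p4, p5, p1, p3, p6]" using p by auto
    let ?c = "\<lambda>S v. if v \<in> S then 1 / 3 else 0 :: real"
    obtain f where f: "clique_flow (complex_compat \<Delta>) (?c {p1, p3, p6}) (?c {p2, p4, p5}) f"
      using represents_imp_balanced_clique_flow[OF rep three_nodes_balanced[OF dist(1)]] by blast
    obtain g where "clique_flow (complex_compat \<Delta>) (?c {p2, p4, p5}) (?c {p1, p3, p6}) g"
      using represents_imp_balanced_clique_flow[OF rep three_nodes_balanced[OF dist(2)]] by blast
    then have g: "clique_flow (compat (nest \<Delta> [H, H, T, T]) (nest \<Delta> [T, T, H, H]) (nest \<Delta> [H, T, H, T])
        (nest \<Delta> [T, H, T, H]) (cross \<Delta> [H, T, T, H]) (cross \<Delta> [T, H, H, T]))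
        (?c {p1, p3, p6}) (?c {p2, p4, p5}) (flip g)"
      by (simp only: clique_flow_flip)
    have "0 < (1 / 3 :: real)" by simp
    note transportation_obstruction[OF p this f] transportation_obstruction[OF p this g]
    then show "triangulating (nest \<Delta> [T, T, H, H]) (nest \<Delta> [H, H, T, T]) (nest \<Delta> [T, H, T, H])
        (nest \<Delta> [H, T, H, T]) (cross \<Delta> [T, H, H, T]) (cross \<Delta> [H, T, T, H])"
      using permissible_nests[OF perm u six] unfolding triangulating_def by argo
  next
    assume "triangulating (nest \<Delta> [T, T, H, H]) (nest \<Delta> [H, H, T, T]) (nest \<Delta> [T, H, T, H])
        (nest \<Delta> [H, T, H, T]) (cross \<Delta> [T, H, H, T]) (cross \<Delta> [H, T, T, H])"
    then show "represents_boundary_triangulation \<Delta>"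
      using represents_if_solvable solvable_if_triangulating by blast
  qed
qed

theorem theorem3p2:
  fixes n :: nat and \<Delta> :: "'v::{finite,linorder} arrow set set"
  assumes "n \<ge> 5" and "CARD('v) = n + 1"
    and "permissible \<Delta>" and "uniform_flag_complex \<Delta>"
  shows "represents_boundary_triangulation \<Delta> \<longleftrightarrow>
    exactly_one_of_three
      (do_not_nest \<Delta> [T,H,T,H] \<and> do_not_nest \<Delta> [H,T,H,T] \<and>
        do_not_cross \<Delta> [H,T,T,H] \<and> do_not_cross \<Delta> [T,H,H,T])
      (nest \<Delta> [T,H,T,H] \<and> nest \<Delta> [H,T,H,T] \<and>
        cross \<Delta> [H,T,T,H] \<and> cross \<Delta> [T,H,H,T])
      ((nest \<Delta> [T,H,T,H] \<noteq> nest \<Delta> [H,T,H,T]) \<and>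
        (cross \<Delta> [T,H,H,T] \<and> cross \<Delta> [H,T,T,H] \<longrightarrow>
          nest \<Delta> [T,T,H,H] \<and> nest \<Delta> [H,H,T,T]))"
proof -
  have card: "6 \<le> CARD('v)" using assms(1,2) by simp
  obtain p1 p2 p3 p4 p5 p6 :: 'v where p: "p1 < p2" "p2 < p3" "p3 < p4" "p4 < p5" "p5 < p6"
    using six_nodes[OF card] by metis
  \<comment> \<open>Any four ordered nodes serve: they turn each negated property into the negation
    of the positive one.\<close>
  note types = edge_types(7-10)[OF assms(4) p(1-3)]
  show ?thesis
    unfolding represents_iff_triangulating[OF card assms(3,4)] types triangulating_def exactly_one_of_three_def
    by argo
qed

end
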